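(* Let $Z\subset(\mathbb{C}^\times)^n$ be a very affine linear space which admits $\mathbb{P}^n$ as an snc-compactifying variety, let $\overline{Z}$ be its closure in $\mathbb{P}^n$, $Z^{\log}$ the Kato–Nakayama space of $(\overline{Z},\overline{Z}\setminus Z)$, $\Theta=\mathrm{ang}(Z)$ and $\Theta^{\log}=\mathrm{ang}(Z^{\log})$. Then in the commutative square formed by the inclusion $Z\hookrightarrow Z^{\log}$, the inclusion $\Theta\hookrightarrow\Theta^{\log}$, the angle map $Z\to\Theta$ and the extended angle map $Z^{\log}\to\Theta^{\log}$, all four maps are homotopy equivalences. Moreover, for every subset $S\subsetneq\{0,\dots,n\}$ with $Z_S\neq\emptyset$, the restricted extended angle map $Z^{\log}_S\to\Theta^{\log}_S$ is a homotopy equivalence, and for $S\subset S'$ the squares formed by the inclusions $Z^{\log}_{S'}\subset Z^{\log}_S\subset Z^{\log}$, $\Theta^{\log}_{S'}\subset\Theta^{\log}_S\subset\Theta^{\log}$ and the angle maps commute.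
   Context: A very affine linear space is a nonempty closed subvariety $Z\subset(\mathbb{C}^\times)^n$ whose ideal in $\mathbb{C}[x_1^{\pm1},\dots,x_n^{\pm1}]$ is generated by affine linear polynomials. Identify $(\mathbb{C}^\times)^n$ with the torus of $\mathbb{P}^n$ via $x_i=X_i/X_0$. $Z$ admits $\mathbb{P}^n$ as an snc-compactifying variety if $\overline{Z}\setminus Z$ is a strict normal crossings divisor in the closure $\overline{Z}\subset\mathbb{P}^n$. Kato–Nakayama space: for a smooth complex variety $\overline{Z}$ with snc divisor $\partial$ and $Z=\overline Z\setminus\partial$, let $\mathcal{M}_x\subset\mathcal{O}_{\overline Z,x}$ be the monoid of germs of functions invertible on the complement of $\partial$ and $\mathcal{M}_x^{\rm gp}$ its group completion. $Z^{\log}$ is the set of pairs $(x,h)$ with $x\in\overline{Z}(\mathbb{C})$ and $h\colon\mathcal{M}^{\rm gp}_x\to S^1$ a group homomorphism with $h(f)=f(x)/|f(x)|$ for units $f\in\mathcal{O}^\times_{\overline Z,x}$; its topology is the weakest making $\pi\colon(x,h)\mapsto x$ continuous and, for every open $U$ and function $f$ on $U$ invertible off $\partial$, the map $\pi^{-1}(U)\to S^1$, $(x,h)\mapsto h(f)$ continuous. $Z$ embeds in $Z^{\log}$ by $x\mapsto (x, f\mapsto f(x)/|f(x)|)$. Extended angle map: the coordinates $x_1,\dots,x_n$ are invertible on $Z$, so define $\mathrm{ang}\colon Z^{\log}\to(S^1)^n$, $(x,h)\mapsto (h(x_1),\dots,h(x_n))$; on $Z$ it is $x\mapsto (x_j/|x_j|)_j$.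 Strata: for $S\subset\{0,\dots,n\}$ put $Z_S=\overline Z\cap V(X_i: i\in S)$, $Z^{\log}_S=\pi^{-1}(Z_S)$ and $\Theta^{\log}_S=\mathrm{ang}(Z^{\log}_S)$. *)

theory Defs
  imports "HOL-Analysis.Analysis"
begin

(* Points of C^{n+1} (homogeneous coordinates X_0..X_n) and of (C^x)^n (coordinates x_1..x_n)
   are modelled as functions nat => complex, with coordinates outside the relevant
   index range equal to 0.  nat => complex carries the product topology, which on
   such finitely supported vectors is the Euclidean topology. *)
type_synonym vec = "nat \<Rightarrow> complex"

definition Cn1 :: "nat \<Rightarrow> vec set" where
  "Cn1 n = {v. \<forall>i>n. v i = 0}"

(* the point of P^n with homogeneous coordinate vector v (v nonzero): the punctured line *)
definition ppt :: "vec \<Rightarrow> vec set" where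
  "ppt v = {(\<lambda>i. c * v i) | c. c \<noteq> 0}"

definition Pn :: "nat \<Rightarrow> vec set set" where
  "Pn n = ppt ` (Cn1 n - {\<lambda>i. 0})"

(* quotient topology on P^n = (C^{n+1} - 0) / C^x *)
definition Ptop :: "nat \<Rightarrow> vec set topology" where
  "Ptop n = topology_generated_by
     {U. U \<subseteq> Pn n \<and> openin (top_of_set (Cn1 n - {\<lambda>i. 0})) (\<Union>U)}"

definition torus :: "nat \<Rightarrow> vec set" where
  "torus n = {x. (\<forall>i. 1 \<le> i \<and> i \<le> n \<longrightarrow> x i \<noteq> 0) \<and> (\<forall>i. (i = 0 \<or> n < i) \<longrightarrow> x i = 0)}"

definition torus_to_P :: "vec \<Rightarrow> vec set" where
  "torus_to_P x = ppt (\<lambda>i. if i = 0 then 1 else x i)"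

definition very_affine_linear :: "nat \<Rightarrow> vec set \<Rightarrow> bool" where
  "very_affine_linear n Z \<longleftrightarrow> Z \<noteq> {} \<and> Z \<subseteq> torus n \<and>
     (\<exists>F :: (vec \<times> complex) set. finite F \<and>
        Z = {x \<in> torus n. \<forall>(a, b) \<in> F. (\<Sum>i\<in>{1..n}. a i * x i) = b})"

definition Zbar :: "nat \<Rightarrow> vec set \<Rightarrow> vec set set" where
  "Zbar n Z = (Ptop n) closure_of (torus_to_P ` Z)"

definition Zbdry :: "nat \<Rightarrow> vec set \<Rightarrow> vec set set" where
  "Zbdry n Z = Zbar n Z - torus_to_P ` Z"

definition Zbar_top :: "nat \<Rightarrow> vec set \<Rightarrow> vec set topology" where
  "Zbar_top n Z = subtopology (Ptop n) (Zbar n Z)"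

definition Zstr :: "nat \<Rightarrow> vec set \<Rightarrow> nat set \<Rightarrow> vec set set" where
  "Zstr n Z S = {p \<in> Zbar n Z. \<forall>i\<in>S. \<forall>v\<in>p. v i = 0}"

definition snc_compactifying :: "nat \<Rightarrow> vec set \<Rightarrow> bool" where
  "snc_compactifying n Z \<longleftrightarrow>
     (\<forall>S \<subseteq> {0..n}.
        (\<forall>i\<in>S. \<forall>j\<in>S. i \<noteq> j \<longrightarrow> Zstr n Z {i} \<noteq> Zstr n Z {j}) \<and> Zstr n Z S \<noteq> {}
        \<longrightarrow> (\<forall>c :: nat \<Rightarrow> complex.
               (\<forall>p\<in>Zbar n Z. \<forall>v\<in>p. (\<Sum>i\<in>S. c i * v i) = 0) \<longrightarrow> (\<forall>i\<in>S. c i = 0)))"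

inductive_set polyfun :: "(vec \<Rightarrow> complex) set" where
  pconst: "(\<lambda>v. c) \<in> polyfun"
| pcoord: "(\<lambda>v. v i) \<in> polyfun"
| padd: "f \<in> polyfun \<Longrightarrow> g \<in> polyfun \<Longrightarrow> (\<lambda>v. f v + g v) \<in> polyfun"
| pmult: "f \<in> polyfun \<Longrightarrow> g \<in> polyfun \<Longrightarrow> (\<lambda>v. f v * g v) \<in> polyfun"

definition homog_poly :: "nat \<Rightarrow> (vec \<Rightarrow> complex) \<Rightarrow> bool" where
  "homog_poly d g \<longleftrightarrow> g \<in> polyfun \<and> (\<forall>c v. g (\<lambda>i. c * v i) = c ^ d * g v)"

definition regular_on :: "nat \<Rightarrow> vec set \<Rightarrow> vec set set \<Rightarrow> (vec set \<Rightarrow> complex) \<Rightarrow> bool" where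
  "regular_on n Z U f \<longleftrightarrow> openin (Zbar_top n Z) U \<and>
     (\<forall>p\<in>U. \<exists>W d g h. openin (Zbar_top n Z) W \<and> p \<in> W \<and> W \<subseteq> U \<and>
        homog_poly d g \<and> homog_poly d h \<and>
        (\<forall>q\<in>W. \<forall>v\<in>q. h v \<noteq> 0 \<and> f q = g v / h v))"

definition logfun_on :: "nat \<Rightarrow> vec set \<Rightarrow> vec set set \<Rightarrow> (vec set \<Rightarrow> complex) \<Rightarrow> bool" where
  "logfun_on n Z U f \<longleftrightarrow> regular_on n Z U f \<and> (\<forall>q \<in> U - Zbdry n Z. f q \<noteq> 0)"

(* the monoid M_p (represented by functions; germs = functions up to agreement near p) *)
definition Mon :: "nat \<Rightarrow> vec set \<Rightarrow> vec set \<Rightarrow> (vec set \<Rightarrow> complex) set" where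
  "Mon n Z p = {f. \<exists>U. p \<in> U \<and> logfun_on n Z U f}"

definition same_germ :: "nat \<Rightarrow> vec set \<Rightarrow> vec set \<Rightarrow> (vec set \<Rightarrow> complex) \<Rightarrow> (vec set \<Rightarrow> complex) \<Rightarrow> bool" where
  "same_germ n Z p f g \<longleftrightarrow> (\<exists>U. openin (Zbar_top n Z) U \<and> p \<in> U \<and> (\<forall>q\<in>U. f q = g q))"

(* h : M_p^gp \<rightarrow> S^1 group homomorphism, equivalently a monoid homomorphism M_p \<rightarrow> S^1
   on germs, restricting to u \<mapsto> u(p)/|u(p)| on units of O_p; normalised to 1 off M_p *)
definition KN_hom :: "nat \<Rightarrow> vec set \<Rightarrow> vec set \<Rightarrow> ((vec set \<Rightarrow> complex) \<Rightarrow> complex) \<Rightarrow> bool" where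
  "KN_hom n Z p h \<longleftrightarrow>
     (\<forall>f. f \<notin> Mon n Z p \<longrightarrow> h f = 1) \<and>
     (\<forall>f\<in>Mon n Z p. cmod (h f) = 1) \<and>
     (\<forall>f\<in>Mon n Z p. \<forall>g\<in>Mon n Z p. same_germ n Z p f g \<longrightarrow> h f = h g) \<and>
     (\<forall>f\<in>Mon n Z p. \<forall>g\<in>Mon n Z p. h (\<lambda>q. f q * g q) = h f * h g) \<and>
     (\<forall>f\<in>Mon n Z p. f p \<noteq> 0 \<longrightarrow> h f = f p / complex_of_real (cmod (f p)))"

type_synonym KNpt = "vec set \<times> ((vec set \<Rightarrow> complex) \<Rightarrow> complex)"

definition Zlog :: "nat \<Rightarrow> vec set \<Rightarrow> KNpt set" where
  "Zlog n Z = {(p, h). p \<in> Zbar n Z \<and> KN_hom n Z p h}"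

definition Zlog_top :: "nat \<Rightarrow> vec set \<Rightarrow> KNpt topology" where
  "Zlog_top n Z = topology_generated_by
     ({{(p, h) \<in> Zlog n Z. p \<in> V} | V. openin (Zbar_top n Z) V} \<union>
      {{(p, h) \<in> Zlog n Z. p \<in> U \<and> h f \<in> W} | U f W. logfun_on n Z U f \<and> open W})"

definition Zemb :: "nat \<Rightarrow> vec set \<Rightarrow> vec \<Rightarrow> KNpt" where
  "Zemb n Z x = (torus_to_P x,
     (\<lambda>f. if f \<in> Mon n Z (torus_to_P x)
          then f (torus_to_P x) / complex_of_real (cmod (f (torus_to_P x))) else 1))"

definition ratio :: "nat \<Rightarrow> nat \<Rightarrow> vec set \<Rightarrow> complex" where
  "ratio a k q = (let v = (SOME v. v \<in> q) in v a / v k)"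

(* h(x_j) for x_j = X_j/X_0 = (X_j/X_k)/(X_0/X_k) in M_p^gp, X_k any coordinate nonzero at p *)
definition ang :: "nat \<Rightarrow> KNpt \<Rightarrow> vec" where
  "ang n z = (let p = fst z; h = snd z; k = (SOME k. k \<le> n \<and> (\<forall>v\<in>p. v k \<noteq> 0)) in
     (\<lambda>j. if 1 \<le> j \<and> j \<le> n then h (ratio j k) / h (ratio 0 k) else 0))"

definition angZ :: "nat \<Rightarrow> vec \<Rightarrow> vec" where
  "angZ n x = (\<lambda>j. if 1 \<le> j \<and> j \<le> n then x j / complex_of_real (cmod (x j)) else 0)"

definition Zlog_str :: "nat \<Rightarrow> vec set \<Rightarrow> nat set \<Rightarrow> KNpt set" where
  "Zlog_str n Z S = {z \<in> Zlog n Z. fst z \<in> Zstr n Z S}"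

definition homotopy_equivalence_map :: "'a topology \<Rightarrow> 'b topology \<Rightarrow> ('a \<Rightarrow> 'b) \<Rightarrow> bool" where
  "homotopy_equivalence_map X Y f \<longleftrightarrow> continuous_map X Y f \<and>
     (\<exists>g. continuous_map Y X g \<and>
          homotopic_with (\<lambda>x. True) X X (g \<circ> f) id \<and>
          homotopic_with (\<lambda>x. True) Y Y (f \<circ> g) id)"

end

theory Submission
  imports Defs "HOL-Computational_Algebra.Fundamental_Theorem_Algebra"
begin

text \<open>Let \<open>L\<close> be the linear span of the cone over \<open>Z\<close>. Near a point of the closure, a function that is
  invertible off the boundary is a unit times a monomial in the coordinates; hence a point of \<open>Z\<^sup>l\<^sup>o\<^sup>g\<close> is a
  vector of \<open>L\<close> (up to positive scaling) together with compatible phases of all coordinates, including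
  the vanishing ones, and the extended angle map forgets the vector.

  For \<open>\<theta>\<close> in the image of a stratum and \<open>t > 0\<close>, the vectors of \<open>L\<close> on the stratum whose coordinates have
  phases within angle \<open>arctan t\<close> of \<open>\<theta>\<close> form a convex cone; it is nonempty by the normal crossings
  condition, and it depends on \<open>(\<theta>, t)\<close> with open fibres. A partition of unity therefore yields
  a continuous selection \<open>G (t, \<theta>)\<close>, whose phases tend to \<open>\<theta>\<close> as \<open>t\<close> tends to \<open>0\<close>. The phases of \<open>G (t, \<theta>)\<close>
  and the straight lines towards \<open>G (t, \<theta>)\<close>, which stay inside the convex cones, provide all homotopies
  needed.\<close>

section \<open>Polynomial functions on linear spaces\<close>

text \<open>Two obstacles shape the proof. A point of the Kato-Nakayama space is a homomorphism on
  all germs of quotients of homogeneous polynomials, so nothing is explicit until the germs have a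
  normal form. The divisibility behind that normal form comes from a limit argument on the zeros of
  polynomials along a line, in place of unique factorisation or the Nullstellensatz.

  The second obstacle is that a phase vector at the boundary need not be the phase vector of any
  point of \<open>L\<close>, and that having exact phases is not an open condition. Allowing an
  error of slope \<open>t\<close> makes the condition open and convex. The same \<open>t\<close> is
  the homotopy time: the phase error and the size of the chosen vector are both bounded by multiples
  of \<open>t\<close>, so each deformation extends continuously to \<open>t = 0\<close>.

  Normal crossings enter at one point only, where the phases of vanishing coordinates are prescribed
  independently, one for each distinct hyperplane. Several coordinates may cut out the same
  hyperplane; their phases are then tied by a constant factor.\<close>

lemma poly_bound_if_no_root:
  fixes p :: "complex poly"
  assumes "degree p \<le> D" "\<And>z. cmod z < \<delta> \<Longrightarrow> poly p z \<noteq> 0" "cmod t \<le> \<delta>" "0 < \<delta>"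
  shows "cmod (poly p t) \<le> 2 ^ D * cmod (poly p 0)"
  using assms(1,2)
proof (induction D arbitrary: p)
  case 0
  then obtain c where "p = [:c:]"
    by (metis degree_eq_zeroE le_zero_eq)
  then show ?case by simp
next
  case (Suc D)
  show ?case
  proof (cases "degree p = 0")
    case True
    then obtain c where "p = [:c:]"
      by (metis degree_eq_zeroE)
    then show ?thesis
      using one_le_power[of "2::real" "Suc D"] by (simp add: mult_le_cancel_right1 del: power_Suc)
  next
    case False
    then obtain r where r: "poly p r = 0"
      using fundamental_theorem_of_algebra[of p] unfolding constant_degree by blast
    then obtain q where q: "p = [:-r, 1:] * q"
      using poly_eq_0_iff_dvd by (metis dvdE)
    have "q \<noteq> 0" using q False by auto
    then have "degree p = Suc (degree q)"
      unfolding q by (subst degree_mult_eq) auto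
    then have "degree q \<le> D" using Suc.prems by simp
    moreover have "poly q z \<noteq> 0" if "cmod z < \<delta>" for z
      using Suc.prems(2)[OF that] q by auto
    ultimately have IH: "cmod (poly q t) \<le> 2 ^ D * cmod (poly q 0)"
      using Suc.IH by blast
    \<comment> \<open>Since \<open>cmod t \<le> \<delta> \<le> cmod r\<close>, each linear factor
      grows by at most 2 between \<open>0\<close> and \<open>t\<close>. The resulting constant
      depends only on the degree, so the bound survives a limit of polynomials; it acts as an
      elementary form of Hurwitz's theorem.\<close>
    have "\<not> cmod r < \<delta>" using Suc.prems(2) r by blast
    then have "cmod (t - r) \<le> 2 * cmod r"
      using assms(3) norm_triangle_ineq4[of t r] by linarith
    then have "cmod (t - r) * cmod (poly q t) \<le> (2 * cmod r) * (2 ^ D * cmod (poly q 0))"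
      using IH by (intro mult_mono) auto
    moreover have "poly p t = (t - r) * poly q t" "poly p 0 = - r * poly q 0"
      by (simp_all add: q algebra_simps)
    ultimately show ?thesis by (simp add: norm_mult mult_ac)
  qed
qed

lemma continuous_on_coord: "continuous_on X (\<lambda>x :: vec. x i)"
  by (rule continuous_on_subset[OF continuous_on_product_coordinates]) simp

lemmas continuous_on_snd_coord =
  continuous_on_product_then_coordinatewise[OF continuous_on_snd[OF continuous_on_id]]

lemma polyfun_continuous_on: "g \<in> polyfun \<Longrightarrow> continuous_on A g"
  by (induction rule: polyfun.induct)
     (auto intro!: continuous_intros continuous_on_coord)

text \<open>The degree bound \<open>D\<close> is the same for all lines; this is what allows one
  constant in the root bound while the line moves.\<close>

lemma polyfun_line:
  assumes "g \<in> polyfun"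
  shows "\<exists>D. \<forall>b e. \<exists>p. degree p \<le> D \<and> (\<forall>t. g (\<lambda>i. b i + t * e i) = poly p t)"
  using assms
proof (induction rule: polyfun.induct)
  case (pconst c)
  show ?case by (rule exI[of _ 0], intro allI exI[of _ "[:c:]"]) simp
next
  case (pcoord i)
  show ?case
  proof (rule exI[of _ 1], intro allI)
    fix b e :: "nat \<Rightarrow> complex"
    show "\<exists>p. degree p \<le> 1 \<and> (\<forall>t. b i + t * e i = poly p t)"
      by (intro exI[of _ "[:b i, e i:]"]) simp
  qed
next
  case (padd f g)
  then obtain D E where
    D: "\<And>b e. \<exists>p. degree p \<le> D \<and> (\<forall>t. f (\<lambda>i. b i + t * e i) = poly p t)" and
    E: "\<And>b e. \<exists>p. degree p \<le> E \<and> (\<forall>t. g (\<lambda>i. b i + t * e i) = poly p t)" by metis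
  show ?case
  proof (intro exI[of _ "max D E"] allI)
    fix b e
    obtain p q where "degree p \<le> D" "\<And>t. f (\<lambda>i. b i + t * e i) = poly p t"
      "degree q \<le> E" "\<And>t. g (\<lambda>i. b i + t * e i) = poly q t" using D E by metis
    then show "\<exists>p. degree p \<le> max D E \<and>
        (\<forall>t. f (\<lambda>i. b i + t * e i) + g (\<lambda>i. b i + t * e i) = poly p t)"
      by (intro exI[of _ "p + q"])
        (auto intro: degree_add_le max.coboundedI1 max.coboundedI2)
  qed
next
  case (pmult f g)
  then obtain D E where
    D: "\<And>b e. \<exists>p. degree p \<le> D \<and> (\<forall>t. f (\<lambda>i. b i + t * e i) = poly p t)" and
    E: "\<And>b e. \<exists>p. degree p \<le> E \<and> (\<forall>t. g (\<lambda>i. b i + t * e i) = poly p t)" by metis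
  show ?case
  proof (intro exI[of _ "D + E"] allI)
    fix b e
    obtain p q where "degree p \<le> D" "\<And>t. f (\<lambda>i. b i + t * e i) = poly p t"
      "degree q \<le> E" "\<And>t. g (\<lambda>i. b i + t * e i) = poly q t" using D E by metis
    then show "\<exists>p. degree p \<le> D + E \<and>
        (\<forall>t. f (\<lambda>i. b i + t * e i) * g (\<lambda>i. b i + t * e i) = poly p t)"
      by (intro exI[of _ "p * q"]) (auto intro: order_trans[OF degree_mult_le add_mono])
  qed
qed

lemma polyfun_comp:
  assumes "g \<in> polyfun" "\<And>i. (\<lambda>v. \<pi> v i) \<in> polyfun"
  shows "(\<lambda>v. g (\<pi> v)) \<in> polyfun"
  using assms(1) by (induction rule: polyfun.induct) (auto intro: polyfun.intros assms(2))

lemma polyfun_sum: "(\<And>i. i \<in> A \<Longrightarrow> f i \<in> polyfun) \<Longrightarrow> (\<lambda>v. \<Sum>i\<in>A. f i v) \<in> polyfun"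
  by (induction A rule: infinite_finite_induct) (auto intro: polyfun.intros)

lemma polyfun_power: "f \<in> polyfun \<Longrightarrow> (\<lambda>v. f v ^ m) \<in> polyfun"
  by (induction m) (auto intro: polyfun.intros)

text \<open>The factor theorem along the direction \<open>e\<close>: when \<open>e i = 1\<close>,
  the vector \<open>v - v i * e\<close> is the projection of \<open>v\<close> to the hyperplane
  where the \<open>i\<close>-th coordinate vanishes, so a \<open>g\<close> that is zero there is
  divisible by that coordinate.\<close>

lemma polyfun_divide_coordinate:
  assumes "g \<in> polyfun"
  shows "\<exists>q\<in>polyfun. \<forall>v. g v = g (\<lambda>j. v j - v i * e j) + v i * q v"
  using assms
proof (induction rule: polyfun.induct)
  case (pconst c)
  show ?case by (intro bexI[of _ "\<lambda>v. 0"]) (auto intro: polyfun.intros)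
next
  case (pcoord j)
  show ?case by (intro bexI[of _ "\<lambda>v. e j"]) (auto intro: polyfun.intros)
next
  case (padd f g)
  obtain p where p: "p \<in> polyfun" "\<forall>v. f v = f (\<lambda>j. v j - v i * e j) + v i * p v"
    using padd.IH(1) by blast
  obtain q where q: "q \<in> polyfun" "\<forall>v. g v = g (\<lambda>j. v j - v i * e j) + v i * q v"
    using padd.IH(2) by blast
  show ?case
  proof (intro bexI[of _ "\<lambda>v. p v + q v"] allI)
    fix v
    define A B where "A = f (\<lambda>j. v j - v i * e j)" and "B = g (\<lambda>j. v j - v i * e j)"
    have "f v = A + v i * p v" "g v = B + v i * q v" unfolding A_def B_def using p(2) q(2) by blast+
    then show "f v + g v = f (\<lambda>j. v j - v i * e j) + g (\<lambda>j. v j - v i * e j) + v i * (p v + q v)"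
      unfolding A_def[symmetric] B_def[symmetric] by (simp add: algebra_simps)
  qed (rule polyfun.padd[OF p(1) q(1)])
next
  case (pmult f g)
  obtain p where p: "p \<in> polyfun" "\<forall>v. f v = f (\<lambda>j. v j - v i * e j) + v i * p v"
    using pmult.IH(1) by blast
  obtain q where q: "q \<in> polyfun" "\<forall>v. g v = g (\<lambda>j. v j - v i * e j) + v i * q v"
    using pmult.IH(2) by blast
  have P: "(\<lambda>v. g (\<lambda>j. v j - v i * e j)) \<in> polyfun"
  proof -
    have "(\<lambda>v. v j + (- e j) * v i) \<in> polyfun" for j by (intro polyfun.intros)
    then show ?thesis
      using polyfun_comp[OF pmult.hyps(2), of "\<lambda>v j. v j - v i * e j"]
      by (simp add: algebra_simps)
  qed
  \<comment> \<open>Product rule for differences: with primes for projected arguments,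
    \<open>f * g - f' * g' = f * (g - g') + (f - f') * g'\<close>.\<close>
  show ?case
  proof (intro bexI[of _ "\<lambda>v. f v * q v + p v * g (\<lambda>j. v j - v i * e j)"] allI)
    fix v
    define A B where "A = f (\<lambda>j. v j - v i * e j)" and "B = g (\<lambda>j. v j - v i * e j)"
    have "f v = A + v i * p v" "g v = B + v i * q v" unfolding A_def B_def using p(2) q(2) by blast+
    then show "f v * g v = f (\<lambda>j. v j - v i * e j) * g (\<lambda>j. v j - v i * e j)
        + v i * (f v * q v + p v * g (\<lambda>j. v j - v i * e j))"
      unfolding A_def[symmetric] B_def[symmetric] by (simp add: algebra_simps)
  qed (intro polyfun.padd polyfun.pmult P p(1) q(1) pmult.hyps)
qed

lemma nonzero_polyfun_along_line:
  assumes "g \<in> polyfun" "g (\<lambda>i. b i + t0 * e i) \<noteq> 0"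
  shows "finite {t. g (\<lambda>i. b i + t * e i) = 0}"
proof -
  obtain p where p: "\<And>t. g (\<lambda>i. b i + t * e i) = poly p t"
    using polyfun_line[OF assms(1)] by metis
  then have "p \<noteq> 0" using assms(2) by auto
  then show ?thesis using p poly_roots_finite by simp
qed

text \<open>Carries identities across the places where a coordinate or a scalar cannot be cancelled
  because it is zero.\<close>

lemma continuous_zero_at_puncture:
  fixes f :: "complex \<Rightarrow> complex"
  assumes "continuous_on UNIV f" "\<And>t. t \<noteq> a \<Longrightarrow> f t = 0"
  shows "f a = 0"
proof -
  have "(f \<longlongrightarrow> f a) (at a)"
    using assms(1) continuous_on_eq_continuous_at isContD by (metis UNIV_I open_UNIV)
  moreover have "(f \<longlongrightarrow> 0) (at a)"
    by (rule tendsto_eventually) (auto simp: eventually_at_filter assms(2))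
  ultimately show ?thesis using tendsto_unique[of "at a"] by auto
qed

lemma homog_poly_mult: "homog_poly d f \<Longrightarrow> homog_poly e g \<Longrightarrow> homog_poly (d + e) (\<lambda>v. f v * g v)"
  by (auto simp: homog_poly_def power_add intro: polyfun.intros)

lemma homog_poly_coord: "homog_poly 1 (\<lambda>v. v i)"
  by (auto simp: homog_poly_def intro: polyfun.intros)

lemma homog_poly_const: "homog_poly 0 (\<lambda>v. c)"
  by (auto simp: homog_poly_def intro: polyfun.intros)

lemma homog_poly_coord_power: "homog_poly m (\<lambda>v. v i ^ m)"
  by (auto simp: homog_poly_def power_mult_distrib intro: polyfun.intros polyfun_power)

section \<open>Linear subspaces and division by coordinates\<close>

definition linear_space :: "nat \<Rightarrow> vec set \<Rightarrow> vec set" where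
  "linear_space n A = {v \<in> Cn1 n. \<forall>a\<in>A. (\<Sum>i\<le>n. a i * v i) = 0}"

lemma linear_space_lincomb:
  assumes "u \<in> linear_space n A" "v \<in> linear_space n A"
  shows "(\<lambda>i. a * u i + b * v i) \<in> linear_space n A"
proof -
  have "(\<Sum>i\<le>n. c i * (a * u i + b * v i)) = a * (\<Sum>i\<le>n. c i * u i) + b * (\<Sum>i\<le>n. c i * v i)" for c
    by (simp add: sum_distrib_left sum.distrib algebra_simps)
  then show ?thesis
    using assms by (auto simp: linear_space_def Cn1_def)
qed

text \<open>\<open>homog_poly\<close> demands homogeneity for all vectors, but a quotient by a
  coordinate is controlled only on the linear space; composing with this projection makes it
  globally homogeneous. Each new form is killed by subtracting a multiple of a vector on which it is
  nonzero.\<close>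

lemma linear_space_projection:
  assumes "finite A"
  shows "\<exists>\<pi>. (\<forall>v. \<pi> v \<in> linear_space n A) \<and> (\<forall>v\<in>linear_space n A. \<pi> v = v)
    \<and> (\<forall>i. (\<lambda>v. \<pi> v i) \<in> polyfun) \<and> (\<forall>c v. \<pi> (\<lambda>i. c * v i) = (\<lambda>i. c * \<pi> v i))"
  using assms
proof (induction A rule: finite_induct)
  case empty
  have "(\<lambda>v. if i \<le> n then v i else 0) \<in> polyfun" for i
    by (cases "i \<le> n") (simp_all add: polyfun.intros)
  then show ?case
    by (intro exI[of _ "\<lambda>v i. if i \<le> n then v i else 0"])
      (auto simp: linear_space_def Cn1_def fun_eq_iff not_le)
next
  case (insert a A)
  then obtain \<pi> where \<pi>: "\<And>v. \<pi> v \<in> linear_space n A" "\<And>v. v \<in> linear_space n A \<Longrightarrow> \<pi> v = v"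
    "\<And>i. (\<lambda>v. \<pi> v i) \<in> polyfun" "\<And>c v. \<pi> (\<lambda>i. c * v i) = (\<lambda>i. c * \<pi> v i)" by blast
  define l where "l v = (\<Sum>i\<le>n. a i * v i)" for v :: vec
  have ins: "linear_space n (insert a A) = {v \<in> linear_space n A. l v = 0}"
    by (auto simp: linear_space_def l_def)
  show ?case
  proof (cases "\<forall>v\<in>linear_space n A. l v = 0")
    case True
    then have "linear_space n (insert a A) = linear_space n A" by (auto simp: ins)
    then show ?thesis using \<pi> by (intro exI[of _ \<pi>]) auto
  next
    case False
    then obtain e where e: "e \<in> linear_space n A" "l e \<noteq> 0" by blast
    define \<rho> where "\<rho> v = (\<lambda>i. 1 * \<pi> v i + (- l (\<pi> v) / l e) * e i)" for v
    have l: "l (\<lambda>i. b * u i + c * v i) = b * l u + c * l v" for b c u v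
      by (simp add: l_def sum_distrib_left sum.distrib algebra_simps)
    have "\<rho> v \<in> linear_space n (insert a A)" for v
    proof -
      have "\<rho> v \<in> linear_space n A" unfolding \<rho>_def by (rule linear_space_lincomb[OF \<pi>(1) e(1)])
      moreover have "l (\<rho> v) = 0" unfolding \<rho>_def by (subst l) (simp add: e(2))
      ultimately show ?thesis by (simp add: ins)
    qed
    moreover have "\<rho> v = v" if "v \<in> linear_space n (insert a A)" for v
      using that \<pi>(2) by (simp add: ins \<rho>_def)
    moreover have "(\<lambda>v. \<rho> v i) \<in> polyfun" for i
    proof -
      have "(\<lambda>v. l (\<pi> v)) \<in> polyfun"
        unfolding l_def by (intro polyfun_sum polyfun.pmult polyfun.pconst \<pi>(3))
      then have "(\<lambda>v. \<pi> v i + l (\<pi> v) * (- e i / l e)) \<in> polyfun"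
        by (intro polyfun.padd polyfun.pmult \<pi>(3) polyfun.pconst)
      then show ?thesis by (simp add: \<rho>_def algebra_simps)
    qed
    moreover have "\<rho> (\<lambda>i. c * v i) = (\<lambda>i. c * \<rho> v i)" for c v
    proof -
      have "l (\<lambda>i. c * u i) = c * l u" for u using l[of c u 0 u] by simp
      then show ?thesis by (simp add: \<rho>_def \<pi>(4) algebra_simps)
    qed
    ultimately show ?thesis by blast
  qed
qed

text \<open>Irreducibility of a linear space. On the line joining a good vector for \<open>I\<close>
  to a good vector for \<open>j\<close>, each polynomial is nonzero at one of the two ends, so only
  finitely many parameters are bad.\<close>

lemma linear_space_common_nonzero:
  assumes "finite I" "\<And>i. i \<in> I \<Longrightarrow> q i \<in> polyfun" "\<And>i. i \<in> I \<Longrightarrow> \<exists>c\<in>linear_space n A. q i c \<noteq> 0"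
  shows "\<exists>c\<in>linear_space n A. \<forall>i\<in>I. q i c \<noteq> 0"
  using assms
proof (induction I rule: finite_induct)
  case empty
  have "(\<lambda>i. 0) \<in> linear_space n A" by (simp add: linear_space_def Cn1_def)
  then show ?case by blast
next
  case (insert j I)
  then obtain c where c: "c \<in> linear_space n A" "\<And>i. i \<in> I \<Longrightarrow> q i c \<noteq> 0" by blast
  obtain d where d: "d \<in> linear_space n A" "q j d \<noteq> 0" using insert.prems by blast
  define B where "B i = {t. q i (\<lambda>k. c k + t * (d k - c k)) = 0}" for i
  have "finite (B i)" if "i \<in> insert j I" for i
  proof (cases "i = j")
    case True
    then show ?thesis unfolding B_def
      using d insert.prems(1)[of j] by (intro nonzero_polyfun_along_line[of _ _ 1]) auto
  next
    case False
    then show ?thesis unfolding B_def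
      using that c insert.prems(1)[of i] by (intro nonzero_polyfun_along_line[of _ _ 0]) auto
  qed
  then have "finite (\<Union>i\<in>insert j I. B i)" using insert.hyps by blast
  then obtain t where t: "t \<notin> (\<Union>i\<in>insert j I. B i)"
    using ex_new_if_finite[OF infinite_UNIV_char_0] by blast
  have "(\<lambda>k. (1 - t) * c k + t * d k) \<in> linear_space n A"
    by (rule linear_space_lincomb[OF c(1) d(1)])
  moreover have "(\<lambda>k. (1 - t) * c k + t * d k) = (\<lambda>k. c k + t * (d k - c k))"
    by (simp add: algebra_simps)
  ultimately show ?case using t unfolding B_def by (intro bexI[of _ "\<lambda>k. c k + t * (d k - c k)"]) auto
qed

text \<open>The zeros of \<^term>\<open>g\<close> on the line through \<^term>\<open>b\<close> in the direction \<^term>\<open>e\<close> move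
  continuously with \<^term>\<open>b\<close>. If \<^term>\<open>g v0 = 0\<close>, then for generic \<^term>\<open>b\<close> near \<^term>\<open>v0\<close> there would
  be a zero near \<^term>\<open>v0\<close>; it lies on one of the hyperplanes, so it is the projection of \<^term>\<open>b\<close>
  to that hyperplane along \<^term>\<open>e\<close>, and this is generic in the hyperplane.\<close>

lemma polyfun_nonzero_at_boundary:
  assumes g: "g \<in> polyfun" and v0: "v0 \<in> linear_space n A"
    and e: "e \<in> linear_space n A" "\<And>i. i \<le> n \<Longrightarrow> e i \<noteq> 0"
    and N: "open N" "v0 \<in> N"
    and nz: "\<And>v. v \<in> linear_space n A \<Longrightarrow> v \<in> N \<Longrightarrow> (\<And>i. i \<le> n \<Longrightarrow> v i \<noteq> 0) \<Longrightarrow> g v \<noteq> 0"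
    and H: "\<And>i. i \<le> n \<Longrightarrow> v0 i = 0 \<Longrightarrow> \<exists>u\<in>linear_space n A. u i = 0 \<and> g u \<noteq> 0"
  shows "g v0 \<noteq> 0"
proof
  assume g0: "g v0 = 0"
  let ?L = "linear_space n A"
  define T where "T = {i. i \<le> n \<and> v0 i = 0}"
  \<comment> \<open>The vector \<open>v0 + c\<close> projected along \<open>e\<close> to the
    \<open>i\<close>-th hyperplane; the \<open>i\<close>-th coordinate vanishes because
    \<open>v0 i = 0\<close> for \<open>i\<close> in \<open>T\<close>. For \<open>c = u - v0\<close>
    with \<open>u i = 0\<close> the projection is \<open>u\<close> itself.\<close>
  define q where "q i c = g (\<lambda>j. v0 j + (c j + c i * (- e j / e i)))" for i and c :: vec
  have "\<exists>c\<in>?L. \<forall>i\<in>T. q i c \<noteq> 0"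
  proof (rule linear_space_common_nonzero)
    show "finite T" by (simp add: T_def)
    show "q i \<in> polyfun" for i
    proof -
      have "(\<lambda>c. g (\<lambda>j. v0 j + (c j + c i * (- e j / e i)))) \<in> polyfun"
        by (rule polyfun_comp[OF g], intro polyfun.padd polyfun.pmult polyfun.pconst polyfun.pcoord)
      then show ?thesis by (simp add: q_def[abs_def])
    qed
    fix i assume i: "i \<in> T"
    then obtain u where u: "u \<in> ?L" "u i = 0" "g u \<noteq> 0" using H by (auto simp: T_def)
    have "(\<lambda>j. 1 * u j + (-1) * v0 j) \<in> ?L" using u(1) v0 by (rule linear_space_lincomb)
    moreover have "q i (\<lambda>j. 1 * u j + (-1) * v0 j) \<noteq> 0" using u i by (simp add: q_def T_def)
    ultimately show "\<exists>c\<in>?L. q i c \<noteq> 0" by blast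
  qed
  then obtain c where c: "c \<in> ?L" "\<And>i. i \<in> T \<Longrightarrow> q i c \<noteq> 0" by blast
  \<comment> \<open>The parameters \<open>s\<close> for which the projection of
    \<open>v0 + s * c\<close> to one of the hyperplanes through \<open>v0\<close> is a zero of
    \<open>g\<close>. The choice of \<open>c\<close> excludes \<open>s = 1\<close>, hence
    finiteness.\<close>
  define bad where "bad = (\<Union>i\<in>T. {s. g (\<lambda>j. v0 j + s * (c j - c i / e i * e j)) = 0})"
  have "finite bad"
    unfolding bad_def using c g
    by (intro finite_UN_I nonzero_polyfun_along_line[of _ _ 1]) (auto simp: T_def q_def)
  define V where "V s t = (\<lambda>j. v0 j + s * c j + t * e j)" for s t
  have V_L: "V s t \<in> ?L" for s t
    using linear_space_lincomb[OF linear_space_lincomb[OF v0 c(1), of 1 s] e(1), of 1 t]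
    by (simp add: V_def)
  have contV: "continuous_on S (\<lambda>x. V (fst x) (snd x))" for S
    unfolding V_def by (intro continuous_on_coordinatewise_then_product continuous_intros)
  \<comment> \<open>Coordinates that are nonzero at \<open>v0\<close> stay nonzero on
    \<open>N'\<close>, so only those in \<open>T\<close> can vanish there.\<close>
  define N' where "N' = N \<inter> (\<Inter>i\<in>{i. i \<le> n \<and> v0 i \<noteq> 0}. {v. v i \<noteq> 0})"
  have "open N'" unfolding N'_def
    by (intro open_Int N open_INT)
      (auto intro!: open_Collect_neq continuous_on_product_coordinates)
  have "v0 \<in> N'" using N by (auto simp: N'_def)
  have "open ((\<lambda>x. V (fst x) (snd x)) -` N')"
    using open_vimage[OF \<open>open N'\<close> contV] .
  moreover have "(0, 0) \<in> (\<lambda>x. V (fst x) (snd x)) -` N'"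
    using \<open>v0 \<in> N'\<close> by (simp add: V_def)
  ultimately obtain B C where "open B" "open C" "(0, 0) \<in> B \<times> C"
    "B \<times> C \<subseteq> (\<lambda>x. V (fst x) (snd x)) -` N'"
    by (rule open_prod_elim)
  then have BC: "open B" "open C" "0 \<in> B" "0 \<in> C" "\<And>s t. s \<in> B \<Longrightarrow> t \<in> C \<Longrightarrow> V s t \<in> N'"
    by auto
  obtain \<delta> where \<delta>: "0 < \<delta>" "ball 0 \<delta> \<subseteq> C" using BC openE by blast
  have VN: "V s t \<in> N'" if "s \<in> B" "cmod t < \<delta>" for s t
    using BC(5)[OF that(1), of t] \<delta>(2) that(2) by (simp add: subset_iff)
  obtain D where D: "\<And>b e. \<exists>p. degree p \<le> D \<and> (\<forall>t. g (\<lambda>i. b i + t * e i) = poly p t)"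
    using polyfun_line[OF g] by blast
  have bound: "cmod (g (V s t)) \<le> 2 ^ D * cmod (g (V s 0))"
    if st: "s \<in> B" "s \<notin> bad" "cmod t \<le> \<delta>" for s t
  proof -
    obtain p where p: "degree p \<le> D" "\<And>t. g (V s t) = poly p t"
      using D[of "\<lambda>j. v0 j + s * c j" e] unfolding V_def by blast
    have "poly p z \<noteq> 0" if z: "cmod z < \<delta>" for z
    proof
      assume "poly p z = 0"
      then have gz: "g (V s z) = 0" using p by simp
      then obtain i where i: "i \<le> n" "V s z i = 0"
        using nz[OF V_L, of s z] VN[OF st(1) z] unfolding N'_def by blast
      then have "i \<in> T" using VN[OF st(1) z] by (auto simp: N'_def T_def)
      then have "z = - s * c i / e i" using i e(2)[OF i(1)]
        by (simp add: V_def T_def field_simps add_eq_0_iff)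
      then have "V s z = (\<lambda>j. v0 j + s * (c j - c i / e i * e j))"
        by (simp add: V_def algebra_simps)
      then have "s \<in> bad" using gz \<open>i \<in> T\<close> by (auto simp: bad_def)
      then show False using st by blast
    qed
    then show ?thesis
      using poly_bound_if_no_root[OF p(1), of \<delta> t] \<delta>(1) st(3) p(2) by auto
  qed
  have ev: "eventually (\<lambda>s. s \<in> B \<and> s \<notin> bad) (at 0)"
  proof -
    have "open (B - (bad - {0}))" using BC(1) \<open>finite bad\<close> by (intro open_Diff) (auto intro: finite_imp_closed)
    then have "eventually (\<lambda>s. s \<in> B - (bad - {0})) (nhds 0)"
      using BC(3) by (intro eventually_nhds_in_open) auto
    then show ?thesis by (auto simp: eventually_at_filter elim: eventually_mono)
  qed
  \<comment> \<open>Any nonzero \<open>t\<close> inside the disc serves. At \<open>s = 0\<close> all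
    coordinates of \<open>V 0 t\<close> are nonzero, those in \<open>T\<close> being
    \<open>t * e i\<close>, so \<open>g\<close> cannot vanish there; the limit of the bound as
    \<open>s\<close> tends to 0 says that it does.\<close>
  define t where "t = complex_of_real (\<delta> / 2)"
  have t: "cmod t < \<delta>" "t \<noteq> 0" using \<delta> by (auto simp: t_def)
  have lim: "((\<lambda>s. cmod (g (V s u))) \<longlongrightarrow> cmod (g (V 0 u))) (at 0)" for u
  proof -
    have "continuous_on UNIV (\<lambda>s. cmod (g (V s u)))"
      using contV[of UNIV]
      by (intro continuous_on_norm continuous_on_compose2[OF polyfun_continuous_on[OF g, of UNIV]])
        (auto simp: V_def intro!: continuous_on_coordinatewise_then_product continuous_intros)
    then show ?thesis using continuous_on_eq_continuous_at isContD by (metis UNIV_I open_UNIV)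
  qed
  have "cmod (g (V 0 t)) \<le> 2 ^ D * cmod (g (V 0 0))"
  proof (rule tendsto_le[OF _ tendsto_mult[OF tendsto_const lim] lim])
    show "eventually (\<lambda>s. cmod (g (V s t)) \<le> 2 ^ D * cmod (g (V s 0))) (at 0)"
      using ev by eventually_elim (use bound t in auto)
  qed auto
  then have "g (V 0 t) = 0" using g0 by (simp add: V_def)
  moreover have "V 0 t i \<noteq> 0" if "i \<le> n" for i
    using VN[OF BC(3) t(1)] that t(2) e(2)[OF that] by (cases "v0 i = 0") (auto simp: N'_def V_def)
  ultimately show False using nz[OF V_L] VN[OF BC(3) t(1)] by (auto simp: N'_def)
qed

text \<open>The quotient by the coordinate is homogeneous only on the linear space, so it is finally
  composed with a projection to that space.\<close>

lemma homog_polyfun_divide: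
  assumes A: "finite A" and g: "homog_poly d g"
    and e: "e \<in> linear_space n A" "e i \<noteq> 0"
    and v: "\<And>v. v \<in> linear_space n A \<Longrightarrow> v i = 0 \<Longrightarrow> g v = 0"
    and nz: "u \<in> linear_space n A" "g u \<noteq> 0"
  obtains d' q where "d = Suc d'" "homog_poly d' q" "\<And>v. v \<in> linear_space n A \<Longrightarrow> g v = v i * q v"
proof -
  let ?L = "linear_space n A"
  have gh: "g (\<lambda>i. c * v i) = c ^ d * g v" for c v using g by (auto simp: homog_poly_def)
  have L0: "(\<lambda>i. 0) \<in> ?L" by (simp add: linear_space_def Cn1_def)
  \<comment> \<open>In degree 0 scaling by 0 changes nothing, so \<open>g u\<close> would equal the
    value at the zero vector, which lies on the hyperplane.\<close>
  have "d \<noteq> 0"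
  proof
    assume "d = 0"
    then show False using gh[of 0 u] v[OF L0] nz(2) by simp
  qed
  then obtain d' where d: "d = Suc d'" using not0_implies_Suc by blast
  define e' where "e' = (\<lambda>j. e j / e i)"
  have e': "e' \<in> ?L" "e' i = 1"
    using linear_space_lincomb[OF e(1) L0, of "1 / e i" 0] e(2) by (auto simp: e'_def)
  obtain q where q: "q \<in> polyfun" "\<And>v. g v = g (\<lambda>j. v j - v i * e' j) + v i * q v"
    using polyfun_divide_coordinate g unfolding homog_poly_def by metis
  have gq: "g v = v i * q v" if "v \<in> ?L" for v
  proof -
    have "(\<lambda>j. v j - v i * e' j) \<in> ?L"
      using linear_space_lincomb[OF that e'(1), of 1 "- v i"] by simp
    then show ?thesis using v[of "\<lambda>j. v j - v i * e' j"] q(2)[of v] e'(2) by simp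
  qed
  have Lc: "(\<lambda>j. c * v j) \<in> ?L" if "v \<in> ?L" for c v
    using linear_space_lincomb[OF that that, of c 0] by simp
  \<comment> \<open>Homogeneity of the quotient in three steps: off the hyperplane by cancelling
    \<open>v i\<close>, on it by approaching along \<open>e\<close>, and for \<open>c = 0\<close> by
    continuity in the scalar.\<close>
  have h1: "q (\<lambda>j. c * v j) = c ^ d' * q v" if "v \<in> ?L" "c \<noteq> 0" "v i \<noteq> 0" for c v
    using gh[of c v] gq[OF that(1)] gq[OF Lc[OF that(1)], of c] that d by simp
  have qc: "continuous_on UNIV (\<lambda>t. q (\<lambda>j. a j + t * b j))" for a b
  proof -
    have "continuous_on UNIV (\<lambda>t j. a j + t * b j)"
      by (intro continuous_on_coordinatewise_then_product continuous_intros)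
    from continuous_on_compose2[OF polyfun_continuous_on[OF q(1), of UNIV] this] show ?thesis by simp
  qed
  have h2: "q (\<lambda>j. c * v j) = c ^ d' * q v" if "v \<in> ?L" "c \<noteq> 0" for c v
  proof (cases "v i = 0")
    case True
    let ?f = "\<lambda>t. q (\<lambda>j. c * v j + t * (c * e j)) - c ^ d' * q (\<lambda>j. v j + t * e j)"
    have "?f 0 = 0"
    proof (rule continuous_zero_at_puncture[of ?f 0])
      show "continuous_on UNIV ?f"
        by (rule continuous_on_diff[OF qc continuous_on_mult[OF continuous_on_const qc]])
      fix t :: complex assume "t \<noteq> 0"
      have "(\<lambda>j. v j + t * e j) \<in> ?L"
        using linear_space_lincomb[OF that(1) e(1), of 1 t] by simp
      from h1[OF this that(2)] show "?f t = 0"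
        using \<open>t \<noteq> 0\<close> e(2) True by (simp add: algebra_simps)
    qed
    then show ?thesis by simp
  qed (use h1 that in blast)
  have h3: "q (\<lambda>j. c * v j) = c ^ d' * q v" if "v \<in> ?L" for c v
  proof (cases "c = 0")
    case True
    let ?f = "\<lambda>t. q (\<lambda>j. 0 + t * v j) - t ^ d' * q v"
    have "?f 0 = 0"
    proof (rule continuous_zero_at_puncture[of ?f 0])
      show "continuous_on UNIV ?f"
        by (rule continuous_on_diff[OF qc]) (intro continuous_intros)
    qed (use h2[OF that] in auto)
    then show ?thesis using True by simp
  qed (use h2 that in blast)
  obtain \<pi> where \<pi>: "\<And>v. \<pi> v \<in> ?L" "\<And>v. v \<in> ?L \<Longrightarrow> \<pi> v = v"
    "\<And>i. (\<lambda>v. \<pi> v i) \<in> polyfun" "\<And>c v. \<pi> (\<lambda>i. c * v i) = (\<lambda>i. c * \<pi> v i)"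
    using linear_space_projection[OF A] by blast
  show ?thesis
  proof (rule that[OF d])
    show "homog_poly d' (\<lambda>v. q (\<pi> v))"
      unfolding homog_poly_def
    proof (intro conjI allI)
      show "(\<lambda>v. q (\<pi> v)) \<in> polyfun" using polyfun_comp[OF q(1) \<pi>(3)] .
      show "q (\<pi> (\<lambda>i. c * v i)) = c ^ d' * q (\<pi> v)" for c v
        unfolding \<pi>(4) by (rule h3[OF \<pi>(1)])
    qed
    show "g v = v i * q (\<pi> v)" if "v \<in> ?L" for v
      using gq[OF that] unfolding \<pi>(2)[OF that] .
  qed
qed

text \<open>As long as \<open>g\<close> vanishes at \<open>v0\<close>, it must vanish on a whole
  coordinate hyperplane through \<open>v0\<close>, hence is divisible by that coordinate. The
  quotient inherits the nonvanishing hypothesis and has smaller degree. The vector \<open>u\<close>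
  witnesses that \<open>g\<close> is not identically zero on the space.\<close>

lemma homog_polyfun_factor:
  assumes A: "finite A" and v0: "v0 \<in> linear_space n A"
    and e: "e \<in> linear_space n A" "\<And>i. i \<le> n \<Longrightarrow> e i \<noteq> 0"
    and N: "open N" "v0 \<in> N"
    and u: "u \<in> linear_space n A" "u \<in> N" "\<And>i. i \<le> n \<Longrightarrow> u i \<noteq> 0"
    and g: "homog_poly d g"
    and nz: "\<And>v. v \<in> linear_space n A \<Longrightarrow> v \<in> N \<Longrightarrow> (\<And>i. i \<le> n \<Longrightarrow> v i \<noteq> 0) \<Longrightarrow> g v \<noteq> 0"
  shows "\<exists>xs d' g'. set xs \<subseteq> {..n} \<and> d = d' + length xs \<and> homog_poly d' g' \<and> g' v0 \<noteq> 0 \<and>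
    (\<forall>v\<in>linear_space n A. g v = (\<Prod>i\<leftarrow>xs. v i) * g' v)"
  using g nz
proof (induction d arbitrary: g rule: less_induct)
  case (less d)
  show ?case
  proof (cases "g v0 = 0")
    case False
    then show ?thesis using less.prems by (intro exI[of _ "[]"]) auto
  next
    case True
    have "g \<in> polyfun" using less.prems by (simp add: homog_poly_def)
    have "\<exists>i\<le>n. v0 i = 0 \<and> (\<forall>v\<in>linear_space n A. v i = 0 \<longrightarrow> g v = 0)"
    proof (rule ccontr)
      assume neg: "\<not> ?thesis"
      have "g v0 \<noteq> 0"
      proof (rule polyfun_nonzero_at_boundary[OF \<open>g \<in> polyfun\<close> v0 e N less.prems(2)])
        show "\<exists>u\<in>linear_space n A. u i = 0 \<and> g u \<noteq> 0" if "i \<le> n" "v0 i = 0" for i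
          using neg that by blast
      qed
      then show False using True by contradiction
    qed
    then obtain i where i: "i \<le> n" "\<And>v. v \<in> linear_space n A \<Longrightarrow> v i = 0 \<Longrightarrow> g v = 0"
      by blast
    obtain d' q where q: "d = Suc d'" "homog_poly d' q" "\<And>v. v \<in> linear_space n A \<Longrightarrow> g v = v i * q v"
      by (rule homog_polyfun_divide[OF A less.prems(1) e(1) e(2)[OF i(1)] i(2) u(1) less.prems(2)[OF u]])
        (assumption | rule that)+
    have "\<exists>xs d'' g'. set xs \<subseteq> {..n} \<and> d' = d'' + length xs \<and> homog_poly d'' g' \<and> g' v0 \<noteq> 0 \<and>
      (\<forall>v\<in>linear_space n A. q v = (\<Prod>i\<leftarrow>xs. v i) * g' v)"
    proof (rule less.IH)
      show "q v \<noteq> 0" if "v \<in> linear_space n A" "v \<in> N" "\<And>i. i \<le> n \<Longrightarrow> v i \<noteq> 0" for v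
        using less.prems(2)[OF that] q(3)[OF that(1)] by auto
    qed (simp_all add: q(1,2))
    then obtain xs d'' g' where xs: "set xs \<subseteq> {..n}" "d' = d'' + length xs" "homog_poly d'' g'" "g' v0 \<noteq> 0"
      "\<And>v. v \<in> linear_space n A \<Longrightarrow> q v = (\<Prod>i\<leftarrow>xs. v i) * g' v" by blast
    show ?thesis
    proof (intro exI conjI ballI)
      show "d = d'' + length (i # xs)" using q(1) xs(2) by simp
      show "set (i # xs) \<subseteq> {..n}" using i(1) xs(1) by simp
      show "g v = (\<Prod>i\<leftarrow>i # xs. v i) * g' v" if "v \<in> linear_space n A" for v
        using q(3)[OF that] xs(5)[OF that] by simp
    qed (rule xs(3) xs(4))+
  qed
qed

section \<open>The closure in projective space\<close>

text \<open>Serves two purposes: it lifts a torus point to homogeneous coordinates, and it completes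
  an angle vector by the phase 1 of the coordinate with index 0.\<close>

definition ext1 :: "vec \<Rightarrow> vec" where
  "ext1 x = (\<lambda>i. if i = 0 then 1 else x i)"

lemma torus_to_P_eq: "torus_to_P x = ppt (ext1 x)"
  by (simp add: torus_to_P_def ext1_def)

lemma mem_ppt: "v \<in> ppt v"
  unfolding ppt_def by (auto intro!: exI[of _ 1])

lemma ppt_scale: "c \<noteq> 0 \<Longrightarrow> ppt (\<lambda>i. c * v i) = ppt v"
proof -
  assume c: "c \<noteq> 0"
  have "(\<lambda>i. d * v i) \<in> {(\<lambda>i. e * (c * v i)) |e. e \<noteq> 0}" if "d \<noteq> 0" for d
    using c that by (intro CollectI exI[of _ "d / c"]) auto
  moreover have "(\<lambda>i. d * (c * v i)) \<in> {(\<lambda>i. e * v i) |e. e \<noteq> 0}" if "d \<noteq> 0" for d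
    using c that by (intro CollectI exI[of _ "d * c"]) (auto simp: mult.assoc)
  ultimately show ?thesis unfolding ppt_def by blast
qed

lemma mem_pptE:
  assumes "u \<in> ppt v"
  obtains c where "c \<noteq> 0" "u = (\<lambda>i. c * v i)"
  using assms by (auto simp: ppt_def)

lemma ppt_eq_if_mem: "u \<in> ppt v \<Longrightarrow> ppt u = ppt v"
  by (elim mem_pptE) (simp add: ppt_scale)

lemma zero_iff_mem_ppt: "u \<in> ppt v \<Longrightarrow> u i = 0 \<longleftrightarrow> v i = 0"
  by (elim mem_pptE) simp

definition punctured :: "nat \<Rightarrow> vec set" where
  "punctured n = Cn1 n - {\<lambda>i. 0}"

lemma scale_punctured: "c \<noteq> 0 \<Longrightarrow> v \<in> punctured n \<Longrightarrow> (\<lambda>i. c * v i) \<in> punctured n"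
  by (auto simp: punctured_def Cn1_def fun_eq_iff)

lemma mem_Pn: "q \<in> Pn n \<Longrightarrow> v \<in> q \<Longrightarrow> v \<in> punctured n \<and> q = ppt v"
proof -
  assume "q \<in> Pn n" "v \<in> q"
  then obtain w where w: "w \<in> punctured n" "q = ppt w" "v \<in> ppt w"
    unfolding Pn_def punctured_def[symmetric] by blast
  from w(3) show "v \<in> punctured n \<and> q = ppt v"
    using w(1,2) scale_punctured ppt_eq_if_mem[OF w(3)] by (elim mem_pptE) auto
qed

lemma ppt_in_Pn: "v \<in> punctured n \<Longrightarrow> ppt v \<in> Pn n"
  by (simp add: Pn_def punctured_def)

text \<open>The generating family is already a topology: distinct projective points are disjoint as
  punctured lines, so taking unions of members commutes with intersection.\<close>

lemma openin_Ptop: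
  "openin (Ptop n) U \<longleftrightarrow> U \<subseteq> Pn n \<and> openin (top_of_set (punctured n)) (\<Union>U)"
proof
  assume "U \<subseteq> Pn n \<and> openin (top_of_set (punctured n)) (\<Union>U)"
  then show "openin (Ptop n) U"
    unfolding Ptop_def punctured_def by (intro topology_generated_by_Basis) blast
next
  assume "openin (Ptop n) U"
  then have "generate_topology_on {U. U \<subseteq> Pn n \<and> openin (top_of_set (punctured n)) (\<Union>U)} U"
    unfolding Ptop_def punctured_def openin_topology_generated_by_iff .
  then show "U \<subseteq> Pn n \<and> openin (top_of_set (punctured n)) (\<Union>U)"
  proof (induction rule: generate_topology_on.induct)
    case (Int a b)
    have "\<Union>(a \<inter> b) = \<Union>a \<inter> \<Union>b"
    proof
      show "\<Union>a \<inter> \<Union>b \<subseteq> \<Union>(a \<inter> b)"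
      proof
        fix v assume "v \<in> \<Union>a \<inter> \<Union>b"
        then obtain q r where "q \<in> a" "v \<in> q" "r \<in> b" "v \<in> r" by blast
        moreover from this have "q = r" using Int.IH mem_Pn by blast
        ultimately show "v \<in> \<Union>(a \<inter> b)" by blast
      qed
    qed blast
    then show ?case using Int.IH by auto
  next
    case (UN K)
    have "\<Union>(\<Union>K) = \<Union>(\<Union> ` K)" by blast
    moreover have "openin (top_of_set (punctured n)) (\<Union>(\<Union> ` K))"
      using UN.IH by (intro openin_Union) blast
    ultimately show ?case using UN.IH by (metis Union_least)
  qed auto
qed

lemma openin_PtopD:
  assumes "openin (Ptop n) T"
  shows "\<exists>N. T \<subseteq> Pn n \<and> open N \<and> \<Union>T = punctured n \<inter> N"
  using assms by (simp add: openin_Ptop openin_open)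

lemma topspace_Ptop: "topspace (Ptop n) = Pn n"
proof -
  have "\<Union>(Pn n) = punctured n"
    using mem_Pn mem_ppt ppt_in_Pn by blast
  then have "openin (Ptop n) (Pn n)" by (simp add: openin_Ptop)
  then have "Pn n \<subseteq> topspace (Ptop n)" by (rule openin_subset)
  moreover have "topspace (Ptop n) \<subseteq> Pn n" using openin_topspace[of "Ptop n"] unfolding openin_Ptop by blast
  ultimately show ?thesis by (rule antisym[rotated])
qed

lemma open_scale_vimage:
  assumes "open N"
  shows "open {w. (\<lambda>i. c * w i) \<in> (N :: vec set)}"
proof -
  have "continuous_on UNIV (\<lambda>(w::vec) i. c * w i)"
    by (intro continuous_on_coordinatewise_then_product continuous_on_mult continuous_on_const
        continuous_on_product_coordinates)
  from open_vimage[OF assms this] show ?thesis by (simp add: vimage_def)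
qed

text \<open>The quotient map is open, because the saturation of an open set is a union of its
  rescaled copies.\<close>

lemma openin_Ptop_ppt_image:
  assumes "open N"
  shows "openin (Ptop n) (ppt ` (punctured n \<inter> N))"
proof -
  have "\<Union>(ppt ` (punctured n \<inter> N)) = punctured n \<inter> (\<Union>c\<in>-{0}. {w. (\<lambda>i. c * w i) \<in> N})" (is "?l = ?r")
  proof (rule set_eqI)
    fix w
    show "w \<in> ?l \<longleftrightarrow> w \<in> ?r"
    proof
      assume "w \<in> ?l"
      then obtain v c where v: "v \<in> punctured n" "v \<in> N" "c \<noteq> 0" "w = (\<lambda>i. c * v i)"
        by (auto elim: mem_pptE)
      then have "(\<lambda>i. inverse c * w i) = v" by (simp add: fun_eq_iff)
      then show "w \<in> ?r" using v scale_punctured[OF v(3,1)] by (auto intro!: bexI[of _ "inverse c"])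
    next
      assume "w \<in> ?r"
      then obtain c where c: "w \<in> punctured n" "c \<noteq> 0" "(\<lambda>i. c * w i) \<in> N" by blast
      then have "w \<in> ppt (\<lambda>i. c * w i)" using ppt_scale[OF c(2), of w] mem_ppt[of w] by simp
      then show "w \<in> ?l" using c scale_punctured by blast
    qed
  qed
  moreover have "open (\<Union>c\<in>-{0}. {w. (\<lambda>i. c * w i) \<in> N})"
    using open_scale_vimage[OF assms] by blast
  ultimately show ?thesis
    using ppt_in_Pn by (auto simp: openin_Ptop openin_open)
qed

lemma closed_linear_space: "closed (linear_space n A)"
proof -
  have "linear_space n A = (\<Inter>i\<in>{i. i > n}. {v. v i = 0}) \<inter> (\<Inter>a\<in>A. {v. (\<Sum>i\<le>n. a i * v i) = 0})"
    by (auto simp: linear_space_def Cn1_def)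
  moreover have "closed {v :: vec. v i = 0}" for i
    by (intro closed_Collect_eq continuous_on_const continuous_on_product_coordinates)
  moreover have "closed {v :: vec. (\<Sum>i\<le>n. a i * v i) = 0}" for a
    by (intro closed_Collect_eq continuous_on_const continuous_on_sum continuous_on_mult
        continuous_on_product_coordinates)
  ultimately show ?thesis by (auto intro!: closed_Int closed_INT)
qed

section \<open>The linear cone over the closure\<close>

locale very_affine =
  fixes n :: nat and Z :: "vec set" and A :: "vec set"
  assumes finite_A: "finite A" and Z_nonempty: "Z \<noteq> {}"
    and Z_eq: "Z = {x \<in> torus n. ext1 x \<in> linear_space n A}"
begin

abbreviation L :: "vec set" where "L \<equiv> linear_space n A"

definition Lx :: "vec set" where "Lx = L - {\<lambda>i. 0}"

lemma Lx_punctured: "v \<in> Lx \<Longrightarrow> v \<in> punctured n"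
  by (auto simp: Lx_def punctured_def linear_space_def)

lemma L_scale: "v \<in> L \<Longrightarrow> (\<lambda>i. c * v i) \<in> L"
  using linear_space_lincomb[of v n A v c 0] by simp

lemma L_add: "u \<in> L \<Longrightarrow> v \<in> L \<Longrightarrow> (\<lambda>i. u i + v i) \<in> L"
  using linear_space_lincomb[of u n A v 1 1] by simp

lemma Lx_scale: "c \<noteq> 0 \<Longrightarrow> v \<in> Lx \<Longrightarrow> (\<lambda>i. c * v i) \<in> Lx"
  using L_scale by (auto simp: Lx_def fun_eq_iff)

lemma Lx_coord: "v \<in> Lx \<Longrightarrow> \<exists>k\<le>n. v k \<noteq> 0"
  by (auto simp: Lx_def linear_space_def Cn1_def fun_eq_iff) (metis not_le)

lemma L_Lx: "v \<in> L \<Longrightarrow> v i \<noteq> 0 \<Longrightarrow> v \<in> Lx"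
  by (auto simp: Lx_def)

lemma ext1_Z:
  assumes "x \<in> Z"
  shows "ext1 x \<in> Lx" "i \<le> n \<Longrightarrow> ext1 x i \<noteq> 0"
proof -
  show "ext1 x \<in> Lx" using assms L_Lx[of "ext1 x" 0] by (auto simp: Z_eq ext1_def)
  show "i \<le> n \<Longrightarrow> ext1 x i \<noteq> 0" using assms by (auto simp: Z_eq ext1_def torus_def)
qed

lemma generic_vector: "\<exists>e\<in>L. \<forall>i\<le>n. e i \<noteq> 0"
proof -
  obtain x where "x \<in> Z" using Z_nonempty by blast
  then show ?thesis using ext1_Z[of x] by (intro bexI[of _ "ext1 x"]) (auto simp: Lx_def)
qed

definition dehom :: "vec \<Rightarrow> vec" where
  "dehom v = (\<lambda>i. if 1 \<le> i \<and> i \<le> n then v i / v 0 else 0)"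

lemma ext1_dehom:
  assumes "v \<in> L" "v 0 \<noteq> 0"
  shows "ext1 (dehom v) = (\<lambda>i. inverse (v 0) * v i)"
  using assms by (auto simp: ext1_def dehom_def fun_eq_iff linear_space_def Cn1_def field_simps)

lemma dehom_in_Z:
  assumes "v \<in> L" "\<And>i. i \<le> n \<Longrightarrow> v i \<noteq> 0"
  shows "dehom v \<in> Z"
proof -
  have "ext1 (dehom v) \<in> L" using assms ext1_dehom[of v] L_scale[of v] by simp
  moreover have "dehom v \<in> torus n" using assms(2) by (auto simp: dehom_def torus_def)
  ultimately show ?thesis by (simp add: Z_eq)
qed

lemma torus_to_P_dehom:
  assumes "v \<in> L" "v 0 \<noteq> 0"
  shows "torus_to_P (dehom v) = ppt v"
  using assms by (simp add: torus_to_P_eq ext1_dehom ppt_scale)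

lemma dehom_ext1: "x \<in> Z \<Longrightarrow> dehom (ext1 x) = x"
  by (auto simp: dehom_def ext1_def Z_eq torus_def fun_eq_iff not_le)

text \<open>Moving from \<open>v\<close> in a direction with all coordinates nonzero, each
  coordinate vanishes for one parameter only, while a nonempty open set of parameters is
  infinite.\<close>

lemma L_dense:
  assumes "v \<in> L" "open N" "v \<in> N"
  shows "\<exists>u\<in>L. u \<in> N \<and> (\<forall>i\<le>n. u i \<noteq> 0)"
proof -
  obtain e where e: "e \<in> L" "\<And>i. i \<le> n \<Longrightarrow> e i \<noteq> 0" using generic_vector by blast
  have cont: "continuous_on UNIV (\<lambda>t i. v i + t * e i)"
    by (intro continuous_on_coordinatewise_then_product continuous_intros)
  have "open ((\<lambda>t i. v i + t * e i) -` N)" by (rule open_vimage[OF assms(2) cont])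
  moreover have "0 \<in> (\<lambda>t i. v i + t * e i) -` N" using assms(3) by simp
  ultimately have "infinite ((\<lambda>t i. v i + t * e i) -` N)"
    by (metis finite_imp_not_open empty_iff)
  then have "infinite ((\<lambda>t i. v i + t * e i) -` N - (\<lambda>i. - v i / e i) ` {..n})"
    by simp
  then obtain t where t: "(\<lambda>i. v i + t * e i) \<in> N" "t \<notin> (\<lambda>i. - v i / e i) ` {..n}"
    using infinite_imp_nonempty by blast
  have "v i + t * e i \<noteq> 0" if "i \<le> n" for i
  proof
    assume "v i + t * e i = 0"
    then have "t = - v i / e i" using e(2)[OF that] by (simp add: field_simps add_eq_0_iff)
    then show False using t(2) that by blast
  qed
  moreover have "(\<lambda>i. v i + t * e i) \<in> L"
    using linear_space_lincomb[OF assms(1) e(1), of 1 t] by simp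
  ultimately show ?thesis using t(1) by blast
qed

text \<open>One inclusion is density in \<open>L\<close> of the vectors without zero coordinate; the
  other holds because \<open>L\<close> is closed and stable under scaling, so its complement
  projects to an open set that misses \<open>Z\<close>.\<close>

lemma Zbar_eq: "Zbar n Z = ppt ` Lx"
proof
  show "ppt ` Lx \<subseteq> Zbar n Z"
  proof
    fix p assume "p \<in> ppt ` Lx"
    then obtain v where v: "p = ppt v" "v \<in> Lx" by blast
    show "p \<in> Zbar n Z" unfolding Zbar_def in_closure_of
    proof (intro conjI allI impI)
      show "p \<in> topspace (Ptop n)" using v Lx_punctured ppt_in_Pn by (simp add: topspace_Ptop)
      fix T assume T: "p \<in> T \<and> openin (Ptop n) T"
      then obtain N where N: "T \<subseteq> Pn n" "open N" "\<Union>T = punctured n \<inter> N"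
        unfolding openin_Ptop openin_open by blast
      have "v \<in> N" using T N(3) v mem_ppt by blast
      then obtain u where u: "u \<in> L" "u \<in> N" "\<And>i. i \<le> n \<Longrightarrow> u i \<noteq> 0"
        using L_dense[of v N] N(2) v by (auto simp: Lx_def)
      have "u \<in> \<Union>T" using u L_Lx[of u 0] Lx_punctured N(3) by auto
      then have "ppt u \<in> T" using N(1) mem_Pn by blast
      moreover have "ppt u \<in> torus_to_P ` Z"
        using imageI[OF dehom_in_Z[OF u(1,3)], of torus_to_P] torus_to_P_dehom[OF u(1) u(3)[of 0]]
        by simp
      ultimately show "\<exists>y. y \<in> torus_to_P ` Z \<and> y \<in> T" by blast
    qed
  qed
next
  show "Zbar n Z \<subseteq> ppt ` Lx"
  proof
    fix p assume p: "p \<in> Zbar n Z"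
    then have "p \<in> Pn n" unfolding Zbar_def in_closure_of topspace_Ptop by blast
    then obtain w where w: "w \<in> punctured n" "p = ppt w" by (auto simp: Pn_def punctured_def)
    have "w \<in> L"
    proof (rule ccontr)
      assume "w \<notin> L"
      let ?T = "ppt ` (punctured n \<inter> - L)"
      have "openin (Ptop n) ?T"
        by (rule openin_Ptop_ppt_image) (use closed_linear_space in blast)
      moreover have "p \<in> ?T" using w \<open>w \<notin> L\<close> by blast
      ultimately have "\<exists>y. y \<in> torus_to_P ` Z \<and> y \<in> ?T"
        using conjunct2[OF p[unfolded Zbar_def in_closure_of], rule_format, of ?T] by simp
      then obtain x where x: "x \<in> Z" "torus_to_P x \<in> ?T" by blast
      then obtain u where u: "u \<notin> L" "ppt (ext1 x) = ppt u" unfolding torus_to_P_eq by blast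
      have "u \<in> ppt (ext1 x)" using mem_ppt[of u] u(2) by simp
      then obtain c where "u = (\<lambda>i. c * ext1 x i)" by (rule mem_pptE)
      moreover have "ext1 x \<in> L" using ext1_Z(1)[OF x(1)] by (simp add: Lx_def)
      ultimately show False using u(1) L_scale by blast
    qed
    then show "p \<in> ppt ` Lx" using w by (auto simp: Lx_def punctured_def)
  qed
qed

lemma mem_Zbar:
  assumes "q \<in> Zbar n Z" "v \<in> q"
  shows "v \<in> Lx" "q = ppt v"
proof -
  obtain u where u: "u \<in> Lx" "q = ppt u" using assms(1) Zbar_eq by blast
  from assms(2) show "v \<in> Lx" unfolding u(2) by (elim mem_pptE) (simp add: Lx_scale u(1))
  show "q = ppt v" using u assms(2) ppt_eq_if_mem by blast
qed

lemma ZbarE: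
  assumes "q \<in> Zbar n Z"
  obtains v where "v \<in> Lx" "q = ppt v"
  using assms Zbar_eq by blast

lemma ppt_in_Zbar: "v \<in> Lx \<Longrightarrow> ppt v \<in> Zbar n Z"
  using Zbar_eq by blast

lemma in_Zbdry_iff:
  assumes "v \<in> Lx"
  shows "ppt v \<in> Zbdry n Z \<longleftrightarrow> (\<exists>i\<le>n. v i = 0)"
proof -
  have "ppt v \<in> torus_to_P ` Z" if "\<forall>i\<le>n. v i \<noteq> 0"
  proof -
    have "v \<in> L" using assms by (simp add: Lx_def)
    then have "dehom v \<in> Z" "torus_to_P (dehom v) = ppt v"
      using that by (simp_all add: dehom_in_Z torus_to_P_dehom)
    then show ?thesis by (metis imageI)
  qed
  moreover have "v i \<noteq> 0" if "ppt v = torus_to_P x" "x \<in> Z" "i \<le> n" for x i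
    using that ext1_Z(2)[OF that(2,3)] zero_iff_mem_ppt[of v "ext1 x" i] mem_ppt[of v]
    by (simp add: torus_to_P_eq)
  ultimately show ?thesis
    unfolding Zbdry_def using ppt_in_Zbar[OF assms] by blast
qed

lemma topspace_Zbar: "topspace (Zbar_top n Z) = Zbar n Z"
  unfolding Zbar_top_def topspace_subtopology topspace_Ptop
  using Zbar_eq Lx_punctured ppt_in_Pn by auto

lemma openin_ZbarE:
  assumes "openin (Zbar_top n Z) W" "v \<in> Lx" "ppt v \<in> W"
  shows "\<exists>N. open N \<and> v \<in> N \<and> (\<forall>u\<in>Lx. u \<in> N \<longrightarrow> ppt u \<in> W)"
proof -
  obtain T where T: "openin (Ptop n) T" "W = T \<inter> Zbar n Z"
    using assms(1) unfolding Zbar_top_def openin_subtopology by blast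
  obtain N where N: "T \<subseteq> Pn n" "open N" "\<Union>T = punctured n \<inter> N"
    using openin_PtopD[OF T(1)] by (elim exE conjE) (rule that)
  show ?thesis
  proof (intro exI conjI ballI impI)
    show "open N" by (rule N(2))
    have "v \<in> \<Union>T" using assms(3) T(2) mem_ppt[of v] by blast
    then show "v \<in> N" using N(3) by blast
    fix u assume u: "u \<in> Lx" "u \<in> N"
    then have "u \<in> \<Union>T" using N(3) Lx_punctured by blast
    then obtain q where "q \<in> T" "u \<in> q" by blast
    then have "ppt u \<in> T" using N(1) mem_Pn[of q n u] by blast
    then show "ppt u \<in> W" using T(2) ppt_in_Zbar[OF u(1)] by simp
  qed
qed

lemma openin_Zbar_image:
  assumes "open N"
  shows "openin (Zbar_top n Z) (ppt ` (Lx \<inter> N))"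
proof -
  have "ppt ` (Lx \<inter> N) = ppt ` (punctured n \<inter> N) \<inter> Zbar n Z"
  proof
    show "ppt ` (punctured n \<inter> N) \<inter> Zbar n Z \<subseteq> ppt ` (Lx \<inter> N)"
    proof
      fix q assume "q \<in> ppt ` (punctured n \<inter> N) \<inter> Zbar n Z"
      then obtain v where "v \<in> N" "q = ppt v" "q \<in> Zbar n Z" by blast
      moreover from this have "v \<in> Lx" using mem_Zbar(1)[of q v] mem_ppt[of v] by simp
      ultimately show "q \<in> ppt ` (Lx \<inter> N)" by simp
    qed
    show "ppt ` (Lx \<inter> N) \<subseteq> ppt ` (punctured n \<inter> N) \<inter> Zbar n Z"
      using Lx_punctured ppt_in_Zbar by auto
  qed
  then show ?thesis
    unfolding Zbar_top_def openin_subtopology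
    by (intro exI[of _ "ppt ` (punctured n \<inter> N)"] conjI openin_Ptop_ppt_image[OF assms])
qed

lemma openin_Lx_vimage:
  assumes "openin (Zbar_top n Z) W"
  shows "openin (top_of_set Lx) {v \<in> Lx. ppt v \<in> W}"
proof (subst openin_subopen, intro ballI)
  fix v assume v: "v \<in> {v \<in> Lx. ppt v \<in> W}"
  then obtain N where N: "open N" "v \<in> N" "\<And>u. u \<in> Lx \<Longrightarrow> u \<in> N \<Longrightarrow> ppt u \<in> W"
    using openin_ZbarE[OF assms, of v] by blast
  show "\<exists>T. openin (top_of_set Lx) T \<and> v \<in> T \<and> T \<subseteq> {v \<in> Lx. ppt v \<in> W}"
    using N v by (intro exI[of _ "Lx \<inter> N"]) (auto simp: openin_open)
qed

end

section \<open>Regular functions near the boundary\<close>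

context very_affine
begin

definition chart :: "nat \<Rightarrow> vec set set" where
  "chart k = ppt ` (Lx \<inter> {v. v k \<noteq> 0})"

lemma open_coord_nonzero: "open {v :: vec. v k \<noteq> 0}"
  by (intro open_Collect_neq continuous_on_const continuous_on_product_coordinates)

lemma openin_chart: "openin (Zbar_top n Z) (chart k)"
  unfolding chart_def by (rule openin_Zbar_image[OF open_coord_nonzero])

lemma mem_chart:
  assumes "q \<in> chart k" "v \<in> q"
  shows "v \<in> Lx" "v k \<noteq> 0" "q = ppt v"
proof -
  obtain u where u: "u \<in> Lx" "u k \<noteq> 0" "q = ppt u" using assms(1) unfolding chart_def by blast
  then have "q \<in> Zbar n Z" using ppt_in_Zbar by blast
  then show "v \<in> Lx" "q = ppt v" using mem_Zbar assms(2) by blast+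
  show "v k \<noteq> 0" using u assms(2) zero_iff_mem_ppt[of v u k] by simp
qed

lemma ppt_in_chart: "v \<in> Lx \<Longrightarrow> v k \<noteq> 0 \<Longrightarrow> ppt v \<in> chart k"
  unfolding chart_def by blast

lemma chart_exists: "p \<in> Zbar n Z \<Longrightarrow> \<exists>k\<le>n. p \<in> chart k"
  using Lx_coord ppt_in_chart by (elim ZbarE) blast

lemma SOME_in_ppt: "(SOME v. v \<in> ppt u) \<in> ppt u"
  using someI[where P = "\<lambda>v. v \<in> ppt u", OF mem_ppt] .

lemma ratio_ppt: "v k \<noteq> 0 \<Longrightarrow> ratio a k (ppt v) = v a / v k"
  unfolding ratio_def Let_def using SOME_in_ppt[of v] by (elim mem_pptE) simp

lemma regular_on_subset:
  assumes "regular_on n Z U f" "openin (Zbar_top n Z) V" "V \<subseteq> U"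
  shows "regular_on n Z V f"
  unfolding regular_on_def
proof (intro conjI ballI)
  fix p assume "p \<in> V"
  then have "p \<in> U" using assms(3) by blast
  with assms(1) obtain W d g h where W: "openin (Zbar_top n Z) W" "p \<in> W" "homog_poly d g" "homog_poly d h"
    "\<forall>q\<in>W. \<forall>v\<in>q. h v \<noteq> 0 \<and> f q = g v / h v"
    unfolding regular_on_def by meson
  show "\<exists>W d g h. openin (Zbar_top n Z) W \<and> p \<in> W \<and> W \<subseteq> V \<and> homog_poly d g \<and> homog_poly d h \<and>
      (\<forall>q\<in>W. \<forall>v\<in>q. h v \<noteq> 0 \<and> f q = g v / h v)"
    by (rule exI[of _ "W \<inter> V"], rule exI[of _ d], rule exI[of _ g], rule exI[of _ h])
      (use \<open>p \<in> V\<close> assms(2) W in auto)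
qed (rule assms(2))

lemma regular_on_mult:
  assumes f: "regular_on n Z U f" and g: "regular_on n Z U g"
  shows "regular_on n Z U (\<lambda>q. f q * g q)"
  unfolding regular_on_def
proof (intro conjI ballI)
  show "openin (Zbar_top n Z) U" using f by (simp add: regular_on_def)
  fix p assume p: "p \<in> U"
  obtain W d a b where W: "openin (Zbar_top n Z) W" "p \<in> W" "W \<subseteq> U" "homog_poly d a" "homog_poly d b"
    "\<forall>q\<in>W. \<forall>v\<in>q. b v \<noteq> 0 \<and> f q = a v / b v"
    using f p unfolding regular_on_def by meson
  obtain W' d' a' b' where W': "openin (Zbar_top n Z) W'" "p \<in> W'" "W' \<subseteq> U" "homog_poly d' a'" "homog_poly d' b'"
    "\<forall>q\<in>W'. \<forall>v\<in>q. b' v \<noteq> 0 \<and> g q = a' v / b' v"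
    using g p unfolding regular_on_def by meson
  show "\<exists>W d a b. openin (Zbar_top n Z) W \<and> p \<in> W \<and> W \<subseteq> U \<and> homog_poly d a \<and> homog_poly d b \<and>
      (\<forall>q\<in>W. \<forall>v\<in>q. b v \<noteq> 0 \<and> f q * g q = a v / b v)"
    by (rule exI[of _ "W \<inter> W'"], rule exI[of _ "d + d'"], rule exI[of _ "\<lambda>v. a v * a' v"],
        rule exI[of _ "\<lambda>v. b v * b' v"])
      (use W W' in \<open>auto intro: homog_poly_mult\<close>)
qed

lemma regular_on_quotient:
  assumes "openin (Zbar_top n Z) U" "homog_poly d g" "homog_poly d h"
    "\<And>q v. q \<in> U \<Longrightarrow> v \<in> q \<Longrightarrow> h v \<noteq> 0 \<and> f q = g v / h v"
  shows "regular_on n Z U f"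
  unfolding regular_on_def
proof (intro conjI ballI)
  show "\<exists>W d g h. openin (Zbar_top n Z) W \<and> p \<in> W \<and> W \<subseteq> U \<and> homog_poly d g \<and> homog_poly d h \<and>
      (\<forall>q\<in>W. \<forall>v\<in>q. h v \<noteq> 0 \<and> f q = g v / h v)" if "p \<in> U" for p
    by (rule exI[of _ U], rule exI[of _ d], rule exI[of _ g], rule exI[of _ h]) (simp add: assms that)
qed (rule assms(1))

lemma regular_on_continuous:
  assumes "regular_on n Z U f"
  shows "continuous_on {v \<in> Lx. ppt v \<in> U} (\<lambda>v. f (ppt v))"
  unfolding continuous_on_eq_continuous_within
proof
  fix v assume v: "v \<in> {v \<in> Lx. ppt v \<in> U}"
  then have "v \<in> Lx" "ppt v \<in> U" by auto
  from assms \<open>ppt v \<in> U\<close> obtain W d a b where W: "openin (Zbar_top n Z) W" "ppt v \<in> W" "homog_poly d a" "homog_poly d b"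
    "\<forall>q\<in>W. \<forall>v\<in>q. b v \<noteq> 0 \<and> f q = a v / b v" unfolding regular_on_def by meson
  obtain N where N: "open N" "v \<in> N" "\<And>u. u \<in> Lx \<Longrightarrow> u \<in> N \<Longrightarrow> ppt u \<in> W"
    using openin_ZbarE[OF W(1) \<open>v \<in> Lx\<close> W(2)] by blast
  have eq: "b u \<noteq> 0 \<and> f (ppt u) = a u / b u" if "u \<in> Lx" "u \<in> N" for u
    using W(5) N(3)[OF that] mem_ppt[of u] by blast
  have "continuous_on (Lx \<inter> N) (\<lambda>u. a u / b u)"
    using W(3,4) eq unfolding homog_poly_def
    by (intro continuous_on_divide polyfun_continuous_on) auto
  then have "continuous_on (Lx \<inter> N) (\<lambda>u. f (ppt u))"
    using eq by (subst continuous_on_cong[OF refl, where g = "\<lambda>u. a u / b u"]) auto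
  then have "continuous (at v within Lx \<inter> N) (\<lambda>u. f (ppt u))"
    using N(2) \<open>v \<in> Lx\<close> continuous_on_eq_continuous_within by blast
  then have "continuous (at v within Lx) (\<lambda>u. f (ppt u))"
    using at_within_nhd[OF N(2,1), of "Lx \<inter> N" Lx] by (simp add: Int_ac)
  then show "continuous (at v within {v \<in> Lx. ppt v \<in> U}) (\<lambda>v. f (ppt v))"
    by (rule continuous_within_subset) auto
qed

lemma MonI: "logfun_on n Z U f \<Longrightarrow> p \<in> U \<Longrightarrow> f \<in> Mon n Z p"
  unfolding Mon_def by blast

lemma logfun_on_subset:
  "logfun_on n Z U f \<Longrightarrow> openin (Zbar_top n Z) V \<Longrightarrow> V \<subseteq> U \<Longrightarrow> logfun_on n Z V f"
  using regular_on_subset[of U f V] unfolding logfun_on_def by blast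

lemma logfun_on_mult:
  assumes "logfun_on n Z U f" "logfun_on n Z U g"
  shows "logfun_on n Z U (\<lambda>q. f q * g q)"
  using assms regular_on_mult[of U f g] unfolding logfun_on_def by auto

lemma logfun_on_openin: "logfun_on n Z U f \<Longrightarrow> openin (Zbar_top n Z) U"
  by (simp add: logfun_on_def regular_on_def)

lemma Mon_mult:
  assumes "f \<in> Mon n Z p" "g \<in> Mon n Z p"
  shows "(\<lambda>q. f q * g q) \<in> Mon n Z p"
proof -
  obtain U V where UV: "p \<in> U" "logfun_on n Z U f" "p \<in> V" "logfun_on n Z V g"
    using assms unfolding Mon_def by blast
  have "openin (Zbar_top n Z) (U \<inter> V)" using UV logfun_on_openin by blast
  then have "logfun_on n Z (U \<inter> V) (\<lambda>q. f q * g q)"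
    using UV by (intro logfun_on_mult) (auto elim: logfun_on_subset)
  then show ?thesis using UV by (auto intro: MonI)
qed

lemma const_logfun: "c \<noteq> 0 \<Longrightarrow> logfun_on n Z (Zbar n Z) (\<lambda>q. c)"
  unfolding logfun_on_def
  by (intro conjI regular_on_quotient[OF _ homog_poly_const[of c] homog_poly_const[of 1]])
    (auto simp: topspace_Zbar[symmetric])

lemma const_Mon: "c \<noteq> 0 \<Longrightarrow> p \<in> Zbar n Z \<Longrightarrow> (\<lambda>q. c) \<in> Mon n Z p"
  using const_logfun MonI by blast

lemma ratio_logfun:
  assumes "a \<le> n"
  shows "logfun_on n Z (chart k) (ratio a k)"
  unfolding logfun_on_def
proof (intro conjI ballI)
  show "regular_on n Z (chart k) (ratio a k)"
    by (rule regular_on_quotient[OF openin_chart homog_poly_coord[of a] homog_poly_coord[of k]])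
      (metis mem_chart(2,3) ratio_ppt)
  fix q assume q: "q \<in> chart k - Zbdry n Z"
  then obtain v where v: "v \<in> Lx" "v k \<noteq> 0" "q = ppt v" unfolding chart_def by blast
  then have "v a \<noteq> 0" using q in_Zbdry_iff[OF v(1)] assms by blast
  then show "ratio a k q \<noteq> 0" using v ratio_ppt by simp
qed

lemma ratio_Mon: "a \<le> n \<Longrightarrow> p \<in> chart k \<Longrightarrow> ratio a k \<in> Mon n Z p"
  using ratio_logfun MonI by blast

lemma unit_logfun:
  "regular_on n Z W u \<Longrightarrow> (\<And>q. q \<in> W \<Longrightarrow> u q \<noteq> 0) \<Longrightarrow> logfun_on n Z W u"
  unfolding logfun_on_def by blast

lemma prod_ratio: "(\<Prod>i\<leftarrow>xs. v i / v k) = (\<Prod>i\<leftarrow>xs. v i) / v k ^ length xs" for v :: vec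
  by (induction xs) auto

text \<open>The normal form of germs: near a point of a chart, a function invertible off the
  boundary is a unit times a product of coordinate ratios. It results from factoring the numerator
  of a local presentation, as the denominator has no zeros.\<close>

lemma logfun_factor:
  assumes f: "logfun_on n Z U f" and p: "p \<in> U" "p \<in> chart k"
  shows "\<exists>W xs u. openin (Zbar_top n Z) W \<and> p \<in> W \<and> W \<subseteq> U \<and> W \<subseteq> chart k \<and> set xs \<subseteq> {..n} \<and>
    regular_on n Z W u \<and> (\<forall>q\<in>W. u q \<noteq> 0) \<and> (\<forall>q\<in>W. f q = u q * (\<Prod>i\<leftarrow>xs. ratio i k q))"
proof -
  obtain v0 where v0: "v0 \<in> Lx" "v0 k \<noteq> 0" "p = ppt v0" using p(2) unfolding chart_def by blast
  have "v0 \<in> L" using v0 by (simp add: Lx_def)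
  have freg: "regular_on n Z U f" using f by (simp add: logfun_on_def)
  then obtain W1 d g h where W1: "openin (Zbar_top n Z) W1" "p \<in> W1" "W1 \<subseteq> U"
    "homog_poly d g" "homog_poly d h" "\<forall>q\<in>W1. \<forall>v\<in>q. h v \<noteq> 0 \<and> f q = g v / h v"
    using p(1) unfolding regular_on_def by meson
  obtain N where N: "open N" "v0 \<in> N" "\<And>u. u \<in> Lx \<Longrightarrow> u \<in> N \<Longrightarrow> ppt u \<in> W1"
    using openin_ZbarE[OF W1(1) v0(1)] W1(2) v0(3) by blast
  have gh: "h v \<noteq> 0 \<and> f (ppt v) = g v / h v" if "v \<in> Lx" "v \<in> N" for v
    using W1(6) N(3)[OF that] mem_ppt[of v] by blast
  \<comment> \<open>Vectors without zero coordinate represent points off the boundary, where a log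
    function does not vanish; this feeds the factorisation.\<close>
  have nz: "g v \<noteq> 0" if v: "v \<in> L" "v \<in> N" "\<And>i. i \<le> n \<Longrightarrow> v i \<noteq> 0" for v
  proof -
    have vx: "v \<in> Lx" using v L_Lx[of v 0] by simp
    then have "ppt v \<in> U - Zbdry n Z" using N(3)[OF vx v(2)] W1(3) in_Zbdry_iff[OF vx] v(3) by blast
    then have "f (ppt v) \<noteq> 0" using f unfolding logfun_on_def by blast
    then show ?thesis using gh[OF vx v(2)] by auto
  qed
  obtain e where e: "e \<in> L" "\<And>i. i \<le> n \<Longrightarrow> e i \<noteq> 0" using generic_vector by blast
  obtain w where w: "w \<in> L" "w \<in> N" "\<And>i. i \<le> n \<Longrightarrow> w i \<noteq> 0"
    using L_dense[OF \<open>v0 \<in> L\<close> N(1,2)] by blast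
  obtain xs d' g' where xs: "set xs \<subseteq> {..n}" "d = d' + length xs" "homog_poly d' g'" "g' v0 \<noteq> 0"
    "\<forall>v\<in>L. g v = (\<Prod>i\<leftarrow>xs. v i) * g' v"
  proof -
    have "\<exists>xs d' g'. set xs \<subseteq> {..n} \<and> d = d' + length xs \<and> homog_poly d' g' \<and> g' v0 \<noteq> 0 \<and>
        (\<forall>v\<in>L. g v = (\<Prod>i\<leftarrow>xs. v i) * g' v)"
      by (rule homog_polyfun_factor[OF finite_A \<open>v0 \<in> L\<close> e N(1,2) w W1(4) nz])
    then show thesis by (elim exE conjE) (rule that)
  qed
  define N' where "N' = N \<inter> {v. v k \<noteq> 0} \<inter> {v. g' v \<noteq> 0}"
  have "open N'" unfolding N'_def using xs(3)
    by (intro open_Int N(1) open_coord_nonzero open_Collect_neq continuous_on_const polyfun_continuous_on)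
      (simp add: homog_poly_def)
  define W where "W = ppt ` (Lx \<inter> N')"
  \<comment> \<open>The power of \<open>v k\<close> restores the degree lost with the factors
    \<open>xs\<close>, so numerator and denominator both have degree \<open>d\<close> and the chosen
    representative does not matter.\<close>
  define u where "u q = (let v = SOME v. v \<in> q in g' v * v k ^ length xs / h v)" for q
  have oW: "openin (Zbar_top n Z) W" unfolding W_def by (rule openin_Zbar_image[OF \<open>open N'\<close>])
  have num: "homog_poly d (\<lambda>v. g' v * v k ^ length xs)"
    unfolding xs(2) by (intro homog_poly_mult xs(3) homog_poly_coord_power)
  have WW1: "W \<subseteq> W1" using N(3) unfolding W_def N'_def by blast
  have W_props: "v \<in> L" "v k \<noteq> 0" "g' v \<noteq> 0" "h v \<noteq> 0" "f q = g v / h v" "q = ppt v"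
    "u q = g' v * v k ^ length xs / h v" if q: "q \<in> W" "v \<in> q" for q v
  proof -
    obtain x where x: "x \<in> Lx" "x \<in> N'" "q = ppt x" using q(1) unfolding W_def by blast
    have "v \<in> ppt x" using q(2) x(3) by simp
    then obtain c where c: "c \<noteq> 0" "v = (\<lambda>i. c * x i)" by (rule mem_pptE)
    show "v \<in> L" using c L_scale x(1) by (simp add: Lx_def)
    show "v k \<noteq> 0" using x(2) c by (simp add: N'_def)
    show "g' v \<noteq> 0" using x(2) c xs(3) by (simp add: N'_def homog_poly_def)
    show hv: "h v \<noteq> 0" "f q = g v / h v" using W1(6) WW1 q by blast+
    show "q = ppt v" using \<open>v \<in> ppt x\<close> x(3) ppt_eq_if_mem by simp
    define y where "y = (SOME v. v \<in> q)"
    have "y \<in> q" unfolding y_def using someI[where P = "\<lambda>v. v \<in> q", OF q(2)] .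
    then have "y \<in> ppt v" using \<open>q = ppt v\<close> by simp
    then obtain b where b: "b \<noteq> 0" "y = (\<lambda>i. b * v i)" by (rule mem_pptE)
    have "u q = g' y * y k ^ length xs / h y" unfolding u_def y_def Let_def ..
    also have "\<dots> = (b ^ d * (g' v * v k ^ length xs)) / (b ^ d * h v)"
    proof -
      have "g' y * y k ^ length xs = b ^ d * (g' v * v k ^ length xs)"
        unfolding b(2) using num[unfolded homog_poly_def] by blast
      moreover have "h y = b ^ d * h v" unfolding b(2) using W1(5)[unfolded homog_poly_def] by blast
      ultimately show ?thesis by simp
    qed
    also have "\<dots> = g' v * v k ^ length xs / h v" using b(1) by simp
    finally show "u q = g' v * v k ^ length xs / h v" .
  qed
  have "v0 \<in> N'" using N(2) v0(2) xs(4) by (simp add: N'_def)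
  show ?thesis
  proof (intro exI conjI ballI)
    show "openin (Zbar_top n Z) W" by (rule oW)
    show "p \<in> W" using v0 \<open>v0 \<in> N'\<close> unfolding W_def by blast
    show "W \<subseteq> U" using WW1 W1(3) by blast
    show "W \<subseteq> chart k" unfolding W_def chart_def N'_def by blast
    show "set xs \<subseteq> {..n}" by (rule xs(1))
    show "regular_on n Z W u"
      by (rule regular_on_quotient[OF oW num W1(5)]) (intro conjI W_props(4,7))
    fix q assume q: "q \<in> W"
    then obtain v where "q = ppt v" unfolding W_def by blast
    then have v: "v \<in> q" using mem_ppt by simp
    note P = W_props[OF q v]
    show "u q \<noteq> 0" using P by simp
    have "(\<Prod>i\<leftarrow>xs. ratio i k q) = (\<Prod>i\<leftarrow>xs. v i / v k)"
      unfolding P(6) ratio_ppt[of v k, OF P(2)] ..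
    then have "u q * (\<Prod>i\<leftarrow>xs. ratio i k q) = g' v * (\<Prod>i\<leftarrow>xs. v i) / h v"
      using P(2,7) by (simp add: prod_ratio)
    then show "f q = u q * (\<Prod>i\<leftarrow>xs. ratio i k q)"
      using P(5) xs(5) P(1) by (simp add: mult.commute)
  qed
qed

end

section \<open>Polar coordinates on the Kato--Nakayama space\<close>

lemma sgn_complex: "z / of_real (cmod z) = sgn z"
  by (simp add: sgn_eq)

lemma norm_mult_sgn: "complex_of_real (cmod z) * sgn z = z"
  by (simp add: sgn_eq)

context very_affine
begin

lemma ZlogD:
  assumes "(p, h) \<in> Zlog n Z"
  shows "p \<in> Zbar n Z"
    and "\<And>f. f \<notin> Mon n Z p \<Longrightarrow> h f = 1"
    and "\<And>f. f \<in> Mon n Z p \<Longrightarrow> cmod (h f) = 1"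
    and "\<And>f g. f \<in> Mon n Z p \<Longrightarrow> g \<in> Mon n Z p \<Longrightarrow> same_germ n Z p f g \<Longrightarrow> h f = h g"
    and "\<And>f g. f \<in> Mon n Z p \<Longrightarrow> g \<in> Mon n Z p \<Longrightarrow> h (\<lambda>q. f q * g q) = h f * h g"
    and "\<And>f. f \<in> Mon n Z p \<Longrightarrow> f p \<noteq> 0 \<Longrightarrow> h f = sgn (f p)"
  using assms unfolding Zlog_def KN_hom_def sgn_complex by auto

lemma same_germI: "openin (Zbar_top n Z) U \<Longrightarrow> p \<in> U \<Longrightarrow> (\<And>q. q \<in> U \<Longrightarrow> f q = g q) \<Longrightarrow> same_germ n Z p f g"
  unfolding same_germ_def by blast

lemma KN_prod_ratio:
  assumes z: "(p, h) \<in> Zlog n Z" and p: "p \<in> chart k" and "set xs \<subseteq> {..n}"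
  shows "(\<lambda>q. \<Prod>i\<leftarrow>xs. ratio i k q) \<in> Mon n Z p \<and>
    h (\<lambda>q. \<Prod>i\<leftarrow>xs. ratio i k q) = (\<Prod>i\<leftarrow>xs. h (ratio i k))"
  using assms(3)
proof (induction xs)
  case Nil
  have m: "(\<lambda>q. 1) \<in> Mon n Z p" using const_Mon[of 1 p] ZlogD(1)[OF z] by simp
  then show ?case using ZlogD(6)[OF z m] by simp
next
  case (Cons a xs)
  have m: "ratio a k \<in> Mon n Z p" using ratio_Mon[OF _ p] Cons.prems by simp
  have IH: "(\<lambda>q. \<Prod>i\<leftarrow>xs. ratio i k q) \<in> Mon n Z p"
    "h (\<lambda>q. \<Prod>i\<leftarrow>xs. ratio i k q) = (\<Prod>i\<leftarrow>xs. h (ratio i k))"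
    using Cons by simp_all
  show ?case using Mon_mult[OF m IH(1)] ZlogD(5)[OF z m IH(1)] IH(2) by simp
qed

lemma KN_factor:
  assumes z: "(p, h) \<in> Zlog n Z" and W: "openin (Zbar_top n Z) W" "p \<in> W" "W \<subseteq> chart k"
    and xs: "set xs \<subseteq> {..n}" and u: "regular_on n Z W u" "\<And>q. q \<in> W \<Longrightarrow> u q \<noteq> 0"
    and f: "f \<in> Mon n Z p" "\<And>q. q \<in> W \<Longrightarrow> f q = u q * (\<Prod>i\<leftarrow>xs. ratio i k q)"
  shows "h f = sgn (u p) * (\<Prod>i\<leftarrow>xs. h (ratio i k))"
proof -
  have um: "u \<in> Mon n Z p" using unit_logfun[OF u] W(2) by (rule MonI)
  have p: "p \<in> chart k" using W by blast
  note P = KN_prod_ratio[OF z p xs]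
  have "same_germ n Z p f (\<lambda>q. u q * (\<Prod>i\<leftarrow>xs. ratio i k q))"
    using W(1,2) f(2) by (rule same_germI)
  then have "h f = h (\<lambda>q. u q * (\<Prod>i\<leftarrow>xs. ratio i k q))"
    using ZlogD(4)[OF z f(1) Mon_mult[OF um conjunct1[OF P]]] by simp
  also have "\<dots> = h u * (\<Prod>i\<leftarrow>xs. h (ratio i k))"
    using ZlogD(5)[OF z um conjunct1[OF P]] P by simp
  also have "h u = sgn (u p)" using ZlogD(6)[OF z um] u(2)[OF W(2)] by simp
  finally show ?thesis .
qed

text \<open>Expresses the change of chart; it makes the angle coordinates independent of the
  reference index chosen in \<open>ang\<close>.\<close>

lemma KN_ratio_cocycle:
  assumes z: "(p, h) \<in> Zlog n Z" and p: "p \<in> chart k" "p \<in> chart l" and le: "j \<le> n" "l \<le> n"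
  shows "h (ratio j k) = h (ratio j l) * h (ratio l k)"
proof -
  have m: "ratio j k \<in> Mon n Z p" "ratio j l \<in> Mon n Z p" "ratio l k \<in> Mon n Z p"
    using ratio_Mon p le by auto
  have "same_germ n Z p (ratio j k) (\<lambda>q. ratio j l q * ratio l k q)"
  proof (rule same_germI)
    show "openin (Zbar_top n Z) (chart k \<inter> chart l)" using openin_chart by blast
    fix q assume q: "q \<in> chart k \<inter> chart l"
    then obtain v where v: "v k \<noteq> 0" "q = ppt v" unfolding chart_def by blast
    then have "v l \<noteq> 0" using q mem_chart(2)[of q l v] mem_ppt[of v] by blast
    then show "ratio j k q = ratio j l q * ratio l k q" using v by (simp add: ratio_ppt)
  qed (use p in blast)
  then show ?thesis
    using ZlogD(4)[OF z m(1) Mon_mult[OF m(2,3)]] ZlogD(5)[OF z m(2,3)] by simp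
qed

lemma KN_ratio_self:
  assumes z: "(p, h) \<in> Zlog n Z" and p: "p \<in> chart k" "k \<le> n"
  shows "h (ratio k k) = 1"
proof -
  obtain v where "v k \<noteq> 0" "p = ppt v" using p(1) unfolding chart_def by blast
  then have "ratio k k p = 1" by (simp add: ratio_ppt)
  then show ?thesis using ZlogD(6)[OF z ratio_Mon[OF p(2,1)]] by simp
qed

lemma KN_ratio_norm:
  "(p, h) \<in> Zlog n Z \<Longrightarrow> p \<in> chart k \<Longrightarrow> j \<le> n \<Longrightarrow> cmod (h (ratio j k)) = 1"
  by (rule ZlogD(3)[OF _ ratio_Mon])

text \<open>The arbitrary index inside \<open>ang\<close> may be replaced by any chart index, since
  the cocycle factor cancels in the quotient. The case \<open>j = 0\<close> agrees with the value 1
  supplied by \<open>ext1\<close>.\<close>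

lemma ext1_ang:
  assumes z: "(p, h) \<in> Zlog n Z" and p: "p \<in> chart k" "k \<le> n" and j: "j \<le> n"
  shows "ext1 (ang n (p, h)) j = h (ratio j k) / h (ratio 0 k)"
proof -
  define l where "l = (SOME k. k \<le> n \<and> (\<forall>v\<in>p. v k \<noteq> 0))"
  have "\<exists>k. k \<le> n \<and> (\<forall>v\<in>p. v k \<noteq> 0)" using p mem_chart(2)[OF p(1)] by blast
  then have l: "l \<le> n \<and> (\<forall>v\<in>p. v l \<noteq> 0)" unfolding l_def by (rule someI_ex)
  obtain v where v: "v \<in> Lx" "p = ppt v" using p(1) unfolding chart_def by blast
  then have pl: "p \<in> chart l" using l mem_ppt[of v] ppt_in_chart by simp
  have nz: "h (ratio i l) \<noteq> 0" "h (ratio i k) \<noteq> 0" if "i \<le> n" for i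
    using KN_ratio_norm[OF z pl that] KN_ratio_norm[OF z p(1) that] by auto
  have c: "h (ratio i l) = h (ratio i k) * h (ratio k l)" if "i \<le> n" for i
    using KN_ratio_cocycle[OF z pl p(1) that p(2)] .
  have "ext1 (ang n (p, h)) j = h (ratio j l) / h (ratio 0 l)"
    using j nz by (auto simp: ext1_def ang_def Let_def l_def[symmetric])
  also have "\<dots> = h (ratio j k) / h (ratio 0 k)"
    unfolding c[OF j] c[OF le0] using nz p(2) c[OF p(2)] by (simp add: divide_simps)
  finally show ?thesis .
qed

lemma h_ratio_eq:
  assumes z: "(p, h) \<in> Zlog n Z" and p: "p \<in> chart k" "k \<le> n" and j: "j \<le> n"
  shows "h (ratio j k) = ext1 (ang n (p, h)) j / ext1 (ang n (p, h)) k"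
  using KN_ratio_norm[OF z p(1), of 0]
  by (simp add: ext1_ang[OF z p] j p(2) KN_ratio_self[OF z p]) (auto simp: divide_simps)

lemma norm_ext1_ang:
  assumes z: "(p, h) \<in> Zlog n Z" and j: "j \<le> n"
  shows "cmod (ext1 (ang n (p, h)) j) = 1"
proof -
  obtain k where k: "k \<le> n" "p \<in> chart k" using chart_exists ZlogD(1)[OF z] by blast
  show ?thesis
    by (simp add: ext1_ang[OF z k(2,1) j] norm_divide KN_ratio_norm[OF z k(2)] j)
qed

text \<open>The right-hand side involves only the base point and the angle vector, so these two
  determine \<open>h\<close>. Injectivity of \<open>Psi\<close> and continuity of its inverse both
  rest on this.\<close>

lemma KN_value:
  assumes z: "(p, h) \<in> Zlog n Z" and W: "openin (Zbar_top n Z) W" "p \<in> W" "W \<subseteq> chart k" and k: "k \<le> n"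
    and xs: "set xs \<subseteq> {..n}" and u: "regular_on n Z W u" "\<And>q. q \<in> W \<Longrightarrow> u q \<noteq> 0"
    and f: "f \<in> Mon n Z p" "\<And>q. q \<in> W \<Longrightarrow> f q = u q * (\<Prod>i\<leftarrow>xs. ratio i k q)"
  shows "h f = sgn (u p) * (\<Prod>i\<leftarrow>xs. ext1 (ang n (p, h)) i / ext1 (ang n (p, h)) k)"
proof -
  have p: "p \<in> chart k" using W by blast
  have "(\<Prod>i\<leftarrow>xs. h (ratio i k)) = (\<Prod>i\<leftarrow>xs. ext1 (ang n (p, h)) i / ext1 (ang n (p, h)) k)"
    using xs h_ratio_eq[OF z p k] by (intro arg_cong[of _ _ prod_list] map_cong) auto
  then show ?thesis using KN_factor[OF z W xs u f] by simp
qed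

text \<open>A point \<^term>\<open>(v, y)\<close> of \<open>polar\<close> encodes the normalised vector \<^term>\<open>v\<close> of a point of the closure
  together with phases \<^term>\<open>ext1 y\<close> of its coordinates. The phase of a vanishing coordinate is free,
  except that coordinates which are proportional on the whole space have compatible phases.\<close>

definition polar :: "(vec \<times> vec) set" where
  "polar = {(v, y). v \<in> Lx \<and> (\<Sum>i\<le>n. cmod (v i)) = 1 \<and> y 0 = 0 \<and> (\<forall>i>n. y i = 0) \<and>
     (\<forall>i\<le>n. cmod (ext1 y i) = 1 \<and> v i = of_real (cmod (v i)) * ext1 y i) \<and>
     (\<forall>i\<le>n. \<forall>j\<le>n. \<forall>c. (\<forall>u\<in>L. u i = c * u j) \<longrightarrow>
        of_real (cmod c) * ext1 y i = c * ext1 y j)}"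

definition rho :: "nat \<Rightarrow> vec set \<Rightarrow> real" where
  "rho i q = (let v = SOME v. v \<in> q in cmod (v i) / (\<Sum>j\<le>n. cmod (v j)))"

text \<open>The first component is the representative of the base point whose moduli sum to 1 and
  whose phases are those of the angle vector. Where a coordinate vanishes the modulus is 0 and the
  phase is remembered only by the second component.\<close>

definition Psi :: "KNpt \<Rightarrow> vec \<times> vec" where
  "Psi z = (\<lambda>i. of_real (rho i (fst z)) * ext1 (ang n z) i, ang n z)"

lemma sum_norm_pos: "v \<in> Lx \<Longrightarrow> 0 < (\<Sum>j\<le>n. cmod (v j))"
  using Lx_coord[of v] by (auto intro!: sum_pos2)

lemma rho_ppt:
  assumes "v \<in> Lx"
  shows "rho i (ppt v) = cmod (v i) / (\<Sum>j\<le>n. cmod (v j))"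
  unfolding rho_def Let_def using SOME_in_ppt[of v]
  by (elim mem_pptE) (simp add: norm_mult flip: sum_distrib_left)

lemma fst_Psi:
  assumes z: "(p, h) \<in> Zlog n Z" and v: "v \<in> Lx" "p = ppt v"
  shows "\<exists>c. c \<noteq> 0 \<and> fst (Psi (p, h)) = (\<lambda>i. c * v i)"
proof -
  obtain k where k: "k \<le> n" "v k \<noteq> 0" using Lx_coord[OF v(1)] by blast
  have p: "p \<in> chart k" using ppt_in_chart v k by blast
  define S where "S = (\<Sum>j\<le>n. cmod (v j))"
  have S: "S > 0" unfolding S_def by (rule sum_norm_pos[OF v(1)])
  \<comment> \<open>Chosen from the coordinate \<open>k\<close>: it strips the phase of
    \<open>v k\<close>, rescales the moduli to sum 1, and turns the phase into
    \<open>1 / h (ratio 0 k)\<close>, the \<open>k\<close>-th angle.\<close>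
  define c where "c = of_real (cmod (v k)) / (of_real S * v k * h (ratio 0 k))"
  have h0: "h (ratio 0 k) \<noteq> 0" using KN_ratio_norm[OF z p, of 0] by auto
  have "of_real (rho i p) * ext1 (ang n (p, h)) i = c * v i" for i
  proof (cases "v i = 0")
    case True
    then show ?thesis using v by (simp add: rho_ppt)
  next
    case False
    then have i: "i \<le> n" using v(1) by (auto simp: Lx_def linear_space_def Cn1_def intro: leI)
    have "ratio i k p = v i / v k" using v k by (simp add: ratio_ppt)
    then have "h (ratio i k) = sgn (v i / v k)"
      using ZlogD(6)[OF z ratio_Mon[OF i p]] False k by simp
    then have e: "ext1 (ang n (p, h)) i = sgn (v i / v k) / h (ratio 0 k)"
      using ext1_ang[OF z p k(1) i] by simp
    have r: "rho i p = cmod (v i) / S" using v by (simp add: rho_ppt S_def)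
    show ?thesis
      unfolding e r c_def using False k h0 S by (simp add: sgn_eq norm_divide field_simps)
  qed
  moreover have "c \<noteq> 0" using k h0 S by (simp add: c_def)
  ultimately show ?thesis unfolding Psi_def by auto
qed

lemma ppt_fst_Psi:
  assumes z: "z \<in> Zlog n Z"
  shows "ppt (fst (Psi z)) = fst z" "fst (Psi z) \<in> Lx"
proof -
  obtain p h where ph: "z = (p, h)" by (cases z)
  obtain v where v: "v \<in> Lx" "p = ppt v" using ZlogD(1)[of p h] z ph ZbarE by blast
  then obtain c where "c \<noteq> 0" "fst (Psi (p, h)) = (\<lambda>i. c * v i)" using fst_Psi[of p h v] z ph by blast
  then show "ppt (fst (Psi z)) = fst z" "fst (Psi z) \<in> Lx"
    using ph v ppt_scale Lx_scale by auto
qed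

lemma snd_Psi: "snd (Psi z) = ang n z"
  by (simp add: Psi_def)

lemma Psi_in_polar:
  assumes z: "z \<in> Zlog n Z"
  shows "Psi z \<in> polar"
proof -
  obtain p h where ph: "z = (p, h)" by (cases z)
  note z' = z[unfolded ph]
  obtain v where v: "v \<in> Lx" "p = ppt v" using ZlogD(1)[OF z'] ZbarE by blast
  define S where "S = (\<Sum>j\<le>n. cmod (v j))"
  have S: "S > 0" unfolding S_def by (rule sum_norm_pos[OF v(1)])
  have rho: "rho i p = cmod (v i) / S" for i using v by (simp add: rho_ppt S_def)
  have nrm: "cmod (fst (Psi z) i) = rho i p" if "i \<le> n" for i
    using norm_ext1_ang[OF z' that] S by (simp add: Psi_def ph norm_mult norm_divide rho)
  have "(\<Sum>i\<le>n. cmod (fst (Psi z) i)) = (\<Sum>i\<le>n. cmod (v i) / S)"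
    by (intro sum.cong) (auto simp: nrm rho)
  also have "\<dots> = 1" using S by (simp add: S_def flip: sum_divide_distrib)
  finally have 1: "(\<Sum>i\<le>n. cmod (fst (Psi z) i)) = 1" .
  \<comment> \<open>If two coordinates are proportional on \<open>L\<close>, their ratios to
    \<open>X_k\<close> differ by the constant unit \<open>c\<close>, on which \<open>h\<close> is
    forced to be \<open>sgn c\<close>. A vector without zero coordinate shows
    \<open>c \<noteq> 0\<close>.\<close>
  have 2: "of_real (cmod c) * ext1 (ang n z) i = c * ext1 (ang n z) j"
    if ij: "i \<le> n" "j \<le> n" and c: "\<And>u. u \<in> L \<Longrightarrow> u i = c * u j" for i j c
  proof -
    obtain e where e: "e \<in> L" "\<And>i. i \<le> n \<Longrightarrow> e i \<noteq> 0" using generic_vector by blast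
    then have c0: "c \<noteq> 0" using c[OF e(1)] ij by auto
    obtain k where k: "k \<le> n" "p \<in> chart k" using chart_exists ZlogD(1)[OF z'] by blast
    have cm: "(\<lambda>q. c) \<in> Mon n Z p" using const_Mon[OF c0 ZlogD(1)[OF z']] .
    have m: "ratio i k \<in> Mon n Z p" "ratio j k \<in> Mon n Z p" using ratio_Mon ij k by auto
    have "same_germ n Z p (ratio i k) (\<lambda>q. c * ratio j k q)"
    proof (rule same_germI[OF openin_chart k(2)])
      fix q assume "q \<in> chart k"
      then obtain v where "v k \<noteq> 0" "q = ppt v" "v \<in> L" unfolding chart_def Lx_def by blast
      then show "ratio i k q = c * ratio j k q" using c by (simp add: ratio_ppt)
    qed
    then have "h (ratio i k) = sgn c * h (ratio j k)"
      using ZlogD(4)[OF z' m(1) Mon_mult[OF cm m(2)]] ZlogD(5)[OF z' cm m(2)] ZlogD(6)[OF z' cm] c0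
      by simp
    then have "ext1 (ang n z) i = sgn c * ext1 (ang n z) j"
      using ext1_ang[OF z' k(2,1)] ij ph by simp
    then show ?thesis using norm_mult_sgn[of c] by (metis mult.assoc)
  qed
  have 3: "fst (Psi z) i = of_real (cmod (fst (Psi z) i)) * ext1 (ang n z) i" if "i \<le> n" for i
    using nrm[OF that] by (simp add: Psi_def ph)
  have "(fst (Psi z), ang n z) \<in> polar"
    unfolding polar_def
    using ppt_fst_Psi(2)[OF z] 1 2 3 norm_ext1_ang[OF z'] by (simp add: ph) (simp add: ang_def Let_def)
  then show ?thesis by (simp add: Psi_def)
qed

text \<open>By the normal form, \<open>h\<close> is fixed on every germ by the base point and the
  angles; outside the monoid both homomorphisms are normalised to 1.\<close>

lemma Psi_inj: "inj_on Psi (Zlog n Z)"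
proof (rule inj_onI)
  fix z z' assume z: "z \<in> Zlog n Z" "z' \<in> Zlog n Z" and eq: "Psi z = Psi z'"
  have fst_eq: "fst z = fst z'" using ppt_fst_Psi(1)[OF z(1)] ppt_fst_Psi(1)[OF z(2)] eq by simp
  then obtain p h h' where ph: "z = (p, h)" "z' = (p, h')" by (metis prod.collapse)
  have ang_eq: "ang n (p, h) = ang n (p, h')" using arg_cong[OF eq, of snd] ph by (simp add: snd_Psi)
  note Z1 = z(1)[unfolded ph] and Z2 = z(2)[unfolded ph]
  have "h f = h' f" for f
  proof (cases "f \<in> Mon n Z p")
    case True
    obtain k where k: "k \<le> n" "p \<in> chart k" using chart_exists ZlogD(1)[OF Z1] by blast
    obtain U where U: "p \<in> U" "logfun_on n Z U f" using True unfolding Mon_def by blast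
    obtain W xs u where W: "openin (Zbar_top n Z) W" "p \<in> W" "W \<subseteq> U" "W \<subseteq> chart k" "set xs \<subseteq> {..n}"
      "regular_on n Z W u" "\<forall>q\<in>W. u q \<noteq> 0" "\<forall>q\<in>W. f q = u q * (\<Prod>i\<leftarrow>xs. ratio i k q)"
      using logfun_factor[OF U(2,1) k(2)] by (elim exE conjE) (rule that)
    show ?thesis
      using KN_value[OF Z1 W(1,2,4) k(1) W(5,6) bspec[OF W(7)] True bspec[OF W(8)]]
        KN_value[OF Z2 W(1,2,4) k(1) W(5,6) bspec[OF W(7)] True bspec[OF W(8)]] ang_eq by simp
  qed (use ZlogD(2)[OF Z1] ZlogD(2)[OF Z2] in simp)
  then show "z = z'" using ph by auto
qed

end

section \<open>Prescribing phases of vanishing coordinates\<close>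

lemma sgn_eqI: "z \<noteq> 0 \<Longrightarrow> z = of_real (cmod z) * s \<Longrightarrow> sgn z = s"
  by (metis nonzero_mult_div_cancel_left norm_eq_zero of_real_eq_0_iff sgn_complex)

lemma sgn_prod_list: "sgn (\<Prod>i\<leftarrow>xs. f i) = (\<Prod>i\<leftarrow>xs. sgn (f i))" for f :: "'a \<Rightarrow> complex"
  by (induction xs) (auto simp: sgn_mult)

lemma tendsto_prod_list:
  fixes f :: "'b \<Rightarrow> 'a \<Rightarrow> complex"
  shows "(\<And>i. i \<in> set xs \<Longrightarrow> ((\<lambda>t. f t i) \<longlongrightarrow> l i) F) \<Longrightarrow>
    ((\<lambda>t. \<Prod>i\<leftarrow>xs. f t i) \<longlongrightarrow> (\<Prod>i\<leftarrow>xs. l i)) F"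
  by (induction xs) (auto intro!: tendsto_intros)

lemma linear_space_sum:
  assumes "finite I" "\<And>i. i \<in> I \<Longrightarrow> e i \<in> linear_space n A"
  shows "(\<lambda>k. \<Sum>i\<in>I. a i * e i k) \<in> linear_space n A"
  using assms
proof (induction I rule: finite_induct)
  case empty
  then show ?case by (simp add: linear_space_def Cn1_def)
next
  case (insert i I)
  have "(\<lambda>k. a i * e i k + 1 * (\<Sum>i\<in>I. a i * e i k)) \<in> linear_space n A"
    using insert by (intro linear_space_lincomb) auto
  then show ?case using insert.hyps by simp
qed

text \<open>Linearly independent coordinate functions can take arbitrary values simultaneously. The
  induction needs a vector that vanishes on \<open>T\<close> but not at \<open>j\<close>; without
  one, the coordinate \<open>j\<close> would depend on those in \<open>T\<close>.\<close>

lemma linear_space_interpolate: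
  assumes "finite T"
    "\<And>c. (\<And>v. v \<in> linear_space n A \<Longrightarrow> (\<Sum>i\<in>T. c i * v i) = 0) \<Longrightarrow> (\<forall>i\<in>T. c i = 0)"
  shows "\<exists>w\<in>linear_space n A. \<forall>i\<in>T. w i = t i"
  using assms
proof (induction T arbitrary: t rule: finite_induct)
  case empty
  have "(\<lambda>i. 0) \<in> linear_space n A" by (simp add: linear_space_def Cn1_def)
  then show ?case by blast
next
  case (insert j T)
  let ?L = "linear_space n A"
  have IH: "\<exists>w\<in>?L. \<forall>i\<in>T. w i = t i" for t
  proof (rule insert.IH)
    fix c assume c: "\<And>v. v \<in> ?L \<Longrightarrow> (\<Sum>i\<in>T. c i * v i) = 0"
    have "\<forall>i\<in>insert j T. (if i = j then 0 else c i) = 0"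
    proof (rule insert.prems)
      fix v assume "v \<in> ?L"
      have "(\<Sum>i\<in>insert j T. (if i = j then 0 else c i) * v i) = (\<Sum>i\<in>T. c i * v i)"
        using insert.hyps by (auto intro!: sum.cong)
      then show "(\<Sum>i\<in>insert j T. (if i = j then 0 else c i) * v i) = 0" using c \<open>v \<in> ?L\<close> by simp
    qed
    then show "\<forall>i\<in>T. c i = 0" using insert.hyps by (metis insertI2)
  qed
  have "\<exists>e\<in>?L. (\<forall>i\<in>T. e i = 0) \<and> e j \<noteq> 0"
  proof (rule ccontr)
    assume neg: "\<not> ?thesis"
    have "\<forall>i. \<exists>w\<in>?L. \<forall>l\<in>T. w l = (if l = i then 1 else 0)"
      by (rule allI) (rule IH)
    then obtain e where e: "\<And>i. e i \<in> ?L" "\<And>i l. l \<in> T \<Longrightarrow> e i l = (if l = i then 1 else 0)" by metis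
    \<comment> \<open>The coefficients of the dependence: with \<open>e i\<close> dual to the
      coordinates in \<open>T\<close>, every \<open>v\<close> would satisfy
      \<open>v j = (\<Sum>i\<in>T. v i * e i j)\<close>.\<close>
    have "\<forall>i\<in>insert j T. (if i = j then 1 else - e i j) = 0"
    proof (rule insert.prems)
      fix v assume v: "v \<in> ?L"
      define u where "u = (\<lambda>k. 1 * v k + (-1) * (\<Sum>i\<in>T. v i * e i k))"
      have "u \<in> ?L" unfolding u_def
        using v e(1) insert.hyps by (intro linear_space_lincomb linear_space_sum) auto
      moreover have "u l = 0" if "l \<in> T" for l
      proof -
        have "(\<Sum>i\<in>T. v i * e i l) = (\<Sum>i\<in>T. if i = l then v i else 0)"
          by (intro sum.cong) (auto simp: e(2)[OF that])
        then show ?thesis using that insert.hyps(1) by (simp add: u_def)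
      qed
      ultimately have "u j = 0" using neg by blast
      have "(\<Sum>i\<in>insert j T. (if i = j then 1 else - e i j) * v i)
          = v j + (\<Sum>i\<in>T. (if i = j then 1 else - e i j) * v i)"
        using insert.hyps by simp
      also have "(\<Sum>i\<in>T. (if i = j then 1 else - e i j) * v i) = (\<Sum>i\<in>T. - (v i * e i j))"
        using insert.hyps by (intro sum.cong) auto
      finally show "(\<Sum>i\<in>insert j T. (if i = j then 1 else - e i j) * v i) = 0"
        using \<open>u j = 0\<close> by (simp add: u_def sum_negf)
    qed
    then show False by auto
  qed
  then obtain e where e: "e \<in> ?L" "\<forall>i\<in>T. e i = 0" "e j \<noteq> 0" by blast
  obtain w where w: "w \<in> ?L" "\<forall>i\<in>T. w i = t i" using IH by blast
  have "(\<lambda>k. 1 * w k + ((t j - w j) / e j) * e k) \<in> ?L" using w(1) e(1) by (rule linear_space_lincomb)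
  moreover have "\<forall>i\<in>insert j T. 1 * w i + ((t j - w j) / e j) * e i = t i"
    using w e insert.hyps by auto
  ultimately show ?case
    by (intro bexI[of _ "\<lambda>k. 1 * w k + ((t j - w j) / e j) * e k"])
qed

context very_affine
begin

lemma ppt_in_Zstr:
  assumes "v \<in> Lx"
  shows "ppt v \<in> Zstr n Z S \<longleftrightarrow> (\<forall>i\<in>S. v i = 0)"
  unfolding Zstr_def using ppt_in_Zbar[OF assms] zero_iff_mem_ppt[of _ v] mem_ppt[of v] by blast

text \<open>Two linear forms with the same zeros are proportional. The factor is read off at a
  vector \<open>e\<close> without zero coordinates, and \<open>w\<close> is the projection of
  \<open>u\<close> along \<open>e\<close> to the \<open>j\<close>-th hyperplane.\<close>

lemma proportional_if_Zstr_eq: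
  assumes ij: "i \<le> n" "j \<le> n" and eq: "Zstr n Z {i} = Zstr n Z {j}"
  shows "\<exists>c. c \<noteq> 0 \<and> (\<forall>u\<in>L. u i = c * u j)"
proof -
  obtain e where e: "e \<in> L" "\<And>i. i \<le> n \<Longrightarrow> e i \<noteq> 0" using generic_vector by blast
  have "u i = e i / e j * u j" if u: "u \<in> L" for u
  proof -
    define w where "w = (\<lambda>k. 1 * u k + (- u j / e j) * e k)"
    have w: "w \<in> L" "w j = 0" unfolding w_def
      using linear_space_lincomb[OF u e(1)] e(2)[OF ij(2)] by (blast, simp)
    have "w i = 0"
    proof (rule ccontr)
      assume "w i \<noteq> 0"
      then have "w \<in> Lx" using w(1) L_Lx by blast
      then have "ppt w \<in> Zstr n Z {j}" "ppt w \<notin> Zstr n Z {i}"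
        using w(2) \<open>w i \<noteq> 0\<close> by (simp_all add: ppt_in_Zstr)
      then show False using eq by simp
    qed
    then show ?thesis using e(2)[OF ij(2)] by (simp add: w_def field_simps)
  qed
  then show ?thesis using e(2) ij by (intro exI[of _ "e i / e j"]) auto
qed

lemma polarD:
  assumes "(v, y) \<in> polar"
  shows "v \<in> Lx" "v \<in> L" "(\<Sum>i\<le>n. cmod (v i)) = 1" "y 0 = 0" "\<And>i. i > n \<Longrightarrow> y i = 0"
    "\<And>i. i \<le> n \<Longrightarrow> cmod (ext1 y i) = 1"
    "\<And>i. i \<le> n \<Longrightarrow> v i = of_real (cmod (v i)) * ext1 y i"
    "\<And>i j c. i \<le> n \<Longrightarrow> j \<le> n \<Longrightarrow> (\<And>u. u \<in> L \<Longrightarrow> u i = c * u j) \<Longrightarrow>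
        of_real (cmod c) * ext1 y i = c * ext1 y j"
  using assms unfolding polar_def Lx_def by auto

end

locale snc_very_affine = very_affine +
  assumes snc: "snc_compactifying n Z"
begin

text \<open>The place where normal crossings are used. One coordinate per hyperplane through the
  point is prescribed by interpolation; the others follow by proportionality, and the compatibility
  clause of \<open>polar\<close> gives them the right phase. The set \<open>B\<close> lists
  coordinates to be kept at zero and must not separate coordinates with the same hyperplane.\<close>

lemma phase_vector:
  assumes vy: "(v, y) \<in> polar"
    and B: "\<And>i j. i \<le> n \<Longrightarrow> j \<in> B \<Longrightarrow> Zstr n Z {i} = Zstr n Z {j} \<Longrightarrow> i \<in> B"
  shows "\<exists>w\<in>L. \<forall>i\<le>n. v i = 0 \<longrightarrow>
    (if i \<in> B then w i = 0 else w i \<noteq> 0 \<and> w i = of_real (cmod (w i)) * ext1 y i)"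
proof -
  note P = polarD[OF vy]
  define T where "T = {i. i \<le> n \<and> v i = 0}"
  \<comment> \<open>Representatives of coinciding hyperplanes are needed because
    \<open>snc_compactifying\<close> speaks only of index sets whose hyperplanes are pairwise
    distinct.\<close>
  define r where "r i = (SOME j. j \<in> T \<and> Zstr n Z {j} = Zstr n Z {i})" for i
  have r: "r i \<in> T \<and> Zstr n Z {r i} = Zstr n Z {i}" if "i \<in> T" for i
    unfolding r_def by (rule someI[of _ i]) (use that in simp)
  have r_inj: "r i = r j" if "Zstr n Z {i} = Zstr n Z {j}" for i j
    unfolding r_def using that by simp
  have sub: "r ` T \<subseteq> {0..n}" "finite (r ` T)" using r by (auto simp: T_def)
  have dist: "\<forall>i\<in>r ` T. \<forall>j\<in>r ` T. i \<noteq> j \<longrightarrow> Zstr n Z {i} \<noteq> Zstr n Z {j}"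
  proof (intro ballI impI notI)
    fix i j assume "i \<in> r ` T" "j \<in> r ` T" "i \<noteq> j" "Zstr n Z {i} = Zstr n Z {j}"
    then obtain a b where "a \<in> T" "b \<in> T" "i = r a" "j = r b" "Zstr n Z {r a} = Zstr n Z {r b}" by blast
    then show False using r[of a] r[of b] r_inj[of a b] \<open>i \<noteq> j\<close> by simp
  qed
  \<comment> \<open>The point itself witnesses that the stratum is nonempty, the other premise of
    the normal crossings condition.\<close>
  have "ppt v \<in> Zstr n Z (r ` T)" using r by (auto simp: ppt_in_Zstr P(1) T_def)
  then have indep: "(\<forall>p\<in>Zbar n Z. \<forall>u\<in>p. (\<Sum>i\<in>r ` T. c i * u i) = 0) \<longrightarrow> (\<forall>i\<in>r ` T. c i = 0)" for c
    using snc[unfolded snc_compactifying_def, rule_format, of "r ` T" c] sub(1) dist by blast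
  have "\<exists>w\<in>L. \<forall>i\<in>r ` T. w i = (if i \<in> B then 0 else ext1 y i)"
  proof (rule linear_space_interpolate[OF sub(2)])
    fix c assume c: "\<And>u. u \<in> L \<Longrightarrow> (\<Sum>i\<in>r ` T. c i * u i) = 0"
    have "\<forall>p\<in>Zbar n Z. \<forall>u\<in>p. (\<Sum>i\<in>r ` T. c i * u i) = 0"
    proof (intro ballI)
      fix p u assume "p \<in> Zbar n Z" "u \<in> p"
      then have "u \<in> L" using mem_Zbar(1) unfolding Lx_def by blast
      then show "(\<Sum>i\<in>r ` T. c i * u i) = 0" by (rule c)
    qed
    then show "\<forall>i\<in>r ` T. c i = 0" using indep by blast
  qed
  then obtain w where w: "w \<in> L" "\<And>i. i \<in> T \<Longrightarrow> w (r i) = (if r i \<in> B then 0 else ext1 y (r i))" by blast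
  have "if i \<in> B then w i = 0 else w i \<noteq> 0 \<and> w i = of_real (cmod (w i)) * ext1 y i"
    if i: "i \<le> n" "v i = 0" for i
  proof -
    have iT: "i \<in> T" using i by (simp add: T_def)
    have le: "r i \<le> n" and eq: "Zstr n Z {i} = Zstr n Z {r i}" using r[OF iT] by (auto simp: T_def)
    obtain c where c: "c \<noteq> 0" "\<And>u. u \<in> L \<Longrightarrow> u i = c * u (r i)"
      using proportional_if_Zstr_eq[OF i(1) le eq] by blast
    have iff: "i \<in> B \<longleftrightarrow> r i \<in> B" using B[OF i(1) _ eq] B[OF le _ eq[symmetric]] by blast
    show ?thesis
    proof (cases "i \<in> B")
      case True
      then show ?thesis using iff w(2)[OF iT] c(2)[OF w(1)] by simp
    next
      case False
      then have "w i = c * ext1 y (r i)" using iff w(2)[OF iT] c(2)[OF w(1)] by simp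
      moreover have "of_real (cmod c) * ext1 y i = c * ext1 y (r i)"
        using P(8)[OF i(1) le c(2)] .
      moreover have "cmod (w i) = cmod c" using calculation(1) P(6)[OF le] by (simp add: norm_mult)
      ultimately show ?thesis using False c(1) P(6)[OF i(1)] by auto
    qed
  qed
  then show ?thesis using w(1) by blast
qed

text \<open>The homomorphism is the limit of \<open>sgn (f (ppt (c t)))\<close> along the ray
  \<open>c t = v + t * w\<close>, where \<open>w\<close> has phases \<open>y\<close> at the
  vanishing coordinates. Multiplicativity, independence of the germ and the value on units pass to
  the limit.\<close>

lemma Psi_surj:
  assumes vy: "(v, y) \<in> polar"
  shows "(v, y) \<in> Psi ` Zlog n Z"
proof -
  note P = polarD[OF vy]
  obtain w where w: "w \<in> L"
    "\<And>i. i \<le> n \<Longrightarrow> v i = 0 \<Longrightarrow> w i \<noteq> 0 \<and> w i = of_real (cmod (w i)) * ext1 y i"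
    using phase_vector[OF vy, of "{}"] by auto
  define c where "c t = (\<lambda>i. v i + of_real t * w i)" for t
  let ?F = "at_right (0::real)"
  have cL: "c t \<in> L" for t
    using linear_space_lincomb[OF P(2) w(1), of 1 "of_real t"] by (simp add: c_def)
  have ctend: "((\<lambda>t. c t i) \<longlongrightarrow> v i) ?F" for i
  proof -
    have "((\<lambda>t. v i + of_real t * w i) \<longlongrightarrow> v i + of_real 0 * w i) ?F"
      by (intro tendsto_intros)
    then show ?thesis by (simp add: c_def)
  qed
  have clim: "(c \<longlongrightarrow> v) ?F"
  proof -
    have "continuous_on UNIV c" unfolding c_def
      by (intro continuous_on_coordinatewise_then_product continuous_intros)
    then have "(c \<longlongrightarrow> c 0) ?F"
      by (simp add: continuous_on_eq_continuous_at isCont_def filterlim_at_split)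
    then show ?thesis by (simp add: c_def)
  qed
  obtain k where k: "k \<le> n" "v k \<noteq> 0" using Lx_coord[OF P(1)] by blast
  have cLx: "eventually (\<lambda>t. c t \<in> Lx \<and> c t k \<noteq> 0) ?F"
    using tendsto_imp_eventually_ne[OF ctend[of k] k(2)] by eventually_elim (use cL L_Lx in auto)
  have sgn_c: "((\<lambda>t. sgn (c t i)) \<longlongrightarrow> ext1 y i) ?F" if i: "i \<le> n" for i
  proof (cases "v i = 0")
    case True
    have "eventually (\<lambda>t. sgn (c t i) = ext1 y i) ?F"
      using eventually_at_right_less[of 0]
    proof eventually_elim
      case (elim t)
      then have "sgn (c t i) = sgn (w i)" using True by (simp add: c_def sgn_mult sgn_of_real)
      then show ?case using sgn_eqI w(2)[OF i True] by simp
    qed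
    then show ?thesis by (rule tendsto_eventually)
  next
    case False
    have "sgn (v i) = ext1 y i" using sgn_eqI[OF False P(7)[OF i]] .
    then show ?thesis using tendsto_sgn[OF ctend[of i] False] by simp
  qed
  define p where "p = ppt v"
  have pk: "p \<in> chart k" unfolding p_def using ppt_in_chart P(1) k(2) by blast
  have pZ: "p \<in> Zbar n Z" unfolding p_def using ppt_in_Zbar P(1) by blast
  have evW: "eventually (\<lambda>t. ppt (c t) \<in> W) ?F" if W: "openin (Zbar_top n Z) W" "p \<in> W" for W
  proof -
    obtain N where N: "open N" "v \<in> N" "\<And>u. u \<in> Lx \<Longrightarrow> u \<in> N \<Longrightarrow> ppt u \<in> W"
      using openin_ZbarE[OF W(1) P(1)] W(2) unfolding p_def by blast
    have "eventually (\<lambda>t. c t \<in> N) ?F" using topological_tendstoD[OF clim N(1,2)] .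
    with cLx show ?thesis by eventually_elim (use N(3) in blast)
  qed
  have reg_lim: "((\<lambda>t. u (ppt (c t))) \<longlongrightarrow> u p) ?F" if u: "regular_on n Z W u" "p \<in> W" for u W
    unfolding p_def
  proof (rule continuous_on_tendsto_compose[OF regular_on_continuous[OF u(1)] clim])
    have "openin (Zbar_top n Z) W" using u(1) by (simp add: regular_on_def)
    from evW[OF this u(2)] cLx show "eventually (\<lambda>t. c t \<in> {v \<in> Lx. ppt v \<in> W}) ?F"
      by eventually_elim blast
    show "v \<in> {v \<in> Lx. ppt v \<in> W}" using P(1) u(2) by (simp add: p_def)
  qed
  have ratio_lim: "((\<lambda>t. sgn (ratio i k (ppt (c t)))) \<longlongrightarrow> ext1 y i / ext1 y k) ?F" if i: "i \<le> n" for i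
  proof -
    have "((\<lambda>t. sgn (c t i) / sgn (c t k)) \<longlongrightarrow> ext1 y i / ext1 y k) ?F"
      using P(6)[OF k(1)] by (intro tendsto_divide sgn_c i k) auto
    moreover have "eventually (\<lambda>t. sgn (c t i) / sgn (c t k) = sgn (ratio i k (ppt (c t)))) ?F"
      using cLx
    proof eventually_elim
      case (elim t)
      then show ?case by (simp add: ratio_ppt sgn_eq norm_divide)
    qed
    ultimately show ?thesis by (rule Lim_transform_eventually)
  qed
  \<comment> \<open>By the normal form only units and coordinate ratios matter: a unit has a nonzero
    limit, and the phases of the ratios converge by the choice of \<open>w\<close>.\<close>
  have ex_lim: "\<exists>l. cmod l = 1 \<and> ((\<lambda>t. sgn (f (ppt (c t)))) \<longlongrightarrow> l) ?F" if f: "f \<in> Mon n Z p" for f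
  proof -
    obtain U where U: "p \<in> U" "logfun_on n Z U f" using f unfolding Mon_def by blast
    obtain W xs u where W: "openin (Zbar_top n Z) W" "p \<in> W" "W \<subseteq> U" "W \<subseteq> chart k" "set xs \<subseteq> {..n}"
      "regular_on n Z W u" "\<forall>q\<in>W. u q \<noteq> 0" "\<forall>q\<in>W. f q = u q * (\<Prod>i\<leftarrow>xs. ratio i k q)"
      using logfun_factor[OF U(2,1) pk] by (elim exE conjE) (rule that)
    define l where "l = sgn (u p) * (\<Prod>i\<leftarrow>xs. ext1 y i / ext1 y k)"
    have "((\<lambda>t. sgn (u (ppt (c t))) * (\<Prod>i\<leftarrow>xs. sgn (ratio i k (ppt (c t))))) \<longlongrightarrow> l) ?F"
      unfolding l_def using W(2,5,7)
      by (intro tendsto_mult tendsto_sgn reg_lim[OF W(6)] tendsto_prod_list ratio_lim) auto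
    moreover have "eventually (\<lambda>t. sgn (u (ppt (c t))) * (\<Prod>i\<leftarrow>xs. sgn (ratio i k (ppt (c t))))
        = sgn (f (ppt (c t)))) ?F"
      using evW[OF W(1,2)] by eventually_elim (simp add: W(8) sgn_mult sgn_prod_list)
    ultimately have "((\<lambda>t. sgn (f (ppt (c t)))) \<longlongrightarrow> l) ?F" by (rule Lim_transform_eventually)
    moreover have "cmod (\<Prod>i\<leftarrow>xs. ext1 y i / ext1 y k) = 1"
      using W(5) by (induction xs) (auto simp: norm_mult norm_divide P(6) k(1))
    then have "cmod l = 1" using W(2,7) by (simp add: l_def norm_mult norm_sgn)
    ultimately show ?thesis by blast
  qed
  \<comment> \<open>The default 1 off the monoid is the normalisation in
    \<open>KN_hom\<close>.\<close>
  define h where "h f = (if f \<in> Mon n Z p then SOME l. cmod l = 1 \<and> ((\<lambda>t. sgn (f (ppt (c t)))) \<longlongrightarrow> l) ?F else 1)" for f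
  have h: "cmod (h f) = 1" "((\<lambda>t. sgn (f (ppt (c t)))) \<longlongrightarrow> h f) ?F" if "f \<in> Mon n Z p" for f
    using someI_ex[OF ex_lim[OF that]] that by (simp_all add: h_def)
  have uniq: "h f = l" if "f \<in> Mon n Z p" "((\<lambda>t. sgn (f (ppt (c t)))) \<longlongrightarrow> l) ?F" for f l
    using tendsto_unique[OF _ h(2)[OF that(1)] that(2)] by simp
  have "KN_hom n Z p h"
    unfolding KN_hom_def sgn_complex
  proof (intro conjI ballI allI impI)
    show "h f = 1" if "f \<notin> Mon n Z p" for f using that by (simp add: h_def)
    show "cmod (h f) = 1" if "f \<in> Mon n Z p" for f using h(1)[OF that] .
    show "h f = h g" if fg: "f \<in> Mon n Z p" "g \<in> Mon n Z p" "same_germ n Z p f g" for f g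
    proof (rule uniq[OF fg(1)])
      obtain U where U: "openin (Zbar_top n Z) U" "p \<in> U" "\<forall>q\<in>U. f q = g q"
        using fg(3) unfolding same_germ_def by blast
      have "eventually (\<lambda>t. sgn (g (ppt (c t))) = sgn (f (ppt (c t)))) ?F"
        using evW[OF U(1,2)] by eventually_elim (simp add: U(3))
      with h(2)[OF fg(2)] show "((\<lambda>t. sgn (f (ppt (c t)))) \<longlongrightarrow> h g) ?F"
        by (rule Lim_transform_eventually)
    qed
    show "h (\<lambda>q. f q * g q) = h f * h g" if "f \<in> Mon n Z p" "g \<in> Mon n Z p" for f g
    proof (rule uniq[OF Mon_mult[OF that]])
      show "((\<lambda>t. sgn (f (ppt (c t)) * g (ppt (c t)))) \<longlongrightarrow> h f * h g) ?F"
        unfolding sgn_mult by (intro tendsto_mult h(2) that)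
    qed
    show "h f = sgn (f p)" if f: "f \<in> Mon n Z p" "f p \<noteq> 0" for f
    proof (rule uniq[OF f(1)])
      obtain U where U: "p \<in> U" "regular_on n Z U f"
        using f unfolding Mon_def logfun_on_def by blast
      show "((\<lambda>t. sgn (f (ppt (c t)))) \<longlongrightarrow> sgn (f p)) ?F"
        by (intro tendsto_sgn reg_lim[OF U(2,1)] f(2))
    qed
  qed
  then have z: "(p, h) \<in> Zlog n Z" using pZ by (simp add: Zlog_def)
  have hr: "h (ratio i k) = ext1 y i / ext1 y k" if "i \<le> n" for i
    by (rule uniq[OF ratio_Mon[OF that pk] ratio_lim[OF that]])
  have y_eq: "ext1 (ang n (p, h)) i = ext1 y i" if "i \<le> n" for i
  proof -
    have "ext1 y k \<noteq> 0" using P(6)[OF k(1)] by auto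
    moreover have "ext1 y 0 = 1" by (simp add: ext1_def)
    ultimately show ?thesis using ext1_ang[OF z pk k(1) that] by (simp add: hr that)
  qed
  have ang: "ang n (p, h) = y"
  proof
    fix i
    show "ang n (p, h) i = y i"
    proof (cases "1 \<le> i \<and> i \<le> n")
      case True
      then show ?thesis using y_eq[of i] by (simp add: ext1_def)
    next
      case False
      then have "i = 0 \<or> i > n" by auto
      then show ?thesis using P(4,5) by (auto simp: ang_def Let_def)
    qed
  qed
  have "of_real (rho i p) * ext1 y i = v i" for i
  proof (cases "i \<le> n")
    case True
    then show ?thesis using P(7)[OF True] by (simp add: p_def rho_ppt P(1,3))
  next
    case False
    then have "v i = 0" using P(2) by (simp add: linear_space_def Cn1_def)
    then show ?thesis by (simp add: p_def rho_ppt P(1))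
  qed
  then have "Psi (p, h) = (v, y)" by (simp add: Psi_def ang)
  then show ?thesis using z by (metis imageI)
qed

lemma Psi_image: "Psi ` Zlog n Z = polar"
  using Psi_in_polar Psi_surj by auto

definition kappa :: "vec \<times> vec \<Rightarrow> KNpt" where
  "kappa = inv_into (Zlog n Z) Psi"

lemma kappa_in_Zlog: "x \<in> polar \<Longrightarrow> kappa x \<in> Zlog n Z"
  unfolding kappa_def using Psi_image by (metis inv_into_into)

lemma Psi_kappa: "x \<in> polar \<Longrightarrow> Psi (kappa x) = x"
  unfolding kappa_def using Psi_image by (metis f_inv_into_f)

lemma kappa_Psi: "z \<in> Zlog n Z \<Longrightarrow> kappa (Psi z) = z"
  unfolding kappa_def by (rule inv_into_f_f[OF Psi_inj])

lemma fst_kappa: "x \<in> polar \<Longrightarrow> fst (kappa x) = ppt (fst x)"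
  using ppt_fst_Psi(1)[OF kappa_in_Zlog] Psi_kappa by metis

lemma ang_kappa: "x \<in> polar \<Longrightarrow> ang n (kappa x) = snd x"
  using Psi_kappa snd_Psi by metis

end

section \<open>Continuity of the polar coordinates and of their inverse\<close>

lemma continuous_map_euclidean_Pair:
  assumes "continuous_map X euclidean f" "continuous_map X euclidean g"
  shows "continuous_map X euclidean (\<lambda>x. (f x, g x))"
  using continuous_map_pairedI[OF assms] by (simp add: prod_topology_euclidean)

lemma continuous_map_euclidean_binary:
  assumes "continuous_map X euclidean f" "continuous_map X euclidean g"
    and S: "\<And>x. x \<in> topspace X \<Longrightarrow> (f x, g x) \<in> S"
    and F: "continuous_on S (\<lambda>p. F (fst p) (snd p))"
  shows "continuous_map X euclidean (\<lambda>x. F (f x) (g x))"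
proof -
  have "continuous_map X (top_of_set S) (\<lambda>x. (f x, g x))"
    using continuous_map_euclidean_Pair[OF assms(1,2)] S by (auto simp: continuous_map_in_subtopology)
  moreover have "continuous_map (top_of_set S) euclidean (\<lambda>p. F (fst p) (snd p))"
    using F by simp
  ultimately have "continuous_map X euclidean ((\<lambda>p. F (fst p) (snd p)) \<circ> (\<lambda>x. (f x, g x)))"
    by (rule continuous_map_compose)
  then show ?thesis by (simp add: o_def)
qed

lemma continuous_map_euclidean_coordinates:
  assumes "\<And>i. continuous_map X euclidean (\<lambda>x. f x i)"
  shows "continuous_map X euclidean f"
  using assms unfolding euclidean_product_topology[symmetric] continuous_map_componentwise_UNIV by simp

lemma continuous_map_coordinate:
  "continuous_map X euclidean f \<Longrightarrow> continuous_map X euclidean (\<lambda>x. f x i)"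
  unfolding euclidean_product_topology[symmetric] continuous_map_componentwise_UNIV by simp

lemma continuous_map_local:
  assumes "\<And>x. x \<in> topspace X \<Longrightarrow> \<exists>U. openin X U \<and> x \<in> U \<and> continuous_map (subtopology X U) Y f"
  shows "continuous_map X Y f"
proof -
  obtain U where U: "\<And>x. x \<in> topspace X \<Longrightarrow> openin X (U x) \<and> x \<in> U x \<and> continuous_map (subtopology X (U x)) Y f"
    using assms by metis
  show ?thesis
    by (rule pasting_lemma[of "topspace X" X U Y "\<lambda>_. f"]) (use U in auto)
qed

context snc_very_affine
begin

lemma openin_Zlog_vimage: "openin (Zbar_top n Z) V \<Longrightarrow> openin (Zlog_top n Z) {z \<in> Zlog n Z. fst z \<in> V}"
  unfolding Zlog_top_def by (intro topology_generated_by_Basis UnI1) (auto simp: case_prod_unfold)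

lemma openin_Zlog_eval:
  "logfun_on n Z U f \<Longrightarrow> open W \<Longrightarrow> openin (Zlog_top n Z) {z \<in> Zlog n Z. fst z \<in> U \<and> snd z f \<in> W}"
  unfolding Zlog_top_def by (intro topology_generated_by_Basis UnI2) (auto simp: case_prod_unfold)

lemma topspace_Zlog: "topspace (Zlog_top n Z) = Zlog n Z"
proof
  show "topspace (Zlog_top n Z) \<subseteq> Zlog n Z"
    unfolding Zlog_top_def topology_generated_by_topspace by (auto simp: case_prod_unfold)
  have "{z \<in> Zlog n Z. fst z \<in> Zbar n Z} = Zlog n Z" using ZlogD(1) by auto
  then show "Zlog n Z \<subseteq> topspace (Zlog_top n Z)"
    using openin_Zlog_vimage[of "Zbar n Z"] openin_subset topspace_Zbar openin_topspace by metis
qed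

lemma continuous_map_eval:
  assumes "logfun_on n Z U f"
  shows "continuous_map (subtopology (Zlog_top n Z) {z \<in> Zlog n Z. fst z \<in> U}) euclidean (\<lambda>z. snd z f)"
  unfolding continuous_map_def
proof (intro conjI allI impI)
  fix W :: "complex set" assume "openin euclidean W"
  then have "openin (Zlog_top n Z) {z \<in> Zlog n Z. fst z \<in> U \<and> snd z f \<in> W}"
    using openin_Zlog_eval[OF assms] by simp
  then show "openin (subtopology (Zlog_top n Z) {z \<in> Zlog n Z. fst z \<in> U})
      {x \<in> topspace (subtopology (Zlog_top n Z) {z \<in> Zlog n Z. fst z \<in> U}). snd x f \<in> W}"
    unfolding openin_subtopology
    by (intro exI[of _ "{z \<in> Zlog n Z. fst z \<in> U \<and> snd z f \<in> W}"]) (auto simp: topspace_Zlog)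
qed auto

lemma continuous_map_ang: "continuous_map (Zlog_top n Z) euclidean (ang n)"
proof (rule continuous_map_euclidean_coordinates)
  fix j
  show "continuous_map (Zlog_top n Z) euclidean (\<lambda>z. ang n z j)"
  proof (cases "1 \<le> j \<and> j \<le> n")
    case False
    then have "(\<lambda>z. ang n z j) = (\<lambda>z. 0)" by (auto simp: ang_def Let_def fun_eq_iff)
    then show ?thesis by simp
  next
    case True
    show ?thesis
    proof (rule continuous_map_local)
      fix z assume "z \<in> topspace (Zlog_top n Z)"
      then have z: "z \<in> Zlog n Z" by (simp add: topspace_Zlog)
      then have "fst z \<in> Zbar n Z" using ZlogD(1)[of "fst z" "snd z"] by simp
      then obtain k where k: "k \<le> n" "fst z \<in> chart k" using chart_exists by blast
      let ?U = "{z \<in> Zlog n Z. fst z \<in> chart k}"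
      have eq: "snd x (ratio j k) / snd x (ratio 0 k) = ang n x j" if x: "x \<in> ?U" for x
      proof -
        have "(fst x, snd x) \<in> Zlog n Z" "fst x \<in> chart k" "j \<le> n" using x True by auto
        from ext1_ang[OF this(1,2) k(1) this(3)] show ?thesis using True by (simp add: ext1_def)
      qed
      have "continuous_map (subtopology (Zlog_top n Z) ?U) euclidean
          (\<lambda>x. snd x (ratio j k) / snd x (ratio 0 k))"
      proof (rule continuous_map_euclidean_binary[where S = "UNIV \<times> -{0}" and F = "(/)"])
        show "continuous_map (subtopology (Zlog_top n Z) ?U) euclidean (\<lambda>x. snd x (ratio j k))"
          "continuous_map (subtopology (Zlog_top n Z) ?U) euclidean (\<lambda>x. snd x (ratio 0 k))"
          using True by (auto intro!: continuous_map_eval ratio_logfun)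
        show "continuous_on (UNIV \<times> -{0}) (\<lambda>p :: complex \<times> complex. fst p / snd p)"
          by (intro continuous_intros) auto
        fix x assume "x \<in> topspace (subtopology (Zlog_top n Z) ?U)"
        then have "(fst x, snd x) \<in> Zlog n Z" "fst x \<in> chart k" by auto
        then have "cmod (snd x (ratio 0 k)) = 1" using KN_ratio_norm by blast
        then show "(snd x (ratio j k), snd x (ratio 0 k)) \<in> UNIV \<times> -{0}" by auto
      qed
      then have "continuous_map (subtopology (Zlog_top n Z) ?U) euclidean (\<lambda>x. ang n x j)"
        using eq by (rule continuous_map_eq) auto
      then show "\<exists>U. openin (Zlog_top n Z) U \<and> z \<in> U \<and>
          continuous_map (subtopology (Zlog_top n Z) U) euclidean (\<lambda>z. ang n z j)"
        using z k openin_Zlog_vimage[OF openin_chart[of k]] by (intro exI[of _ ?U]) auto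
    qed
  qed
qed

lemma continuous_map_rho: "continuous_map (Zlog_top n Z) euclideanreal (\<lambda>z. rho i (fst z))"
  unfolding continuous_map_def
proof (intro conjI allI impI)
  fix W :: "real set" assume "openin euclidean W"
  then have "open W" by simp
  let ?f = "\<lambda>v :: vec. cmod (v i) / (\<Sum>j\<le>n. cmod (v j))"
  have "continuous_on Lx ?f"
  proof (intro continuous_on_divide continuous_on_norm continuous_on_sum)
    show "continuous_on Lx (\<lambda>v. v j)" for j
      by (rule continuous_on_coord)
    then show "continuous_on Lx (\<lambda>v. v j)" for j .
    show "\<forall>v\<in>Lx. (\<Sum>j\<le>n. cmod (v j)) \<noteq> 0"
    proof
      fix v assume "v \<in> Lx"
      then show "(\<Sum>j\<le>n. cmod (v j)) \<noteq> 0" using sum_norm_pos[of v] by simp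
    qed
  qed
  then have "openin (top_of_set Lx) (Lx \<inter> ?f -` W)"
    using \<open>open W\<close> by (rule continuous_openin_preimage_gen)
  moreover have "Lx \<inter> ?f -` W = {v \<in> Lx. ?f v \<in> W}" by blast
  ultimately have "openin (top_of_set Lx) {v \<in> Lx. ?f v \<in> W}" by (rule back_subst)
  then obtain N where N: "open N" "{v \<in> Lx. ?f v \<in> W} = Lx \<inter> N" unfolding openin_open by blast
  have *: "openin (Zbar_top n Z) (ppt ` {v \<in> Lx. ?f v \<in> W})"
    unfolding N(2) by (rule openin_Zbar_image[OF N(1)])
  have "{z \<in> topspace (Zlog_top n Z). rho i (fst z) \<in> W}
      = {z \<in> Zlog n Z. fst z \<in> ppt ` {v \<in> Lx. ?f v \<in> W}}"
  proof (rule set_eqI)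
    fix z
    show "z \<in> {z \<in> topspace (Zlog_top n Z). rho i (fst z) \<in> W}
        \<longleftrightarrow> z \<in> {z \<in> Zlog n Z. fst z \<in> ppt ` {v \<in> Lx. ?f v \<in> W}}"
    proof (cases "z \<in> Zlog n Z")
      case True
      then have "fst z \<in> Zbar n Z" using ZlogD(1)[of "fst z" "snd z"] by simp
      then obtain v where v: "v \<in> Lx" "fst z = ppt v" by (rule ZbarE)
      have "ppt v \<in> ppt ` {v \<in> Lx. ?f v \<in> W} \<longleftrightarrow> ?f v \<in> W"
      proof
        assume "ppt v \<in> ppt ` {v \<in> Lx. ?f v \<in> W}"
        then obtain x where "x \<in> Lx" "?f x \<in> W" "ppt v = ppt x" by blast
        then show "?f v \<in> W" using rho_ppt[of x i] rho_ppt[OF v(1), of i] by simp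
      qed (use v(1) in blast)
      then show ?thesis using True v by (simp add: topspace_Zlog rho_ppt)
    qed (simp add: topspace_Zlog)
  qed
  then show "openin (Zlog_top n Z) {z \<in> topspace (Zlog_top n Z). rho i (fst z) \<in> W}"
    using openin_Zlog_vimage[OF *] by simp
qed auto

lemma continuous_map_Psi: "continuous_map (Zlog_top n Z) euclidean Psi"
proof -
  have e: "continuous_map (Zlog_top n Z) euclidean (\<lambda>z. ext1 (ang n z) i)" for i
    using continuous_map_coordinate[OF continuous_map_ang, of i]
    by (cases "i = 0") (simp_all add: ext1_def)
  have "continuous_map (Zlog_top n Z) euclidean (\<lambda>z. of_real (rho i (fst z)) * ext1 (ang n z) i)" for i
    using continuous_map_euclidean_binary[OF continuous_map_rho e[of i], where S = UNIV
        and F = "\<lambda>a b. of_real a * b"]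
    by (simp add: continuous_intros)
  then have "continuous_map (Zlog_top n Z) euclidean (\<lambda>z i. of_real (rho i (fst z)) * ext1 (ang n z) i)"
    by (intro continuous_map_euclidean_coordinates) simp
  from continuous_map_euclidean_Pair[OF this continuous_map_ang] show ?thesis
    by (simp add: Psi_def[abs_def])
qed

lemma openin_polar_vimage:
  assumes "openin (Zbar_top n Z) V"
  shows "openin (top_of_set polar) {x \<in> polar. ppt (fst x) \<in> V}"
proof -
  have "continuous_on polar fst" by (intro continuous_intros)
  moreover have "fst \<in> polar \<rightarrow> Lx" using polarD(1) by auto
  ultimately have "openin (top_of_set polar) (polar \<inter> fst -` {v \<in> Lx. ppt v \<in> V})"
    using openin_Lx_vimage[OF assms] continuous_openin_preimage by blast
  moreover have "polar \<inter> fst -` {v \<in> Lx. ppt v \<in> V} = {x \<in> polar. ppt (fst x) \<in> V}"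
    using polarD(1) by auto
  ultimately show ?thesis by simp
qed

text \<open>Only generating open sets need testing. For those given by a log function, the normal
  form on a neighbourhood turns the evaluation into an explicit continuous expression in vector and
  phases.\<close>

lemma continuous_map_kappa: "continuous_map (top_of_set polar) (Zlog_top n Z) kappa"
  unfolding Zlog_top_def
proof (rule continuous_on_generated_topo)
  show "kappa ` topspace (top_of_set polar) \<subseteq>
      \<Union> ({{(p, h) \<in> Zlog n Z. p \<in> V} | V. openin (Zbar_top n Z) V} \<union>
      {{(p, h) \<in> Zlog n Z. p \<in> U \<and> h f \<in> W} | U f W. logfun_on n Z U f \<and> open W})"
    using kappa_in_Zlog topspace_Zlog unfolding Zlog_top_def topology_generated_by_topspace by auto
next
  fix G assume "G \<in> {{(p, h) \<in> Zlog n Z. p \<in> V} | V. openin (Zbar_top n Z) V} \<union>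
      {{(p, h) \<in> Zlog n Z. p \<in> U \<and> h f \<in> W} | U f W. logfun_on n Z U f \<and> open W}"
  then consider V where "openin (Zbar_top n Z) V" "G = {(p, h) \<in> Zlog n Z. p \<in> V}"
    | U f W where "logfun_on n Z U f" "open W" "G = {(p, h) \<in> Zlog n Z. p \<in> U \<and> h f \<in> W}" by blast
  then show "openin (top_of_set polar) (kappa -` G \<inter> topspace (top_of_set polar))"
  proof cases
    case 1
    have "kappa -` G \<inter> topspace (top_of_set polar) = {x \<in> polar. ppt (fst x) \<in> V}"
      using kappa_in_Zlog fst_kappa by (auto simp: 1(2) case_prod_unfold)
    then show ?thesis using openin_polar_vimage[OF 1(1)] by simp
  next
    case 2
    have eq: "kappa -` G \<inter> topspace (top_of_set polar) = {x \<in> polar. ppt (fst x) \<in> U \<and> snd (kappa x) f \<in> W}"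
      using kappa_in_Zlog fst_kappa by (auto simp: 2(3) case_prod_unfold)
    show ?thesis unfolding eq
    proof (subst openin_subopen, intro ballI)
      fix x assume "x \<in> {x \<in> polar. ppt (fst x) \<in> U \<and> snd (kappa x) f \<in> W}"
      then have x: "x \<in> polar" "ppt (fst x) \<in> U" "snd (kappa x) f \<in> W" by auto
      have xL: "fst x \<in> Lx" using polarD(1)[of "fst x" "snd x"] x(1) by simp
      then obtain k where k: "k \<le> n" "ppt (fst x) \<in> chart k" using chart_exists ppt_in_Zbar by blast
      obtain V xs u where V: "openin (Zbar_top n Z) V" "ppt (fst x) \<in> V" "V \<subseteq> U" "V \<subseteq> chart k" "set xs \<subseteq> {..n}"
        "regular_on n Z V u" "\<forall>q\<in>V. u q \<noteq> 0" "\<forall>q\<in>V. f q = u q * (\<Prod>i\<leftarrow>xs. ratio i k q)"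
        using logfun_factor[OF 2(1) x(2) k(2)] by (elim exE conjE) (rule that)
      let ?P = "{x \<in> polar. ppt (fst x) \<in> V}"
      let ?g = "\<lambda>x. sgn (u (ppt (fst x))) * (\<Prod>i\<leftarrow>xs. ext1 (snd x) i / ext1 (snd x) k)"
      \<comment> \<open>One factorisation of \<open>f\<close> is valid at all points over
        \<open>V\<close>, so the same formula computes the value throughout the
        neighbourhood.\<close>
      have val: "snd (kappa a) f = ?g a" if a: "a \<in> ?P" for a
      proof -
        have z: "(ppt (fst a), snd (kappa a)) \<in> Zlog n Z"
          using kappa_in_Zlog[of a] fst_kappa[of a] a by (metis (no_types, lifting) mem_Collect_eq prod.collapse)
        have ang: "ang n (ppt (fst a), snd (kappa a)) = snd a"
          using ang_kappa[of a] fst_kappa[of a] a by (metis (no_types, lifting) mem_Collect_eq prod.collapse)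
        have aV: "ppt (fst a) \<in> V" using a by simp
        have m: "f \<in> Mon n Z (ppt (fst a))" using MonI[OF 2(1)] aV V(3) by blast
        show ?thesis
          using KN_value[OF z V(1) aV V(4) k(1) V(5,6) bspec[OF V(7)] m bspec[OF V(8)]] by (simp add: ang)
      qed
      have c_ext: "continuous_on ?P (\<lambda>x. ext1 (snd x) i)" for i
      proof (cases "i = 0")
        case False
        have "continuous_on ?P (\<lambda>x. snd x i)"
          by (rule continuous_on_snd_coord)
        then show ?thesis using False by (simp add: ext1_def)
      qed (simp add: ext1_def)
      have "continuous_on ?P (\<lambda>x. \<Prod>i\<leftarrow>ys. ext1 (snd x) i / ext1 (snd x) k)" for ys
      proof (induction ys)
        case (Cons i ys)
        have nz: "\<forall>a\<in>?P. ext1 (snd a) k \<noteq> 0"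
        proof
          fix a assume "a \<in> ?P"
          then have "cmod (ext1 (snd a) k) = 1" using polarD(6)[of "fst a" "snd a" k] k(1) by simp
          then show "ext1 (snd a) k \<noteq> 0" by auto
        qed
        have "continuous_on ?P (\<lambda>x. ext1 (snd x) i / ext1 (snd x) k * (\<Prod>i\<leftarrow>ys. ext1 (snd x) i / ext1 (snd x) k))"
          by (intro continuous_on_mult continuous_on_divide c_ext nz Cons)
        then show ?case by simp
      qed simp
      moreover have "continuous_on ?P (\<lambda>x. u (ppt (fst x)))"
      proof (rule continuous_on_compose2[OF regular_on_continuous[OF V(6)]])
        show "continuous_on ?P fst" by (rule continuous_on_fst[OF continuous_on_id])
        show "fst ` ?P \<subseteq> {v \<in> Lx. ppt v \<in> V}" using polarD(1) by fastforce
      qed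
      ultimately have "continuous_on ?P ?g"
        using V(7) by (intro continuous_on_mult continuous_on_sgn) auto
      then have "openin (top_of_set ?P) (?P \<inter> ?g -` W)"
        using 2(2) by (simp add: continuous_openin_preimage_gen)
      then have "openin (top_of_set polar) (?P \<inter> ?g -` W)"
        using openin_polar_vimage[OF V(1)] by (rule openin_trans)
      moreover have "x \<in> ?P \<inter> ?g -` W" using x V(2) val[of x] by simp
      moreover have "?P \<inter> ?g -` W \<subseteq> {x \<in> polar. ppt (fst x) \<in> U \<and> snd (kappa x) f \<in> W}"
        using val V(3) by auto
      ultimately show "\<exists>T. openin (top_of_set polar) T \<and> x \<in> T \<and>
          T \<subseteq> {x \<in> polar. ppt (fst x) \<in> U \<and> snd (kappa x) f \<in> W}" by blast
    qed
  qed
qed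

end

section \<open>Continuous choice of a vector with prescribed approximate phases\<close>

text \<open>A Browder-type selection argument: a vector good at one point is good nearby, and a
  partition of unity averages such local constant choices. Values closed under sums and positive
  multiples contain the average.\<close>

lemma open_fibre_cone_selection:
  fixes X :: "'a :: {metric_space, second_countable_topology} set" and \<Phi> :: "'a \<Rightarrow> vec set"
  assumes ne: "\<And>x. x \<in> X \<Longrightarrow> \<exists>v. v \<in> \<Phi> x"
    and add: "\<And>x u v. x \<in> X \<Longrightarrow> u \<in> \<Phi> x \<Longrightarrow> v \<in> \<Phi> x \<Longrightarrow> (\<lambda>i. u i + v i) \<in> \<Phi> x"
    and scale: "\<And>x v a. x \<in> X \<Longrightarrow> v \<in> \<Phi> x \<Longrightarrow> 0 < a \<Longrightarrow> (\<lambda>i. of_real a * v i) \<in> \<Phi> x"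
    and op: "\<And>x v. x \<in> X \<Longrightarrow> v \<in> \<Phi> x \<Longrightarrow> \<exists>N. open N \<and> x \<in> N \<and> (\<forall>y\<in>X. y \<in> N \<longrightarrow> v \<in> \<Phi> y)"
  shows "\<exists>g. continuous_on X g \<and> (\<forall>x\<in>X. g x \<in> \<Phi> x)"
proof -
  define \<C> where "\<C> = {N. open N \<and> (\<exists>v. \<forall>y\<in>X. y \<in> N \<longrightarrow> v \<in> \<Phi> y)}"
  have cover: "X \<subseteq> \<Union>\<C>"
  proof
    fix x assume x: "x \<in> X"
    obtain v where "v \<in> \<Phi> x" using ne[OF x] by blast
    then obtain N where "open N" "x \<in> N" "\<forall>y\<in>X. y \<in> N \<longrightarrow> v \<in> \<Phi> y" using op[OF x] by blast
    then show "x \<in> \<Union>\<C>" unfolding \<C>_def by blast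
  qed
  have opC: "open T" if "T \<in> \<C>" for T using that by (simp add: \<C>_def)
  obtain \<D> where \<D>: "X \<subseteq> \<Union>\<D>" "\<And>U. U \<in> \<D> \<Longrightarrow> open U \<and> (\<exists>T. T \<in> \<C> \<and> U \<subseteq> T)"
    "\<And>x. x \<in> X \<Longrightarrow> \<exists>V. open V \<and> x \<in> V \<and> finite {U. U \<in> \<D> \<and> U \<inter> V \<noteq> {}}"
    by (rule paracompact[OF cover opC]) (assumption | rule that)+
  have "\<exists>v. \<forall>y\<in>X. y \<in> U \<longrightarrow> v \<in> \<Phi> y" if U: "U \<in> \<D>" for U
  proof -
    obtain T where "T \<in> \<C>" "U \<subseteq> T" using \<D>(2)[OF U] by blast
    then show ?thesis unfolding \<C>_def by blast
  qed
  then obtain w where w: "\<And>U y. U \<in> \<D> \<Longrightarrow> y \<in> X \<Longrightarrow> y \<in> U \<Longrightarrow> w U \<in> \<Phi> y" by metis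
  have opD: "open T" if "T \<in> \<D>" for T using \<D>(2)[OF that] by blast
  obtain F :: "'a set \<Rightarrow> 'a \<Rightarrow> real" where
    F: "\<And>U. U \<in> \<D> \<Longrightarrow> continuous_on X (F U) \<and> (\<forall>x\<in>X. 0 \<le> F U x)"
      "\<And>x U. U \<in> \<D> \<Longrightarrow> x \<in> X \<Longrightarrow> x \<notin> U \<Longrightarrow> F U x = 0"
      "\<And>x. x \<in> X \<Longrightarrow> supp_sum (\<lambda>W. F W x) \<D> = 1"
      "\<And>x. x \<in> X \<Longrightarrow> \<exists>V. open V \<and> x \<in> V \<and> finite {U \<in> \<D>. \<exists>x\<in>V. F U x \<noteq> 0}"
    by (rule subordinate_partition_of_unity[OF \<D>(1) opD \<D>(3)]) (assumption | rule that)+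
  define g where "g x = (\<lambda>i. \<Sum>U\<in>{U \<in> \<D>. F U x \<noteq> 0}. of_real (F U x) * w U i)" for x
  have "continuous_on X g"
    unfolding continuous_on_eq_continuous_within
  proof
    fix x assume x: "x \<in> X"
    then obtain V where V: "open V" "x \<in> V" "finite {U \<in> \<D>. \<exists>x\<in>V. F U x \<noteq> 0}" using F(4) by blast
    define Q where "Q = {U \<in> \<D>. \<exists>x\<in>V. F U x \<noteq> 0}"
    have "continuous_on (X \<inter> V) (\<lambda>x i. \<Sum>U\<in>Q. of_real (F U x) * w U i)"
    proof (intro continuous_on_coordinatewise_then_product continuous_on_sum continuous_on_mult
        continuous_on_const continuous_on_of_real)
      show "continuous_on (X \<inter> V) (F U)" if "U \<in> Q" for U
        using F(1)[of U] that continuous_on_subset[of X "F U" "X \<inter> V"] by (simp add: Q_def)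
    qed
    moreover have eq: "g y = (\<lambda>i. \<Sum>U\<in>Q. of_real (F U y) * w U i)" if "y \<in> X \<inter> V" for y
      unfolding g_def
      by (intro ext sum.mono_neutral_left) (use V(3) that in \<open>auto simp: Q_def\<close>)
    ultimately have "continuous_on (X \<inter> V) g" by (subst continuous_on_cong[OF refl eq])
    then have "continuous (at x within X \<inter> V) g"
      using x V(2) by (simp add: continuous_on_eq_continuous_within)
    then show "continuous (at x within X) g"
      using at_within_nhd[OF V(2,1), of "X \<inter> V" X] by (simp add: Int_ac)
  qed
  moreover have "g x \<in> \<Phi> x" if x: "x \<in> X" for x
  proof -
    define Q where "Q = {U \<in> \<D>. F U x \<noteq> 0}"
    \<comment> \<open>Sums over infinite or empty index sets are 0, so the total 1 shows that only
      finitely many, and at least one, of the weights are nonzero at \<open>x\<close>.\<close>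
    have sum1: "sum (\<lambda>U. F U x) Q = 1"
      using F(3)[OF x] by (simp add: supp_sum_def support_on_def Q_def)
    then have fin: "finite Q" "Q \<noteq> {}"
      by (metis sum.infinite zero_neq_one, metis sum.empty zero_neq_one)
    have Qw: "F U x > 0" "w U \<in> \<Phi> x" if "U \<in> Q" for U
      using that F(1)[of U] F(2)[of U x] w[of U x] x by (auto simp: Q_def order.strict_iff_order)
    have "(\<lambda>i. \<Sum>U\<in>R. of_real (F U x) * w U i) \<in> \<Phi> x" if "finite R" "R \<noteq> {}" "R \<subseteq> Q" for R
      using that
    proof (induction R rule: finite_ne_induct)
      case (singleton U)
      then show ?case using scale[OF x Qw(2) Qw(1)] by simp
    next
      case (insert U R)
      then have "(\<lambda>i. of_real (F U x) * w U i) \<in> \<Phi> x" using scale[OF x Qw(2) Qw(1)] by simp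
      from add[OF x this] insert show ?case by simp
    qed
    from this[OF fin] show ?thesis by (simp add: g_def Q_def)
  qed
  ultimately show ?thesis by blast
qed

text \<open>Multiplying by \<open>cnj (\<theta> i)\<close> rotates the target phase to the positive
  real axis. The strict inequality, free of division, is open in all data, stable under sums and
  positive multiples, and for \<open>t > 0\<close> forces the real part to be positive.\<close>

definition near_phase :: "nat set \<Rightarrow> real \<Rightarrow> vec \<Rightarrow> vec \<Rightarrow> bool" where
  "near_phase I t \<theta> v \<longleftrightarrow> (\<forall>i\<in>I. \<bar>Im (v i * cnj (\<theta> i))\<bar> < t * Re (v i * cnj (\<theta> i)))"

lemma near_phase_scale:
  assumes "near_phase I t \<theta> v" "0 < a"
  shows "near_phase I t \<theta> (\<lambda>i. of_real a * v i)"
proof -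
  have "\<bar>a * x\<bar> < t * (a * y)" if "\<bar>x\<bar> < t * y" for x y :: real
    using mult_strict_left_mono[OF that assms(2)] assms(2) by (simp add: abs_mult mult_ac)
  then show ?thesis
    using assms(1) unfolding near_phase_def mult.assoc by simp
qed

lemma near_phase_add:
  assumes "near_phase I t \<theta> u" "near_phase I t \<theta> v"
  shows "near_phase I t \<theta> (\<lambda>i. u i + v i)"
  unfolding near_phase_def
proof
  fix i assume i: "i \<in> I"
  have "\<bar>Im (u i * cnj (\<theta> i)) + Im (v i * cnj (\<theta> i))\<bar>
      < t * Re (u i * cnj (\<theta> i)) + t * Re (v i * cnj (\<theta> i))"
    using assms i unfolding near_phase_def by (smt (verit, best))
  then show "\<bar>Im ((u i + v i) * cnj (\<theta> i))\<bar> < t * Re ((u i + v i) * cnj (\<theta> i))"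
    by (simp only: distrib_right distrib_left plus_complex.simps)
qed

text \<open>Exactly aligned vectors, zero coordinates included, lie on the closure of the cone, and
  adding one to a vector of the open cone stays in it. This lets straight lines start at boundary
  points.\<close>

lemma near_phase_aligned:
  assumes "near_phase I t \<theta> u" "0 < t"
    "\<And>i. i \<in> I \<Longrightarrow> v i = of_real (r i) * \<theta> i \<and> 0 \<le> r i \<and> cmod (\<theta> i) = 1"
  shows "near_phase I t \<theta> (\<lambda>i. v i + u i)"
  unfolding near_phase_def
proof
  fix i assume i: "i \<in> I"
  have "\<theta> i * cnj (\<theta> i) = 1"
    using assms(3)[OF i] by (simp add: complex_norm_square[symmetric])
  then have "v i * cnj (\<theta> i) = of_real (r i)" using assms(3)[OF i] by (simp add: mult.assoc)
  then have "(v i + u i) * cnj (\<theta> i) = of_real (r i) + u i * cnj (\<theta> i)"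
    by (simp add: distrib_right)
  moreover have "0 \<le> t * r i" using assms(2) assms(3)[OF i] by simp
  ultimately show "\<bar>Im ((v i + u i) * cnj (\<theta> i))\<bar> < t * Re ((v i + u i) * cnj (\<theta> i))"
    using assms(1) i unfolding near_phase_def by (simp add: distrib_left)
      (smt (verit, best))
qed

lemma near_phase_nonzero:
  assumes "near_phase I t \<theta> v" "0 < t" "i \<in> I"
  shows "v i \<noteq> 0"
  using assms by (auto simp: near_phase_def)

lemma near_phase_sgn:
  assumes "near_phase I t \<theta> v" "0 < t" "i \<in> I" "cmod (\<theta> i) = 1"
  shows "cmod (sgn (v i) - \<theta> i) \<le> 2 * t"
proof -
  define z where "z = v i * cnj (\<theta> i)"
  have z: "\<bar>Im z\<bar> < t * Re z" using assms(1,3) by (simp add: near_phase_def z_def)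
  then have Re: "0 < Re z" using assms(2) by (smt (verit) mult_nonneg_nonpos zero_less_mult_pos)
  have "z \<noteq> 0" using Re by auto
  have tt: "\<theta> i * cnj (\<theta> i) = 1" using assms(4) by (simp add: complex_norm_square[symmetric])
  have "v i = z * \<theta> i" using tt by (simp add: z_def mult.assoc mult.commute[of "cnj (\<theta> i)"])
  then have "sgn (v i) - \<theta> i = \<theta> i * (sgn z - 1)"
    using assms(4) by (simp add: sgn_mult sgn_eq norm_mult algebra_simps)
  then have "cmod (sgn (v i) - \<theta> i) = cmod (sgn z - 1)" using assms(4) by (simp add: norm_mult)
  also have "sgn z - 1 = (z - of_real (cmod z)) / of_real (cmod z)"
    using \<open>z \<noteq> 0\<close> by (simp add: sgn_eq diff_divide_distrib)
  also have "cmod \<dots> = cmod (z - of_real (cmod z)) / cmod z" by (simp add: norm_divide)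
  \<comment> \<open>The constant 2: the real and the imaginary part of \<open>z - cmod z\<close>
    each contribute at most \<open>\<bar>Im z\<bar>\<close>, which is below
    \<open>t * cmod z\<close>.\<close>
  also have "\<dots> \<le> (2 * (t * cmod z)) / cmod z"
  proof (intro divide_right_mono)
    have "cmod (z - of_real (cmod z)) \<le> \<bar>Re z - cmod z\<bar> + \<bar>Im z\<bar>"
      using cmod_le[of "z - of_real (cmod z)"] by simp
    moreover have "cmod z \<le> Re z + \<bar>Im z\<bar>" using cmod_le[of z] Re by simp
    moreover have "Re z \<le> cmod z" by (rule complex_Re_le_cmod)
    moreover have "t * Re z \<le> t * cmod z" using assms(2) complex_Re_le_cmod by simp
    ultimately show "cmod (z - of_real (cmod z)) \<le> 2 * (t * cmod z)" using z by linarith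
  qed simp
  also have "\<dots> = 2 * t" using \<open>z \<noteq> 0\<close> by simp
  finally show ?thesis .
qed

lemma continuous_on_ext1: "continuous_on UNIV (\<lambda>x :: real \<times> vec. ext1 (snd x) i)"
proof (cases "i = 0")
  case False
  have "continuous_on UNIV (\<lambda>x :: real \<times> vec. snd x i)"
    by (rule continuous_on_snd_coord)
  then show ?thesis using False by (simp add: ext1_def)
qed (simp add: ext1_def)

lemma open_near_phase:
  assumes "finite I"
  shows "open {x :: real \<times> vec. near_phase I (fst x) (ext1 (snd x)) v}"
proof -
  have "{x :: real \<times> vec. near_phase I (fst x) (ext1 (snd x)) v} =
      (\<Inter>i\<in>I. {x. \<bar>Im (v i * cnj (ext1 (snd x) i))\<bar> < fst x * Re (v i * cnj (ext1 (snd x) i))})"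
    by (auto simp: near_phase_def)
  moreover have "open {x :: real \<times> vec. \<bar>Im (v i * cnj (ext1 (snd x) i))\<bar> < fst x * Re (v i * cnj (ext1 (snd x) i))}" for i
    by (intro open_Collect_less continuous_on_rabs continuous_on_Im continuous_on_Re continuous_on_mult
        continuous_on_const continuous_on_cnj continuous_on_ext1 continuous_on_fst continuous_on_id)
  ultimately show ?thesis using assms by (simp add: open_INT)
qed

text \<open>The times \<open>t\<close> are positive, since only then are the cones open. The bound
  of the size by \<open>t\<close> prepares the extension by the zero vector at
  \<open>t = 0\<close>.\<close>

lemma phase_selection:
  assumes I: "finite I"
    and add: "\<And>u v. u \<in> M \<Longrightarrow> v \<in> M \<Longrightarrow> (\<lambda>i. u i + v i) \<in> M"
    and scale: "\<And>v a. v \<in> M \<Longrightarrow> 0 < a \<Longrightarrow> (\<lambda>i. of_real a * v i) \<in> M"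
    and supp: "M \<subseteq> Cn1 n"
    and ex: "\<And>y t. y \<in> Y \<Longrightarrow> 0 < t \<Longrightarrow> \<exists>v\<in>M. near_phase I t (ext1 y) v"
  shows "\<exists>G. continuous_on ({0<..1} \<times> Y) G \<and> (\<forall>t\<in>{0<..1}. \<forall>y\<in>Y.
    G (t, y) \<in> M \<and> near_phase I t (ext1 y) (G (t, y)) \<and> (\<forall>i. cmod (G (t, y) i) \<le> t))"
proof -
  let ?X = "{0<..1} \<times> Y"
  define \<Phi> where "\<Phi> x = {v \<in> M. near_phase I (fst x) (ext1 (snd x)) v}" for x :: "real \<times> vec"
  have "\<exists>g. continuous_on ?X g \<and> (\<forall>x\<in>?X. g x \<in> \<Phi> x)"
  proof (rule open_fibre_cone_selection)
    fix x :: "real \<times> vec" assume x: "x \<in> ?X"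
    then show "\<exists>v. v \<in> \<Phi> x" using ex[of "snd x" "fst x"] by (auto simp: \<Phi>_def)
    show "(\<lambda>i. u i + v i) \<in> \<Phi> x" if "u \<in> \<Phi> x" "v \<in> \<Phi> x" for u v
      using that add near_phase_add by (simp add: \<Phi>_def)
    show "(\<lambda>i. of_real a * v i) \<in> \<Phi> x" if "v \<in> \<Phi> x" "0 < a" for v a
      using that scale near_phase_scale by (simp add: \<Phi>_def)
    show "\<exists>N. open N \<and> x \<in> N \<and> (\<forall>y\<in>?X. y \<in> N \<longrightarrow> v \<in> \<Phi> y)" if "v \<in> \<Phi> x" for v
      using that open_near_phase[OF I, of v]
      by (intro exI[of _ "{x. near_phase I (fst x) (ext1 (snd x)) v}"]) (simp add: \<Phi>_def)
  qed
  then obtain g where g: "continuous_on ?X g" "\<And>x. x \<in> ?X \<Longrightarrow> g x \<in> \<Phi> x" by blast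
  \<comment> \<open>A positive continuous factor that leaves the cones invariant and pushes all
    moduli below \<open>t\<close>; the summand 1 keeps the denominator positive.\<close>
  define a where "a x = fst x / (1 + (\<Sum>i\<le>n. cmod (g x i)))" for x
  define G where "G x = (\<lambda>i. of_real (a x) * g x i)" for x
  have pos: "0 < 1 + (\<Sum>i\<le>n. cmod (g x i))" for x
    by (intro add_pos_nonneg sum_nonneg) auto
  have gi: "continuous_on ?X (\<lambda>x. g x i)" for i
    by (rule continuous_on_product_then_coordinatewise[OF g(1)])
  have "continuous_on ?X G" unfolding G_def a_def
  proof (intro continuous_on_coordinatewise_then_product continuous_on_mult continuous_on_of_real
      continuous_on_divide continuous_on_fst continuous_on_id continuous_on_add continuous_on_const
      continuous_on_sum continuous_on_norm gi)
    show "\<forall>x\<in>?X. 1 + (\<Sum>i\<le>n. cmod (g x i)) \<noteq> 0" using pos by (metis less_irrefl)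
  qed
  moreover have "G (t, y) \<in> M \<and> near_phase I t (ext1 y) (G (t, y)) \<and> (\<forall>i. cmod (G (t, y) i) \<le> t)"
    if "t \<in> {0<..1}" "y \<in> Y" for t y
  proof (intro conjI allI)
    have gx: "g (t, y) \<in> M" "near_phase I t (ext1 y) (g (t, y))"
      using g(2)[of "(t, y)"] that by (auto simp: \<Phi>_def)
    have a: "0 < a (t, y)" using that pos by (simp add: a_def)
    show "G (t, y) \<in> M" unfolding G_def by (rule scale[OF gx(1) a])
    show "near_phase I t (ext1 y) (G (t, y))" unfolding G_def by (rule near_phase_scale[OF gx(2) a])
    fix i
    have "cmod (g (t, y) i) \<le> 1 + (\<Sum>i\<le>n. cmod (g (t, y) i))"
    proof (cases "i \<le> n")
      case True
      then have "cmod (g (t, y) i) \<le> (\<Sum>i\<le>n. cmod (g (t, y) i))" by (intro member_le_sum) auto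
      then show ?thesis by simp
    next
      case False
      then have "g (t, y) i = 0" using gx(1) supp by (auto simp: Cn1_def)
      then show ?thesis using pos[of "(t, y)"] by simp
    qed
    moreover have "cmod (G (t, y) i) = a (t, y) * cmod (g (t, y) i)"
      unfolding G_def norm_mult norm_of_real using a by simp
    moreover have "a (t, y) * (1 + (\<Sum>i\<le>n. cmod (g (t, y) i))) = t"
      using pos[of "(t, y)"] unfolding a_def by simp
    ultimately show "cmod (G (t, y) i) \<le> t"
      using mult_left_mono[of _ _ "a (t, y)"] a by fastforce
  qed
  ultimately show ?thesis by blast
qed

text \<open>The error bound is uniform in \<open>x\<close>, which gives joint continuity at time 0.
  The constant 2 is the one from the phase estimate.\<close>

lemma continuous_on_extend_to_zero:
  fixes f :: "real \<times> 'a :: metric_space \<Rightarrow> complex"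
  assumes f: "continuous_on ({0<..1} \<times> X) f" and a: "continuous_on X a"
    and bnd: "\<And>t x. 0 < t \<Longrightarrow> t \<le> 1 \<Longrightarrow> x \<in> X \<Longrightarrow> cmod (f (t, x) - a x) \<le> 2 * t"
  shows "continuous_on ({0..1} \<times> X) (\<lambda>p. if fst p = 0 then a (snd p) else f p)"
  unfolding continuous_on_eq_continuous_within
proof
  let ?h = "\<lambda>p. if fst p = 0 then a (snd p) else f p" and ?X = "{0..1::real} \<times> X"
  fix p assume p: "p \<in> ?X"
  have asnd: "continuous_on ?X (\<lambda>q. a (snd q))"
    by (rule continuous_on_compose2[OF a continuous_on_snd[OF continuous_on_id]]) auto
  show "continuous (at p within ?X) ?h"
  proof (cases "fst p = 0")
    case True
    have "((\<lambda>q. ?h q - a (snd q)) \<longlongrightarrow> 0) (at p within ?X)"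
    proof (rule Lim_null_comparison)
      have "((\<lambda>q. 2 * fst q) \<longlongrightarrow> 2 * fst p) (at p within ?X)"
        by (intro tendsto_intros)
      then show "((\<lambda>q. 2 * fst q) \<longlongrightarrow> 0) (at p within ?X)" using True by simp
      show "eventually (\<lambda>q. cmod (?h q - a (snd q)) \<le> 2 * fst q) (at p within ?X)"
        unfolding eventually_at_filter
        by (rule always_eventually) (use bnd in auto)
    qed
    moreover have "((\<lambda>q. a (snd q)) \<longlongrightarrow> a (snd p)) (at p within ?X)"
      using bspec[OF asnd[unfolded continuous_on_def] p] .
    ultimately have "((\<lambda>q. (?h q - a (snd q)) + a (snd q)) \<longlongrightarrow> 0 + a (snd p)) (at p within ?X)"
      by (rule tendsto_add)
    then show ?thesis using True by (simp add: continuous_within)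
  next
    case False
    let ?N = "{q :: real \<times> 'a. fst q > 0}"
    have N: "open ?N" "p \<in> ?N"
      using False p by (auto intro!: open_Collect_less continuous_intros)
    have "continuous_on ({0<..1} \<times> X) ?h"
      by (subst continuous_on_cong[OF refl, of _ ?h f]) (auto intro: f)
    then have "continuous (at p within {0<..1} \<times> X) ?h"
      using False p by (auto simp: continuous_on_eq_continuous_within)
    moreover have "at p within ({0<..1} \<times> X) = at p within ?X"
      by (rule at_within_nhd[OF N(2,1)]) auto
    ultimately show ?thesis by simp
  qed
qed

section \<open>Strata\<close>

text \<open>Builds a candidate for \<open>polar\<close>: coordinates in \<open>I\<close> take their
  phase from \<open>v\<close>, the remaining ones, which are meant to vanish, keep it from
  \<open>y\<close>. Index 0 is left out because \<open>ext1\<close> fixes its phase to 1.\<close>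

definition normalise :: "nat \<Rightarrow> nat set \<Rightarrow> vec \<Rightarrow> vec \<Rightarrow> vec \<times> vec" where
  "normalise n I v y = (\<lambda>i. v i / of_real (\<Sum>j\<le>n. cmod (v j)),
     \<lambda>i. if i \<in> I \<and> i \<noteq> 0 then sgn (v i) else y i)"

context snc_very_affine
begin

definition LS :: "nat set \<Rightarrow> vec set" where
  "LS S = {v \<in> L. \<forall>i\<in>S. v i = 0}"

text \<open>The complement of \<open>S\<close> would be too large: a coordinate proportional to one
  in \<open>S\<close> vanishes on the stratum as well.\<close>

definition free_coords :: "nat set \<Rightarrow> nat set" where
  "free_coords S = {i. i \<le> n \<and> (\<exists>v\<in>LS S. v i \<noteq> 0)}"

text \<open>Requiring the zeroth coordinate to be real and nonnegative fixes the common phase of a vector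
  in agreement with the convention \<^term>\<open>ext1 y 0 = 1\<close>.\<close>

definition MS :: "nat set \<Rightarrow> vec set" where
  "MS S = {v \<in> LS S. \<exists>r\<ge>0. v 0 = of_real r}"

definition polarS :: "nat set \<Rightarrow> (vec \<times> vec) set" where
  "polarS S = {x \<in> polar. \<forall>i\<in>S. fst x i = 0}"

definition phases :: "nat set \<Rightarrow> vec set" where
  "phases S = snd ` polarS S"

lemma MS_add: "u \<in> MS S \<Longrightarrow> v \<in> MS S \<Longrightarrow> (\<lambda>i. u i + v i) \<in> MS S"
proof -
  assume u: "u \<in> MS S" and v: "v \<in> MS S"
  obtain r s where "0 \<le> r" "u 0 = of_real r" "0 \<le> s" "v 0 = of_real s"
    using u v by (auto simp: MS_def)
  then show ?thesis
    using u v L_add[of u v] unfolding MS_def LS_def by (auto intro!: exI[of _ "r + s"])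
qed

lemma MS_scale: "v \<in> MS S \<Longrightarrow> 0 \<le> a \<Longrightarrow> (\<lambda>i. of_real a * v i) \<in> MS S"
proof -
  assume v: "v \<in> MS S" and a: "0 \<le> a"
  obtain r where "0 \<le> r" "v 0 = of_real r" using v by (auto simp: MS_def)
  then show ?thesis
    using v a L_scale[of v "of_real a"] unfolding MS_def LS_def by (auto intro!: exI[of _ "a * r"])
qed

lemma MS_Cn1: "MS S \<subseteq> Cn1 n"
  by (auto simp: MS_def LS_def linear_space_def)

lemma finite_free_coords: "finite (free_coords S)"
  by (simp add: free_coords_def)

lemma polarS_D:
  assumes "(v, y) \<in> polarS S"
  shows "(v, y) \<in> polar" "v \<in> MS S" "y \<in> phases S" "v \<in> LS S"
proof -
  show P: "(v, y) \<in> polar" using assms by (simp add: polarS_def)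
  show L: "v \<in> LS S" using assms polarD(2)[OF P] by (simp add: polarS_def LS_def)
  have "v 0 = of_real (cmod (v 0))" using polarD(7)[OF P, of 0] by (simp add: ext1_def)
  then show "v \<in> MS S" using L unfolding MS_def by (metis (mono_tags, lifting) mem_Collect_eq norm_ge_zero)
  show "y \<in> phases S" unfolding phases_def using assms by force
qed

lemma free_coordsI: "v \<in> LS S \<Longrightarrow> i \<le> n \<Longrightarrow> v i \<noteq> 0 \<Longrightarrow> i \<in> free_coords S"
  by (auto simp: free_coords_def)

lemma zero_off_free_coords: "v \<in> LS S \<Longrightarrow> i \<notin> free_coords S \<Longrightarrow> v i = 0"
  by (auto simp: free_coords_def LS_def linear_space_def Cn1_def)

text \<open>The nonzero coordinates of \<open>v\<close> already have the exact phases, and adding a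
  small multiple of \<open>w\<close> supplies them at the vanishing free coordinates. A final
  rotation makes the zeroth coordinate real and costs an arbitrarily small angle.\<close>

lemma near_phase_exists:
  assumes S: "S \<subseteq> {0..n}" and vy: "(v, y) \<in> polarS S" and t: "0 < t"
  shows "\<exists>u\<in>MS S. near_phase (free_coords S) t (ext1 y) u"
proof -
  note P = polarD[OF polarS_D(1)[OF vy]]
  note vLS = polarS_D(4)[OF vy]
  define I where "I = free_coords S"
  \<comment> \<open>These coordinates vanish on the whole stratum, so \<open>w\<close> must vanish
    there for \<open>u e\<close> to stay in \<open>LS S\<close>.\<close>
  define B where "B = {i. i \<le> n \<and> i \<notin> I}"
  have "i \<in> B" if i: "i \<le> n" "j \<in> B" "Zstr n Z {i} = Zstr n Z {j}" for i j
  proof -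
    have j: "j \<le> n" "j \<notin> I" using i(2) by (auto simp: B_def)
    obtain c where c: "\<And>u. u \<in> L \<Longrightarrow> u i = c * u j"
      using proportional_if_Zstr_eq[OF i(1) j(1) i(3)] by blast
    have "u i = 0" if "u \<in> LS S" for u
      using that zero_off_free_coords[OF that, of j] c[of u] j(2) by (simp add: I_def LS_def)
    then show ?thesis using i(1) by (auto simp: B_def I_def free_coords_def)
  qed
  then obtain w where w: "w \<in> L" "\<And>i. i \<le> n \<Longrightarrow> v i = 0 \<Longrightarrow>
      if i \<in> B then w i = 0 else w i \<noteq> 0 \<and> w i = of_real (cmod (w i)) * ext1 y i"
    using phase_vector[OF polarS_D(1)[OF vy], of B] by blast
  have "w i = 0" if "i \<in> S" for i
  proof -
    have "i \<le> n" "v i = 0" "i \<notin> I" using that S vLS by (auto simp: LS_def I_def free_coords_def)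
    then show ?thesis using w(2)[of i] by (simp add: B_def)
  qed
  then have wLS: "w \<in> LS S" using w(1) by (simp add: LS_def)
  define u where "u e = (\<lambda>i. v i + of_real e * w i)" for e
  \<comment> \<open>If \<open>v 0 \<noteq> 0\<close>, conjugation turns the zeroth coordinate into a
    squared modulus. If \<open>v 0 = 0\<close>, that coordinate is \<open>e * w 0\<close>, already
    real and nonnegative, and no rotation is made.\<close>
  define r where "r e = (if v 0 = 0 then 1 else cnj (u e 0))" for e
  let ?F = "at_right (0 :: real)"
  have uLS: "u e \<in> LS S" for e
    using linear_space_lincomb[of v n A w 1 "of_real e"] vLS wLS by (simp add: u_def LS_def)
  have ulim: "((\<lambda>e. u e i) \<longlongrightarrow> v i) ?F" for i
  proof -
    have "((\<lambda>e. v i + of_real e * w i) \<longlongrightarrow> v i + of_real 0 * w i) ?F"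
      by (intro tendsto_intros)
    then show ?thesis by (simp add: u_def)
  qed
  have v0: "v 0 = of_real (cmod (v 0))" using P(7)[of 0] by (simp add: ext1_def)
  define r0 where "r0 = (if v 0 = 0 then 1 else cmod (v 0))"
  have r0: "0 < r0" by (simp add: r0_def)
  have rlim: "(r \<longlongrightarrow> of_real r0) ?F"
  proof (cases "v 0 = 0")
    case False
    have "((\<lambda>e. cnj (u e 0)) \<longlongrightarrow> cnj (v 0)) ?F" using ulim by (rule tendsto_cnj)
    moreover have "cnj (v 0) = v 0" using v0 by (metis complex_cnj_complex_of_real)
    ultimately show ?thesis using False v0 by (simp add: r_def[abs_def] r0_def)
  qed (simp add: r_def[abs_def] r0_def)
  have near: "eventually (\<lambda>e. \<bar>Im (z e)\<bar> < t * Re (z e)) ?F"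
    if "(z \<longlongrightarrow> of_real a) ?F" "0 < a" for z a
  proof -
    have "((\<lambda>e. t * Re (z e) - \<bar>Im (z e)\<bar>) \<longlongrightarrow> t * Re (of_real a) - \<bar>Im (of_real a)\<bar>) ?F"
      by (intro tendsto_intros that)
    moreover have "0 < t * Re (of_real a) - \<bar>Im (of_real a)\<bar>" using that t by simp
    ultimately have "eventually (\<lambda>e. 0 < t * Re (z e) - \<bar>Im (z e)\<bar>) ?F" by (rule order_tendstoD(1))
    then show ?thesis by eventually_elim simp
  qed
  have "eventually (\<lambda>e. \<bar>Im (r e * u e i * cnj (ext1 y i))\<bar> < t * Re (r e * u e i * cnj (ext1 y i))) ?F"
    if i: "i \<in> I" for i
  proof -
    have le: "i \<le> n" using i by (simp add: I_def free_coords_def)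
    have yy: "ext1 y i * cnj (ext1 y i) = 1" using P(6)[OF le] by (simp add: complex_norm_square[symmetric])
    show ?thesis
    proof (cases "v i = 0")
      case False
      have "((\<lambda>e. r e * u e i * cnj (ext1 y i)) \<longlongrightarrow> of_real r0 * v i * cnj (ext1 y i)) ?F"
        by (intro tendsto_mult rlim ulim tendsto_const)
      moreover have "v i * cnj (ext1 y i) = of_real (cmod (v i))"
        using P(7)[OF le] yy by (metis mult.assoc mult.right_neutral)
      ultimately have "((\<lambda>e. r e * u e i * cnj (ext1 y i)) \<longlongrightarrow> of_real (r0 * cmod (v i))) ?F"
        by (simp only: mult.assoc of_real_mult)
      then show ?thesis by (rule near) (use False r0 in simp)
    next
      case True
      have "i \<notin> B" using i by (simp add: B_def)
      then have wi: "w i \<noteq> 0" "w i = of_real (cmod (w i)) * ext1 y i"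
        using w(2)[OF le True] by auto
      \<comment> \<open>Here the coordinate of \<open>u e\<close> is an exact positive multiple of
        its target phase, so the only phase error is that of the rotation
        \<open>r e\<close>.\<close>
      have "eventually (\<lambda>e. \<bar>Im (r e)\<bar> < t * Re (r e)) ?F" by (rule near[OF rlim r0])
      with eventually_at_right_less[of 0] show ?thesis
      proof eventually_elim
        case (elim e)
        have "w i * cnj (ext1 y i) = of_real (cmod (w i))"
          using wi(2) yy by (metis mult.assoc mult.right_neutral)
        moreover define Q where "Q = e * cmod (w i)"
        ultimately have eq: "r e * u e i * cnj (ext1 y i) = of_real Q * r e"
          using True by (simp add: u_def mult_ac)
        have "0 < Q" using elim wi by (simp add: Q_def)
        then have "Q * \<bar>Im (r e)\<bar> < Q * (t * Re (r e))"
          using elim(2) by (intro mult_strict_left_mono)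
        then show ?case unfolding eq using \<open>0 < Q\<close> by (simp add: abs_mult mult_ac)
      qed
    qed
  qed
  then have "eventually (\<lambda>e. \<forall>i\<in>I. \<bar>Im (r e * u e i * cnj (ext1 y i))\<bar> < t * Re (r e * u e i * cnj (ext1 y i))) ?F"
    using finite_free_coords unfolding I_def by (intro eventually_ball_finite) auto
  with eventually_at_right_less[of 0]
  have "eventually (\<lambda>e. 0 < e \<and> near_phase I t (ext1 y) (\<lambda>i. r e * u e i)) ?F"
    by eventually_elim (simp add: near_phase_def)
  then obtain e where e: "0 < e" "near_phase I t (ext1 y) (\<lambda>i. r e * u e i)"
    using eventually_happens[of _ ?F] by auto
  have "(\<lambda>i. r e * u e i) \<in> LS S" using uLS[of e] L_scale by (simp add: LS_def)
  moreover have "\<exists>q\<ge>0. r e * u e 0 = of_real q"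
  proof (cases "v 0 = 0")
    case False
    then have "r e * u e 0 = of_real ((cmod (u e 0))\<^sup>2)"
      using complex_norm_square[of "u e 0"] by (simp add: r_def mult.commute)
    then show ?thesis using zero_le_power2 by blast
  next
    case True
    have "w 0 = of_real (cmod (w 0))" using w(2)[OF le0 True] by (auto simp: ext1_def split: if_splits)
    then have "r e * u e 0 = of_real (e * cmod (w 0))"
      using True by (simp add: r_def u_def)
    then show ?thesis using e(1) by (intro exI[of _ "e * cmod (w 0)"]) simp
  qed
  ultimately show ?thesis using e(2) unfolding I_def MS_def by blast
qed

text \<open>The point \<open>(v0, y)\<close> certifies that the phases kept off the free coordinates
  are admissible; \<open>v\<close> contributes only the free ones.\<close>

lemma normalise_in_polarS:
  assumes vy: "(v0, y) \<in> polarS S" and v: "v \<in> MS S" and nz: "\<And>i. i \<in> free_coords S \<Longrightarrow> v i \<noteq> 0"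
  shows "normalise n (free_coords S) v y \<in> polarS S"
proof -
  note P = polarD[OF polarS_D(1)[OF vy]]
  define I where "I = free_coords S"
  have vLS: "v \<in> LS S" and vL: "v \<in> L" using v by (auto simp: MS_def LS_def)
  \<comment> \<open>A nonzero coordinate of \<open>v0\<close> is free, hence also nonzero in
    \<open>v\<close>, so the normalising sum is positive.\<close>
  obtain k where k: "k \<le> n" "v0 k \<noteq> 0" using Lx_coord[OF P(1)] by blast
  then have "v k \<noteq> 0" using nz free_coordsI[OF polarS_D(4)[OF vy]] by blast
  then have vx: "v \<in> Lx" using vL L_Lx by blast
  define s where "s = (\<Sum>j\<le>n. cmod (v j))"
  have s: "0 < s" unfolding s_def by (rule sum_norm_pos[OF vx])
  define v' where "v' = (\<lambda>i. v i / of_real s)"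
  define y' where "y' = (\<lambda>i. if i \<in> I \<and> i \<noteq> 0 then sgn (v i) else y i)"
  have v'_eq: "v' = (\<lambda>i. inverse (of_real s) * v i)" by (simp add: v'_def field_simps)
  have e1: "ext1 y' i = sgn (v i)" if "i \<in> I" for i
  proof (cases "i = 0")
    case True
    obtain r where "v 0 = of_real r" "0 \<le> r" using v by (auto simp: MS_def)
    moreover have "v 0 \<noteq> 0" using nz that True by (simp add: I_def)
    ultimately show ?thesis using True by (simp add: ext1_def sgn_of_real)
  qed (use that in \<open>simp add: ext1_def y'_def\<close>)
  have e2: "ext1 y' i = ext1 y i" if "i \<notin> I" for i using that by (simp add: ext1_def y'_def)
  have v0: "v i = 0" if "i \<notin> I" for i using zero_off_free_coords[OF vLS] that by (simp add: I_def)
  have "(v', y') \<in> polar" unfolding polar_def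
  proof (intro CollectI case_prodI conjI allI impI)
    show "v' \<in> Lx" unfolding v'_eq using Lx_scale[OF _ vx] s by simp
    have "(\<Sum>i\<le>n. cmod (v' i)) = (\<Sum>i\<le>n. cmod (v i) / s)" using s by (simp add: v'_def norm_divide)
    also have "\<dots> = 1" using s by (simp add: s_def flip: sum_divide_distrib)
    finally show "(\<Sum>i\<le>n. cmod (v' i)) = 1" .
    show "y' 0 = 0" using P(4) by (simp add: y'_def)
    show "y' i = 0" if "n < i" for i using that P(5) by (simp add: y'_def I_def free_coords_def)
    show "cmod (ext1 y' i) = 1" if "i \<le> n" for i
      using e1 e2 nz P(6)[OF that] by (cases "i \<in> I") (auto simp: norm_sgn I_def)
    show "v' i = of_real (cmod (v' i)) * ext1 y' i" if "i \<le> n" for i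
      using e1 v0 s norm_mult_sgn[of "v i"] by (cases "i \<in> I") (auto simp: v'_def norm_divide)
    fix i j c assume ij: "i \<le> n" "j \<le> n" and c: "\<forall>u\<in>L. u i = c * u j"
    show "of_real (cmod c) * ext1 y' i = c * ext1 y' j"
    proof (cases "c = 0")
      case False
      \<comment> \<open>Proportional coordinates with \<open>c \<noteq> 0\<close> are free together,
        so their phases are both read from \<open>v\<close> or both from \<open>y\<close>; the mixed
        case of the compatibility condition does not arise.\<close>
      have "u i = 0 \<longleftrightarrow> u j = 0" if "u \<in> L" for u
        using bspec[OF c that] False by simp
      then have "i \<in> I \<longleftrightarrow> j \<in> I"
        using ij unfolding I_def free_coords_def LS_def by blast
      show ?thesis
      proof (cases "j \<in> I")
        case True
        then have "sgn (v i) = sgn c * sgn (v j)" using bspec[OF c vL] by (simp add: sgn_mult)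
        then have "of_real (cmod c) * sgn (v i) = c * sgn (v j)"
          by (simp add: norm_mult_sgn flip: mult.assoc)
        then show ?thesis using True \<open>i \<in> I \<longleftrightarrow> j \<in> I\<close> e1 by simp
      next
        case False
        have "of_real (cmod c) * ext1 y i = c * ext1 y j" by (rule P(8)[OF ij bspec[OF c]])
        then show ?thesis using False e2 \<open>i \<in> I \<longleftrightarrow> j \<in> I\<close> by simp
      qed
    qed simp
  qed
  moreover have "\<forall>i\<in>S. v' i = 0" using vLS by (simp add: v'_def LS_def)
  ultimately have "(v', y') \<in> polarS S" by (simp add: polarS_def)
  then show ?thesis by (simp add: normalise_def v'_def y'_def s_def I_def)
qed

end

section \<open>Generalities on homotopy equivalences\<close>

lemma homotopic_top_of_setI:
  fixes h :: "real \<times> 'a :: topological_space \<Rightarrow> 'b :: topological_space"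
  assumes "continuous_on ({0..1} \<times> X) h" "\<And>t x. t \<in> {0..1} \<Longrightarrow> x \<in> X \<Longrightarrow> h (t, x) \<in> Y"
    and "\<And>x. x \<in> X \<Longrightarrow> h (0, x) = f x" "\<And>x. x \<in> X \<Longrightarrow> h (1, x) = g x"
  shows "homotopic_with (\<lambda>_. True) (top_of_set X) (top_of_set Y) f g"
proof -
  have "prod_topology (top_of_set {0..1::real}) (top_of_set X) = top_of_set ({0..1} \<times> X)"
    by (simp add: prod_topology_euclidean flip: subtopology_Times)
  then have c: "continuous_map (prod_topology (top_of_set {0..1}) (top_of_set X)) (top_of_set Y) h"
    using assms(1,2) by (auto simp: continuous_map_in_subtopology)
  have "\<exists>h. continuous_map (prod_topology (top_of_set {0..1::real}) (top_of_set X)) (top_of_set Y) h \<and>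
      (\<forall>x\<in>topspace (top_of_set X). h (0, x) = f x) \<and>
      (\<forall>x\<in>topspace (top_of_set X). h (1, x) = g x) \<and> (\<forall>t\<in>{0..1::real}. True)"
    by (intro exI[of _ h] conjI) (use c assms(3,4) in simp_all)
  then show ?thesis by (subst homotopic_with) (rule refl, assumption)
qed

lemma homotopy_equivalence_map_homeomorphic:
  assumes "homeomorphic_maps X Y f g"
  shows "homotopy_equivalence_map X Y f"
  unfolding homotopy_equivalence_map_def
proof (intro conjI exI[of _ g])
  show f: "continuous_map X Y f" "continuous_map Y X g"
    using assms by (auto simp: homeomorphic_maps_def)
  have gf: "(g \<circ> f) x = id x" if "x \<in> topspace X" for x
    using assms that by (simp add: homeomorphic_maps_def)
  have fg: "(f \<circ> g) y = id y" if "y \<in> topspace Y" for y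
    using assms that by (simp add: homeomorphic_maps_def)
  show "homotopic_with (\<lambda>x. True) X X (g \<circ> f) id"
    by (rule homotopic_with_equal[OF TrueI TrueI continuous_map_compose[OF f] gf])
  show "homotopic_with (\<lambda>x. True) Y Y (f \<circ> g) id"
    by (rule homotopic_with_equal[OF TrueI TrueI continuous_map_compose[OF f(2,1)] fg])
qed

lemma homotopic_conj_id:
  assumes "homotopic_with (\<lambda>_. True) Y Y (g' \<circ> g) id" "continuous_map X Y f" "continuous_map Y X f'"
    and "homotopic_with (\<lambda>_. True) X X (f' \<circ> f) id"
  shows "homotopic_with (\<lambda>_. True) X X ((f' \<circ> g') \<circ> (g \<circ> f)) id"
proof -
  have "homotopic_with (\<lambda>_. True) Y X (f' \<circ> (g' \<circ> g)) (f' \<circ> id)"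
    by (rule homotopic_with_compose_continuous_map_left[OF assms(1,3)]) simp
  then have "homotopic_with (\<lambda>_. True) X X ((f' \<circ> (g' \<circ> g)) \<circ> f) ((f' \<circ> id) \<circ> f)"
    by (rule homotopic_with_compose_continuous_map_right[OF _ assms(2)]) simp
  then show ?thesis using homotopic_with_trans[OF _ assms(4)] by (simp add: o_assoc)
qed

lemma homotopy_equivalence_map_compose:
  assumes "homotopy_equivalence_map X Y f" "homotopy_equivalence_map Y W g"
  shows "homotopy_equivalence_map X W (g \<circ> f)"
proof -
  obtain f' where f: "continuous_map X Y f" "continuous_map Y X f'"
    "homotopic_with (\<lambda>x. True) X X (f' \<circ> f) id" "homotopic_with (\<lambda>x. True) Y Y (f \<circ> f') id"
    using assms(1) unfolding homotopy_equivalence_map_def by blast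
  obtain g' where g: "continuous_map Y W g" "continuous_map W Y g'"
    "homotopic_with (\<lambda>x. True) Y Y (g' \<circ> g) id" "homotopic_with (\<lambda>x. True) W W (g \<circ> g') id"
    using assms(2) unfolding homotopy_equivalence_map_def by blast
  show ?thesis
    unfolding homotopy_equivalence_map_def
    by (intro conjI exI[of _ "f' \<circ> g'"] continuous_map_compose[OF f(1) g(1)]
        continuous_map_compose[OF g(2) f(2)] homotopic_conj_id[OF g(3) f(1,2,3)]
        homotopic_conj_id[OF f(4) g(2,1,4)])
qed

lemma homotopy_equivalence_map_eq:
  assumes f: "homotopy_equivalence_map X Y f" and eq: "\<And>x. x \<in> topspace X \<Longrightarrow> f x = f' x"
  shows "homotopy_equivalence_map X Y f'"
proof -
  obtain g where g: "continuous_map X Y f" "continuous_map Y X g"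
    "homotopic_with (\<lambda>x. True) X X (g \<circ> f) id" "homotopic_with (\<lambda>x. True) Y Y (f \<circ> g) id"
    using f unfolding homotopy_equivalence_map_def by blast
  have gy: "g y \<in> topspace X" if "y \<in> topspace Y" for y
    using g(2) that by (auto simp: continuous_map_def)
  show ?thesis
    unfolding homotopy_equivalence_map_def
  proof (intro conjI exI[of _ g])
    show "continuous_map X Y f'" using continuous_map_eq[OF g(1) eq] .
    show "homotopic_with (\<lambda>x. True) X X (g \<circ> f') id"
      by (rule homotopic_with_eq[OF g(3)]) (simp_all add: eq)
    show "homotopic_with (\<lambda>x. True) Y Y (f' \<circ> g) id"
      by (rule homotopic_with_eq[OF g(4)]) (simp_all add: eq gy)
  qed (rule g(2))
qed

section \<open>Deformations of a stratum and of its phases\<close>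

context snc_very_affine
begin

definition selects :: "nat set \<Rightarrow> (real \<times> vec \<Rightarrow> vec) \<Rightarrow> bool" where
  "selects S G \<longleftrightarrow> continuous_on ({0..1} \<times> phases S) G \<and> (\<forall>y\<in>phases S. G (0, y) = (\<lambda>i. 0)) \<and>
     (\<forall>t\<in>{0<..1}. \<forall>y\<in>phases S. G (t, y) \<in> MS S \<and> near_phase (free_coords S) t (ext1 y) (G (t, y)))"

lemma selects_exists:
  assumes S: "S \<subseteq> {0..n}"
  shows "\<exists>G. selects S G"
proof -
  have "\<exists>G. continuous_on ({0<..1} \<times> phases S) G \<and> (\<forall>t\<in>{0<..1}. \<forall>y\<in>phases S.
    G (t, y) \<in> MS S \<and> near_phase (free_coords S) t (ext1 y) (G (t, y)) \<and> (\<forall>i. cmod (G (t, y) i) \<le> t))"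
  proof (rule phase_selection[OF finite_free_coords MS_add MS_scale MS_Cn1])
    fix y t assume "y \<in> phases S" "(0::real) < t"
    then show "\<exists>v\<in>MS S. near_phase (free_coords S) t (ext1 y) v"
      using near_phase_exists[OF S] unfolding phases_def by force
  qed auto
  then obtain G where G: "continuous_on ({0<..1} \<times> phases S) G"
    "\<And>t y. t \<in> {0<..1} \<Longrightarrow> y \<in> phases S \<Longrightarrow>
      G (t, y) \<in> MS S \<and> near_phase (free_coords S) t (ext1 y) (G (t, y)) \<and> (\<forall>i. cmod (G (t, y) i) \<le> t)"
    by blast
  define E where "E p = (\<lambda>i. if fst p = 0 then 0 else G p i)" for p
  have "continuous_on ({0..1} \<times> phases S) E"
    unfolding E_def
  proof (intro continuous_on_coordinatewise_then_product continuous_on_extend_to_zero)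
    show "continuous_on ({0<..1} \<times> phases S) (\<lambda>p. G p i)" for i
      by (rule continuous_on_product_then_coordinatewise[OF G(1)])
    show "cmod (G (t, y) i - 0) \<le> 2 * t" if "0 < t" "t \<le> 1" "y \<in> phases S" for t y i
      using G(2)[of t y] that by (smt (verit) diff_zero greaterThanAtMost_iff)
  qed simp
  then show ?thesis
    unfolding selects_def using G(2) by (intro exI[of _ E]) (simp add: E_def)
qed

text \<open>Equals \<open>v\<close> at time 0 and \<open>G (1, y)\<close> at time 1. The second no
  longer depends on \<open>v\<close>, which makes the end of the deformation factor through the
  phases.\<close>

definition push_vec :: "(real \<times> vec \<Rightarrow> vec) \<Rightarrow> real \<times> vec \<times> vec \<Rightarrow> vec" where
  "push_vec G p = (\<lambda>i. of_real (1 - fst p) * fst (snd p) i + G (fst p, snd (snd p)) i)"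

text \<open>At time 0 the phases are taken from the second component, since a vanishing coordinate
  of the vector has none.\<close>

definition push :: "nat set \<Rightarrow> (real \<times> vec \<Rightarrow> vec) \<Rightarrow> real \<times> vec \<times> vec \<Rightarrow> vec \<times> vec" where
  "push S G p = (\<lambda>i. push_vec G p i / of_real (\<Sum>j\<le>n. cmod (push_vec G p j)),
     \<lambda>i. if i \<in> free_coords S \<and> i \<noteq> 0
         then (if fst p = 0 then snd (snd p) i else sgn (push_vec G p i)) else snd (snd p) i)"

text \<open>The companion of \<open>push\<close> on phases alone: \<open>y\<close> is moved to the
  phases of \<open>G (t, y)\<close>.\<close>

definition flow :: "nat set \<Rightarrow> (real \<times> vec \<Rightarrow> vec) \<Rightarrow> real \<times> vec \<Rightarrow> vec" where
  "flow S G p = (\<lambda>i. if i \<in> free_coords S \<and> i \<noteq> 0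
     then (if fst p = 0 then snd p i else sgn (G p i)) else snd p i)"

lemma free_coords_le: "i \<in> free_coords S \<Longrightarrow> i \<le> n"
  by (simp add: free_coords_def)

lemma push_normalise: "t \<noteq> 0 \<Longrightarrow> push S G (t, v, y) = normalise n (free_coords S) (push_vec G (t, v, y)) y"
  by (auto simp: push_def normalise_def fun_eq_iff)

lemma flow_normalise: "t \<noteq> 0 \<Longrightarrow> flow S G (t, y) = snd (normalise n (free_coords S) (G (t, y)) y)"
  by (auto simp: flow_def normalise_def fun_eq_iff)

lemma push_vec_0:
  assumes "selects S G" "(v, y) \<in> polarS S"
  shows "push_vec G (0, v, y) = v"
  using assms polarS_D(3)[OF assms(2)] by (simp add: selects_def push_vec_def)

lemma push_0:
  assumes "selects S G" "x \<in> polarS S"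
  shows "push S G (0, x) = x"
proof -
  obtain v y where x: "x = (v, y)" by (cases x)
  show ?thesis
    unfolding x push_def using push_vec_0[OF assms[unfolded x]] polarD(3)[OF polarS_D(1)[OF assms(2)[unfolded x]]]
    by auto
qed

lemma push_vec_props:
  assumes G: "selects S G" and vy: "(v, y) \<in> polarS S" and t: "0 < t" "t \<le> 1"
  shows "push_vec G (t, v, y) \<in> MS S" "near_phase (free_coords S) t (ext1 y) (push_vec G (t, v, y))"
proof -
  note P = polarD[OF polarS_D(1)[OF vy]]
  have g: "G (t, y) \<in> MS S" "near_phase (free_coords S) t (ext1 y) (G (t, y))"
    using G t polarS_D(3)[OF vy] by (auto simp: selects_def)
  have eq: "push_vec G (t, v, y) = (\<lambda>i. of_real (1 - t) * v i + G (t, y) i)"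
    by (simp add: push_vec_def)
  show "push_vec G (t, v, y) \<in> MS S"
    unfolding eq using t by (intro MS_add MS_scale polarS_D(2)[OF vy] g(1)) simp
  show "near_phase (free_coords S) t (ext1 y) (push_vec G (t, v, y))"
    unfolding eq
  proof (rule near_phase_aligned[OF g(2) t(1), where r = "\<lambda>i. (1 - t) * cmod (v i)"], intro conjI)
    fix i assume "i \<in> free_coords S"
    then have i: "i \<le> n" by (rule free_coords_le)
    show "of_real (1 - t) * v i = of_real ((1 - t) * cmod (v i)) * ext1 y i"
      using P(7)[OF i] by (metis mult.assoc of_real_mult)
    show "0 \<le> (1 - t) * cmod (v i)" using t by simp
    show "cmod (ext1 y i) = 1" by (rule P(6)[OF i])
  qed
qed

lemma push_in_polarS:
  assumes G: "selects S G" and x: "x \<in> polarS S" and t: "0 \<le> t" "t \<le> 1"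
  shows "push S G (t, x) \<in> polarS S"
proof (cases "t = 0")
  case False
  obtain v y where xy: "x = (v, y)" by (cases x)
  have "0 < t" using t False by simp
  note p = push_vec_props[OF G x[unfolded xy] this t(2)]
  show ?thesis
    unfolding xy push_normalise[OF False]
    by (rule normalise_in_polarS[OF x[unfolded xy] p(1) near_phase_nonzero[OF p(2) \<open>0 < t\<close>]])
qed (use push_0[OF G x] x in simp)

lemma exists_free_coord: "(v, y) \<in> polarS S \<Longrightarrow> \<exists>k\<in>free_coords S. v k \<noteq> 0"
  using polarS_D(4) Lx_coord[of v] polarD(1) polarS_D(1) free_coordsI by meson

lemma continuous_on_push:
  assumes G: "selects S G"
  shows "continuous_on ({0..1} \<times> polarS S) (push S G)"
proof -
  let ?D = "{0..1::real} \<times> polarS S"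
  have c_v: "continuous_on X (\<lambda>p :: real \<times> vec \<times> vec. fst (snd p) i)" for X i
    by (rule continuous_on_product_then_coordinatewise[OF continuous_on_fst[OF continuous_on_snd[OF continuous_on_id]]])
  have c_y: "continuous_on X (\<lambda>p :: real \<times> vec \<times> vec. snd (snd p) i)" for X i
    by (rule continuous_on_product_then_coordinatewise[OF continuous_on_snd[OF continuous_on_snd[OF continuous_on_id]]])
  have "continuous_on ?D (\<lambda>p. G (fst p, snd (snd p)))"
  proof (rule continuous_on_compose2[where f = "\<lambda>p. (fst p, snd (snd p))"])
    show "continuous_on ({0..1} \<times> phases S) G" using G by (simp add: selects_def)
    show "continuous_on ?D (\<lambda>p. (fst p, snd (snd p)))" by (intro continuous_intros)
    show "(\<lambda>p. (fst p, snd (snd p))) ` ?D \<subseteq> {0..1} \<times> phases S" using polarS_D(3) by auto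
  qed
  then have c_G: "continuous_on ?D (\<lambda>p. G (fst p, snd (snd p)) i)" for i
    by (rule continuous_on_product_then_coordinatewise)
  have c_u: "continuous_on ?D (\<lambda>p. push_vec G p i)" for i
    unfolding push_vec_def
    by (intro continuous_on_add continuous_on_mult c_v c_G continuous_on_of_real continuous_on_diff
        continuous_on_const continuous_on_fst continuous_on_id)
  have nz: "push_vec G (t, v, y) i \<noteq> 0"
    if "0 < t" "t \<le> 1" "(v, y) \<in> polarS S" "i \<in> free_coords S" for t v y i
    using near_phase_nonzero[OF push_vec_props(2)[OF G that(3,1,2)] that(1,4)] .
  \<comment> \<open>At positive time all free coordinates are nonzero; at time 0 the vector is
    \<open>v\<close> itself, which is nonzero at \<open>k\<close>.\<close>
  have s: "\<forall>p\<in>?D. of_real (\<Sum>j\<le>n. cmod (push_vec G p j)) \<noteq> 0"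
  proof
    fix p assume "p \<in> ?D"
    then obtain t v y where p: "p = (t, v, y)" "0 \<le> t" "t \<le> 1" "(v, y) \<in> polarS S" by auto
    obtain k where k: "k \<in> free_coords S" "v k \<noteq> 0" using exists_free_coord[OF p(4)] by blast
    have "push_vec G p k \<noteq> 0"
      using nz[of t v y k] push_vec_0[OF G p(4)] k p by (cases "t = 0") auto
    then have "0 < (\<Sum>j\<le>n. cmod (push_vec G p j))"
      using free_coords_le[OF k(1)] by (intro sum_pos2[of _ k]) auto
    then show "of_real (\<Sum>j\<le>n. cmod (push_vec G p j)) \<noteq> 0" by (simp del: of_real_sum)
  qed
  have "continuous_on ?D (\<lambda>p i. push_vec G p i / of_real (\<Sum>j\<le>n. cmod (push_vec G p j)))"
    by (intro continuous_on_coordinatewise_then_product continuous_on_divide c_u s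
        continuous_on_of_real continuous_on_sum continuous_on_norm)
  moreover have "continuous_on ?D (\<lambda>p i. if i \<in> free_coords S \<and> i \<noteq> 0
         then (if fst p = 0 then snd (snd p) i else sgn (push_vec G p i)) else snd (snd p) i)"
  proof (rule continuous_on_coordinatewise_then_product)
    fix i
    show "continuous_on ?D (\<lambda>p. if i \<in> free_coords S \<and> i \<noteq> 0
         then (if fst p = 0 then snd (snd p) i else sgn (push_vec G p i)) else snd (snd p) i)"
    proof (cases "i \<in> free_coords S \<and> i \<noteq> 0")
      case True
      \<comment> \<open>At time 0 the coordinate may vanish, where \<open>sgn\<close> is
        discontinuous; the phase estimate by \<open>2 * t\<close> takes over.\<close>
      have "continuous_on ?D (\<lambda>p. if fst p = 0 then snd (snd p) i else sgn (push_vec G p i))"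
      proof (rule continuous_on_extend_to_zero)
        show "continuous_on ({0<..1} \<times> polarS S) (\<lambda>p. sgn (push_vec G p i))"
          by (intro continuous_on_sgn continuous_on_subset[OF c_u]) (use nz True in auto)
        show "continuous_on (polarS S) (\<lambda>x. snd x i)"
          by (rule continuous_on_snd_coord)
        fix t :: real and x assume t: "0 < t" "t \<le> 1" and x: "x \<in> polarS S"
        obtain v y where xy: "x = (v, y)" by (cases x)
        have "cmod (sgn (push_vec G (t, v, y) i) - ext1 y i) \<le> 2 * t"
          using near_phase_sgn[OF push_vec_props(2)[OF G x[unfolded xy] t] t(1), of i] True
            polarD(6)[OF polarS_D(1)[OF x[unfolded xy]], of i] free_coords_le[of i S] by simp
        then show "cmod (sgn (push_vec G (t, x) i) - snd x i) \<le> 2 * t"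
          using True by (simp add: xy ext1_def)
      qed
      then show ?thesis using True by simp
    qed (use c_y in auto)
  qed
  ultimately show ?thesis unfolding push_def[abs_def] by (rule continuous_on_Pair)
qed

lemma G_props:
  assumes "selects S G" "y \<in> phases S" "0 < t" "t \<le> 1"
  shows "G (t, y) \<in> MS S" "near_phase (free_coords S) t (ext1 y) (G (t, y))"
    "i \<in> free_coords S \<Longrightarrow> G (t, y) i \<noteq> 0" "normalise n (free_coords S) (G (t, y)) y \<in> polarS S"
proof -
  show 1: "G (t, y) \<in> MS S" "near_phase (free_coords S) t (ext1 y) (G (t, y))"
    using assms by (auto simp: selects_def)
  show 2: "G (t, y) i \<noteq> 0" if "i \<in> free_coords S" for i
    using near_phase_nonzero[OF 1(2) assms(3) that] .
  obtain v where "(v, y) \<in> polarS S" using assms(2) by (auto simp: phases_def)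
  then show "normalise n (free_coords S) (G (t, y)) y \<in> polarS S"
    using 1(1) 2 by (rule normalise_in_polarS)
qed

lemma phases_D:
  assumes "y \<in> phases S"
  shows "i \<le> n \<Longrightarrow> cmod (ext1 y i) = 1" "y 0 = 0" "i > n \<Longrightarrow> y i = 0"
proof -
  obtain v where "(v, y) \<in> polarS S" using assms by (auto simp: phases_def)
  from polarD[OF polarS_D(1)[OF this]] show "i \<le> n \<Longrightarrow> cmod (ext1 y i) = 1" "y 0 = 0" "i > n \<Longrightarrow> y i = 0"
    by blast+
qed

lemma continuous_on_flow:
  assumes G: "selects S G"
  shows "continuous_on ({0..1} \<times> phases S) (flow S G)"
  unfolding flow_def[abs_def]
proof (rule continuous_on_coordinatewise_then_product)
  fix i
  let ?D = "{0..1} \<times> phases S"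
  have c_y: "continuous_on X (\<lambda>p :: real \<times> vec. snd p i)" for X
    by (rule continuous_on_snd_coord)
  show "continuous_on ?D (\<lambda>p. if i \<in> free_coords S \<and> i \<noteq> 0
     then (if fst p = 0 then snd p i else sgn (G p i)) else snd p i)"
  proof (cases "i \<in> free_coords S \<and> i \<noteq> 0")
    case True
    have "continuous_on ?D G" using G by (simp add: selects_def)
    then have "continuous_on ?D (\<lambda>p. G p i)" by (rule continuous_on_product_then_coordinatewise)
    then have c_G: "continuous_on ({0<..1} \<times> phases S) (\<lambda>p. G p i)"
      by (rule continuous_on_subset) auto
    have "continuous_on ?D (\<lambda>p. if fst p = 0 then snd p i else sgn (G p i))"
    proof (rule continuous_on_extend_to_zero)
      show "continuous_on ({0<..1} \<times> phases S) (\<lambda>p. sgn (G p i))"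
        by (intro continuous_on_sgn c_G) (use G_props(3)[OF G] True in auto)
      show "continuous_on (phases S) (\<lambda>y. y i)"
        by (rule continuous_on_coord)
      fix t :: real and y assume t: "0 < t" "t \<le> 1" and y: "y \<in> phases S"
      have "cmod (sgn (G (t, y) i) - ext1 y i) \<le> 2 * t"
        using near_phase_sgn[OF G_props(2)[OF G y t] t(1), of i] True phases_D(1)[OF y, of i]
          free_coords_le[of i S] by simp
      then show "cmod (sgn (G (t, y) i) - y i) \<le> 2 * t" using True by (simp add: ext1_def)
    qed
    then show ?thesis using True by simp
  qed (use c_y in auto)
qed

lemma flow_in_phases:
  assumes G: "selects S G" and y: "y \<in> phases S" and t: "0 \<le> t" "t \<le> 1"
  shows "flow S G (t, y) \<in> phases S"
proof (cases "t = 0")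
  case True
  then have "flow S G (t, y) = y" by (auto simp: flow_def)
  then show ?thesis using y by simp
next
  case False
  then show ?thesis
    using G_props(4)[OF G y, of t] t unfolding flow_normalise[OF False] phases_def by simp
qed

lemma flow_0: "flow S G (0, y) = y"
  by (auto simp: flow_def)

text \<open>The end point of \<open>push\<close>, as a function of the phases only; it is the
  homotopy inverse of \<open>snd\<close>.\<close>

definition core :: "nat set \<Rightarrow> (real \<times> vec \<Rightarrow> vec) \<Rightarrow> vec \<Rightarrow> vec \<times> vec" where
  "core S G y = normalise n (free_coords S) (G (1, y)) y"

lemma push_1: "push S G (1, v, y) = core S G y"
  unfolding core_def by (subst push_normalise) (simp_all add: push_vec_def)

lemma core_in_polarS: "selects S G \<Longrightarrow> y \<in> phases S \<Longrightarrow> core S G y \<in> polarS S"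
  unfolding core_def by (rule G_props(4)) auto

lemma continuous_on_G1:
  assumes "selects S G"
  shows "continuous_on (phases S) (\<lambda>y. G (1, y) i)"
proof -
  have "continuous_on (phases S) (\<lambda>y. G (1, y))"
  proof (rule continuous_on_compose2[where f = "\<lambda>y. (1, y)"])
    show "continuous_on ({0..1} \<times> phases S) G" using assms by (simp add: selects_def)
  qed (auto intro!: continuous_intros)
  then show ?thesis by (rule continuous_on_product_then_coordinatewise)
qed

lemma continuous_on_core:
  assumes G: "selects S G"
  shows "continuous_on (phases S) (core S G)"
proof -
  have "continuous_on (phases S) (\<lambda>y i. G (1, y) i / of_real (\<Sum>j\<le>n. cmod (G (1, y) j)))"
  proof (intro continuous_on_coordinatewise_then_product continuous_on_divide continuous_on_G1[OF G]
      continuous_on_of_real continuous_on_sum continuous_on_norm, intro ballI)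
    fix y assume y: "y \<in> phases S"
    then obtain v where "(v, y) \<in> polarS S" by (auto simp: phases_def)
    then obtain k where k: "k \<in> free_coords S" using exists_free_coord by blast
    have "G (1, y) k \<noteq> 0" using G_props(3)[OF G y _ _ k, of 1] by simp
    then have "0 < (\<Sum>j\<le>n. cmod (G (1, y) j))"
      using free_coords_le[OF k] by (intro sum_pos2[of _ k]) auto
    then show "of_real (\<Sum>j\<le>n. cmod (G (1, y) j)) \<noteq> 0" by (simp del: of_real_sum)
  qed
  moreover have "continuous_on (phases S) (\<lambda>y. flow S G (1, y))"
    by (rule continuous_on_compose2[OF continuous_on_flow[OF G]]) (auto intro!: continuous_intros)
  ultimately have "continuous_on (phases S) (\<lambda>y.
      (\<lambda>i. G (1, y) i / of_real (\<Sum>j\<le>n. cmod (G (1, y) j)), flow S G (1, y)))"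
    by (rule continuous_on_Pair)
  then show ?thesis by (simp add: core_def[abs_def] flow_normalise normalise_def)
qed

lemma push_homotopy:
  assumes G: "selects S G"
  shows "homotopic_with (\<lambda>_. True) (top_of_set (polarS S)) (top_of_set (polarS S)) (core S G \<circ> snd) id"
proof -
  have "homotopic_with (\<lambda>_. True) (top_of_set (polarS S)) (top_of_set (polarS S)) id (core S G \<circ> snd)"
  proof (rule homotopic_top_of_setI[OF continuous_on_push[OF G]])
    show "push S G (t, x) \<in> polarS S" if "t \<in> {0..1}" "x \<in> polarS S" for t x
      using push_in_polarS[OF G that(2)] that(1) by simp
    show "push S G (0, x) = id x" if "x \<in> polarS S" for x using push_0[OF G that] by simp
    show "push S G (1, x) = (core S G \<circ> snd) x" for x by (cases x) (simp add: push_1)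
  qed
  then show ?thesis by (rule homotopic_with_symD)
qed

text \<open>Formulated for subsets so that it applies both to the phases of a stratum and to the
  angle image of \<open>Z\<close>.\<close>

lemma flow_homotopy:
  assumes G: "selects S G" and X: "X \<subseteq> phases S" and Y: "Y \<subseteq> phases S" "X \<subseteq> Y"
    and flow: "\<And>t y. 0 < t \<Longrightarrow> t \<le> 1 \<Longrightarrow> y \<in> X \<Longrightarrow> flow S G (t, y) \<in> Y"
  shows "homotopic_with (\<lambda>_. True) (top_of_set X) (top_of_set Y) (\<lambda>y. flow S G (1, y)) id"
proof -
  have "homotopic_with (\<lambda>_. True) (top_of_set X) (top_of_set Y) id (\<lambda>y. flow S G (1, y))"
  proof (rule homotopic_top_of_setI)
    show "continuous_on ({0..1} \<times> X) (flow S G)"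
      by (rule continuous_on_subset[OF continuous_on_flow[OF G]]) (use X in auto)
    show "flow S G (t, y) \<in> Y" if "t \<in> {0..1}" "y \<in> X" for t y
      using flow[of t y] that Y(2) flow_0 by (cases "t = 0") auto
  qed (simp_all add: flow_0)
  then show ?thesis by (rule homotopic_with_symD)
qed

lemma homotopy_equivalence_polarS:
  assumes "S \<subseteq> {0..n}"
  shows "homotopy_equivalence_map (top_of_set (polarS S)) (top_of_set (phases S)) snd"
proof -
  obtain G where G: "selects S G" using selects_exists[OF assms] by blast
  have eq: "(snd \<circ> core S G) y = flow S G (1, y)" for y
    by (simp add: core_def flow_normalise)
  show ?thesis
    unfolding homotopy_equivalence_map_def
  proof (intro conjI exI[of _ "core S G"])
    show "continuous_map (top_of_set (polarS S)) (top_of_set (phases S)) snd"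
      using continuous_on_snd[OF continuous_on_id, of "polarS S"]
      by (auto simp: continuous_map_in_subtopology phases_def)
    show "continuous_map (top_of_set (phases S)) (top_of_set (polarS S)) (core S G)"
      using continuous_on_core[OF G] core_in_polarS[OF G] by (auto simp: continuous_map_in_subtopology)
    show "homotopic_with (\<lambda>x. True) (top_of_set (polarS S)) (top_of_set (polarS S)) (core S G \<circ> snd) id"
      by (rule push_homotopy[OF G])
    have "homotopic_with (\<lambda>x. True) (top_of_set (phases S)) (top_of_set (phases S)) (\<lambda>y. flow S G (1, y)) id"
      by (rule flow_homotopy[OF G]) (use flow_in_phases[OF G] in auto)
    then show "homotopic_with (\<lambda>x. True) (top_of_set (phases S)) (top_of_set (phases S)) (snd \<circ> core S G) id"
      using eq by (simp add: o_def)
  qed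
qed

end

section \<open>The homotopy equivalences\<close>

context snc_very_affine
begin

lemma Zlog_str_subset: "Zlog_str n Z S \<subseteq> Zlog n Z"
  by (auto simp: Zlog_str_def)

lemma Psi_in_polarS_iff:
  assumes z: "z \<in> Zlog n Z"
  shows "Psi z \<in> polarS S \<longleftrightarrow> z \<in> Zlog_str n Z S"
  using ppt_in_Zstr[OF ppt_fst_Psi(2)[OF z], of S] ppt_fst_Psi(1)[OF z] Psi_in_polar[OF z] z
  by (simp add: polarS_def Zlog_str_def)

lemma homeomorphic_maps_Psi:
  "homeomorphic_maps (subtopology (Zlog_top n Z) (Zlog_str n Z S)) (top_of_set (polarS S)) Psi kappa"
proof -
  have top: "topspace (subtopology (Zlog_top n Z) (Zlog_str n Z S)) = Zlog_str n Z S"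
    using Zlog_str_subset topspace_Zlog by auto
  have sub: "polarS S \<subseteq> polar" by (auto simp: polarS_def)
  have k: "kappa x \<in> Zlog_str n Z S" if "x \<in> polarS S" for x
  proof -
    have "x \<in> polar" using that sub by blast
    then show ?thesis using Psi_in_polarS_iff[of "kappa x" S] kappa_in_Zlog Psi_kappa that by simp
  qed
  have "continuous_map (subtopology (Zlog_top n Z) (Zlog_str n Z S)) (top_of_set (polarS S)) Psi"
    using continuous_map_from_subtopology[OF continuous_map_Psi] Psi_in_polarS_iff Zlog_str_subset top
    by (fastforce simp: continuous_map_in_subtopology)
  moreover have "continuous_map (top_of_set (polarS S)) (subtopology (Zlog_top n Z) (Zlog_str n Z S)) kappa"
    using continuous_map_from_subtopology_mono[OF continuous_map_kappa sub] k
    by (auto simp: continuous_map_in_subtopology)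
  ultimately show ?thesis
    unfolding homeomorphic_maps_def top
    using kappa_Psi[OF subsetD[OF Zlog_str_subset]] Psi_kappa[OF subsetD[OF sub]] by simp
qed

lemma ang_image_Zlog_str: "ang n ` Zlog_str n Z S = phases S"
proof -
  have "Psi ` Zlog_str n Z S = polarS S"
  proof
    show "Psi ` Zlog_str n Z S \<subseteq> polarS S" using Psi_in_polarS_iff Zlog_str_subset by blast
    show "polarS S \<subseteq> Psi ` Zlog_str n Z S"
    proof
      fix x assume x: "x \<in> polarS S"
      then have "x \<in> Psi ` Zlog n Z" using Psi_image by (simp add: polarS_def)
      then show "x \<in> Psi ` Zlog_str n Z S" using x Psi_in_polarS_iff by blast
    qed
  qed
  then show ?thesis unfolding phases_def by (simp add: image_image snd_Psi flip: \<open>Psi ` Zlog_str n Z S = polarS S\<close>)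
qed

text \<open>In polar coordinates the extended angle map is the projection
  \<open>snd\<close>.\<close>

lemma homotopy_equivalence_ang:
  assumes "S \<subseteq> {0..n}"
  shows "homotopy_equivalence_map (subtopology (Zlog_top n Z) (Zlog_str n Z S))
    (top_of_set (ang n ` Zlog_str n Z S)) (ang n)"
  unfolding ang_image_Zlog_str
  using homotopy_equivalence_map_compose[OF homotopy_equivalence_map_homeomorphic[OF homeomorphic_maps_Psi]
      homotopy_equivalence_polarS[OF assms]]
  by (rule homotopy_equivalence_map_eq) (simp add: snd_Psi)

section \<open>The very affine space inside its Kato-Nakayama space\<close>

lemma Zlog_str_empty: "Zlog_str n Z {} = Zlog n Z"
  using ZlogD(1) by (auto simp: Zlog_str_def Zstr_def)

lemma free_coords_empty: "free_coords {} = {..n}"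
  using generic_vector by (auto simp: free_coords_def LS_def)

text \<open>Off the boundary every log function is a unit at the point, so the value of the
  homomorphism is forced.\<close>

lemma Zemb_in_Zlog:
  assumes x: "x \<in> Z"
  shows "Zemb n Z x \<in> Zlog n Z"
proof -
  define p where "p = torus_to_P x"
  have p: "p \<in> Zbar n Z" unfolding p_def torus_to_P_eq by (rule ppt_in_Zbar[OF ext1_Z(1)[OF x]])
  have nb: "p \<notin> Zbdry n Z"
    unfolding p_def torus_to_P_eq using in_Zbdry_iff[OF ext1_Z(1)[OF x]] ext1_Z(2)[OF x] by blast
  have nz: "f p \<noteq> 0" if "f \<in> Mon n Z p" for f
    using that nb unfolding Mon_def logfun_on_def by blast
  have "KN_hom n Z p (\<lambda>f. if f \<in> Mon n Z p then sgn (f p) else 1)"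
    unfolding KN_hom_def sgn_complex
  proof (intro conjI ballI impI allI)
    fix f g assume fg: "f \<in> Mon n Z p" "g \<in> Mon n Z p"
    show "(if (\<lambda>q. f q * g q) \<in> Mon n Z p then sgn (f p * g p) else 1) =
        (if f \<in> Mon n Z p then sgn (f p) else 1) * (if g \<in> Mon n Z p then sgn (g p) else 1)"
      using fg Mon_mult[OF fg] by (simp add: sgn_mult)
    show "(if f \<in> Mon n Z p then sgn (f p) else 1) = (if g \<in> Mon n Z p then sgn (g p) else 1)"
      if "same_germ n Z p f g"
      using fg that by (auto simp: same_germ_def)
  qed (use nz in \<open>auto simp: norm_sgn\<close>)
  then show ?thesis using p unfolding Zemb_def Zlog_def p_def[symmetric] sgn_complex by simp
qed

lemma ang_Zemb:
  assumes x: "x \<in> Z"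
  shows "ang n (Zemb n Z x) = angZ n x"
proof
  fix j
  define p where "p = torus_to_P x"
  define h where "h = snd (Zemb n Z x)"
  have ph: "Zemb n Z x = (p, h)" by (simp add: p_def h_def Zemb_def)
  have z: "(p, h) \<in> Zlog n Z" using Zemb_in_Zlog[OF x] ph by simp
  have pe: "p = ppt (ext1 x)" by (simp add: p_def torus_to_P_eq)
  have pc: "p \<in> chart 0" unfolding pe using ext1_Z[OF x] by (intro ppt_in_chart) auto
  show "ang n (Zemb n Z x) j = angZ n x j"
  proof (cases "1 \<le> j \<and> j \<le> n")
    case True
    have r: "ratio j 0 p = x j" using ratio_ppt[of "ext1 x" 0 j] True by (simp add: pe ext1_def)
    have "x j \<noteq> 0" using ext1_Z(2)[OF x, of j] True by (simp add: ext1_def)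
    then have "h (ratio j 0) = sgn (x j)"
      using ZlogD(6)[OF z ratio_Mon[OF _ pc]] r True by simp
    then have "ext1 (ang n (p, h)) j = sgn (x j)"
      using ext1_ang[OF z pc le0, of j] KN_ratio_self[OF z pc le0] True by simp
    then show ?thesis using True by (simp add: ph ext1_def angZ_def sgn_complex)
  qed (auto simp: ang_def angZ_def Let_def)
qed

text \<open>A vector without zero coordinates represents a point of \<open>Z\<close>, and its zeroth
  coordinate is real and positive, so dehomogenising preserves phases. This links the constructions
  for the empty index set with the embedding of \<open>Z\<close>.\<close>

lemma normalise_eq_Psi_Zemb:
  assumes u: "u \<in> MS {}" and nz: "\<And>i. i \<le> n \<Longrightarrow> u i \<noteq> 0" and y: "y 0 = 0" "\<And>i. n < i \<Longrightarrow> y i = 0"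
  shows "normalise n (free_coords {}) u y = Psi (Zemb n Z (dehom u))"
proof -
  have uL: "u \<in> L" using u by (simp add: MS_def LS_def)
  have ux: "u \<in> Lx" using L_Lx[OF uL nz[of 0]] by simp
  obtain r where r: "u 0 = of_real r" "0 < r"
    using u nz[of 0] by (auto simp: MS_def order.strict_iff_order)
  have Z: "dehom u \<in> Z" using dehom_in_Z[OF uL nz] .
  have a: "angZ n (dehom u) i = (if i \<in> free_coords {} \<and> i \<noteq> 0 then sgn (u i) else y i)" for i
    using y r by (auto simp: angZ_def dehom_def free_coords_empty sgn_complex sgn_divide sgn_of_real not_le)
  have f: "fst (Zemb n Z (dehom u)) = ppt u"
    using torus_to_P_dehom[OF uL nz[of 0]] by (simp add: Zemb_def)
  have "of_real (rho i (ppt u)) * ext1 (angZ n (dehom u)) i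
      = u i / of_real (\<Sum>j\<le>n. cmod (u j))" for i
  proof (cases "i \<le> n")
    case True
    have "ext1 (angZ n (dehom u)) i = sgn (u i)"
      using True r a by (auto simp: ext1_def free_coords_empty sgn_of_real)
    then show ?thesis
      unfolding rho_ppt[OF ux] using norm_mult_sgn[of "u i"] by (simp del: of_real_sum)
  next
    case False
    then have "u i = 0" using uL by (simp add: linear_space_def Cn1_def)
    then show ?thesis by (simp add: rho_ppt[OF ux])
  qed
  then show ?thesis
    unfolding normalise_def Psi_def ang_Zemb[OF Z] f using a by auto
qed

lemma phases_empty: "phases {} = ang n ` Zlog n Z"
  using ang_image_Zlog_str[of "{}"] by (simp add: Zlog_str_empty)

lemma angZ_in_phases: "x \<in> Z \<Longrightarrow> angZ n x \<in> phases {}"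
  unfolding phases_empty using ang_Zemb Zemb_in_Zlog by (metis imageI)

lemma ext1_angZ:
  assumes "x \<in> Z" "i \<le> n"
  shows "ext1 x i = of_real (cmod (ext1 x i)) * ext1 (angZ n x) i"
  using assms by (simp add: ext1_def angZ_def sgn_complex norm_mult_sgn)

lemma continuous_on_ext1_coord: "continuous_on X (\<lambda>x :: vec. ext1 x i)"
  using continuous_on_coord by (cases "i = 0") (auto simp: ext1_def)

lemma continuous_on_dehom:
  assumes "\<And>i. continuous_on X (\<lambda>x. f x i)" "\<And>x. x \<in> X \<Longrightarrow> f x 0 \<noteq> 0"
  shows "continuous_on X (\<lambda>x. dehom (f x))"
  unfolding dehom_def
proof (rule continuous_on_coordinatewise_then_product)
  fix i
  have "continuous_on X (\<lambda>x. f x i / f x 0)"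
    using assms by (intro continuous_on_divide) auto
  then show "continuous_on X (\<lambda>x. if 1 \<le> i \<and> i \<le> n then f x i / f x 0 else 0)"
    by (cases "1 \<le> i \<and> i \<le> n") auto
qed

lemma continuous_on_angZ: "continuous_on Z (angZ n)"
  unfolding angZ_def[abs_def] sgn_complex
proof (rule continuous_on_coordinatewise_then_product)
  fix i
  have "continuous_on Z (\<lambda>x. sgn (x i))" if "1 \<le> i \<and> i \<le> n"
    using that by (intro continuous_on_sgn continuous_on_coord) (auto simp: Z_eq torus_def)
  then show "continuous_on Z (\<lambda>x. if 1 \<le> i \<and> i \<le> n then sgn (x i) else 0)"
    by (cases "1 \<le> i \<and> i \<le> n") auto
qed

text \<open>Continuity is visible after \<open>Psi\<close>, where the embedding has an explicit
  formula, and is carried back by \<open>kappa\<close>.\<close>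

lemma continuous_map_Zemb: "continuous_map (top_of_set Z) (Zlog_top n Z) (Zemb n Z)"
proof -
  have Psi_Zemb: "Psi (Zemb n Z x) = (\<lambda>i. of_real (cmod (ext1 x i) / (\<Sum>j\<le>n. cmod (ext1 x j)))
      * ext1 (angZ n x) i, angZ n x)" if x: "x \<in> Z" for x
    unfolding Psi_def ang_Zemb[OF x] using rho_ppt[OF ext1_Z(1)[OF x]]
    by (simp add: Zemb_def torus_to_P_eq)
  have c_a: "continuous_on Z (\<lambda>x. ext1 (angZ n x) i)" for i
    using continuous_on_compose2[OF continuous_on_ext1_coord[of UNIV] continuous_on_angZ] by simp
  have "continuous_on Z (\<lambda>x i. of_real (cmod (ext1 x i) / (\<Sum>j\<le>n. cmod (ext1 x j)))
      * ext1 (angZ n x) i)"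
  proof (intro continuous_on_coordinatewise_then_product continuous_on_mult c_a continuous_on_of_real
      continuous_on_divide continuous_on_norm continuous_on_sum continuous_on_ext1_coord, intro ballI)
    fix x assume "x \<in> Z"
    then show "(\<Sum>j\<le>n. cmod (ext1 x j)) \<noteq> 0" using sum_norm_pos[OF ext1_Z(1)] by force
  qed
  then have "continuous_on Z (\<lambda>x. (\<lambda>i. of_real (cmod (ext1 x i) / (\<Sum>j\<le>n. cmod (ext1 x j)))
      * ext1 (angZ n x) i, angZ n x))"
    using continuous_on_angZ by (rule continuous_on_Pair)
  then have "continuous_on Z (Psi \<circ> Zemb n Z)"
    by (subst continuous_on_cong[OF refl]) (use Psi_Zemb in auto)
  then have "continuous_map (top_of_set Z) (top_of_set polar) (Psi \<circ> Zemb n Z)"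
    using Psi_in_polar Zemb_in_Zlog by (auto simp: continuous_map_in_subtopology)
  from continuous_map_compose[OF this continuous_map_kappa]
  show ?thesis
    by (rule continuous_map_eq) (simp add: kappa_Psi Zemb_in_Zlog)
qed

lemma G_vec:
  assumes "selects {} G" "y \<in> phases {}" "0 < t" "t \<le> 1"
  shows "G (t, y) \<in> MS {}" "G (t, y) \<in> L" "\<And>i. i \<le> n \<Longrightarrow> G (t, y) i \<noteq> 0"
  using G_props(1,3)[OF assms] by (auto simp: MS_def LS_def free_coords_empty)

text \<open>At every positive time the flow lies in the angle image of \<open>Z\<close>, even when
  it starts in the larger image; hence it deforms the latter into the former.\<close>

lemma flow_angZ:
  assumes "selects {} G" "y \<in> phases {}" "0 < t" "t \<le> 1"
  shows "flow {} G (t, y) = angZ n (dehom (G (t, y)))"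
proof -
  note g = G_vec[OF assms]
  have "normalise n (free_coords {}) (G (t, y)) y = Psi (Zemb n Z (dehom (G (t, y))))"
    by (rule normalise_eq_Psi_Zemb[OF g(1)]) (use g(3) phases_D(2,3)[OF assms(2)] in auto)
  then have "flow {} G (t, y) = snd (Psi (Zemb n Z (dehom (G (t, y)))))"
    using flow_normalise[of t "{}" G y] assms(3) by simp
  then show ?thesis using ang_Zemb[OF dehom_in_Z[OF g(2,3)]] by (simp add: snd_Psi)
qed

text \<open>The segment from \<open>ext1 x\<close> to \<open>G (1, angZ n x)\<close> keeps all
  coordinates nonzero, because the first vector is exactly aligned with the phases of
  \<open>x\<close> and the second lies in the open cone of tolerance 1 around them.\<close>

lemma segment_homotopy:
  assumes G: "selects {} G"
  shows "homotopic_with (\<lambda>_. True) (top_of_set Z) (top_of_set Z) (\<lambda>x. dehom (G (1, angZ n x))) id"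
proof -
  define f where "f p = (\<lambda>i. of_real (1 - fst p) * ext1 (snd p) i
      + of_real (fst p) * G (1, angZ n (snd p)) i)" for p
  have nz: "f (t, x) \<in> L \<and> (\<forall>i\<le>n. f (t, x) i \<noteq> 0)" if t: "0 \<le> t" "t \<le> 1" and x: "x \<in> Z" for t x
  proof
    note g = G_vec[OF G angZ_in_phases[OF x] zero_less_one order_refl]
    have near: "near_phase (free_coords {}) 1 (ext1 (angZ n x)) (G (1, angZ n x))"
      by (rule G_props(2)[OF G angZ_in_phases[OF x]]) auto
    show "f (t, x) \<in> L" unfolding f_def fst_conv snd_conv
      using ext1_Z(1)[OF x] g(2) by (intro linear_space_lincomb) (auto simp: Lx_def)
    show "\<forall>i\<le>n. f (t, x) i \<noteq> 0"
    proof (cases "t = 0")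
      case True
      then show ?thesis using ext1_Z(2)[OF x] by (simp add: f_def)
    next
      case False
      then have "0 < t" using t by simp
      have "near_phase (free_coords {}) 1 (ext1 (angZ n x))
          (\<lambda>i. of_real (1 - t) * ext1 x i + of_real t * G (1, angZ n x) i)"
      proof (rule near_phase_aligned[OF near_phase_scale[OF near \<open>0 < t\<close>],
            where r = "\<lambda>i. (1 - t) * cmod (ext1 x i)"], simp, intro conjI)
        fix i assume "i \<in> free_coords {}"
        then have i: "i \<le> n" by (rule free_coords_le)
        show "of_real (1 - t) * ext1 x i
            = of_real ((1 - t) * cmod (ext1 x i)) * ext1 (angZ n x) i"
          using ext1_angZ[OF x i] by (metis mult.assoc of_real_mult)
        show "0 \<le> (1 - t) * cmod (ext1 x i)" using t by simp
        show "cmod (ext1 (angZ n x) i) = 1" by (rule phases_D(1)[OF angZ_in_phases[OF x] i])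
      qed
      from near_phase_nonzero[OF this zero_less_one] show ?thesis
        by (simp add: f_def free_coords_empty)
    qed
  qed
  have "homotopic_with (\<lambda>_. True) (top_of_set Z) (top_of_set Z) id (\<lambda>x. dehom (G (1, angZ n x)))"
  proof (rule homotopic_top_of_setI[where h = "\<lambda>p. dehom (f p)"])
    show "continuous_on ({0..1} \<times> Z) (\<lambda>p. dehom (f p))"
    proof (rule continuous_on_dehom)
      fix i
      have "continuous_on Z (\<lambda>x. G (1, angZ n x) i)"
        by (rule continuous_on_compose2[OF continuous_on_G1[OF G] continuous_on_angZ])
          (use angZ_in_phases in auto)
      then have "continuous_on ({0..1::real} \<times> Z) (\<lambda>p. G (1, angZ n (snd p)) i)"
        by (rule continuous_on_compose2[OF _ continuous_on_snd[OF continuous_on_id]]) auto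
      moreover have "continuous_on ({0..1::real} \<times> Z) (\<lambda>p. ext1 (snd p) i)"
        using continuous_on_subset[OF continuous_on_ext1] by blast
      ultimately show "continuous_on ({0..1} \<times> Z) (\<lambda>p. f p i)"
        unfolding f_def by (intro continuous_on_add continuous_on_mult continuous_on_of_real
            continuous_on_diff continuous_on_const continuous_on_fst continuous_on_id)
    qed (use nz in force)
    show "dehom (f (t, x)) \<in> Z" if "t \<in> {0..1}" "x \<in> Z" for t x
      using nz[of t x] that by (intro dehom_in_Z) auto
  qed (simp_all add: f_def dehom_ext1)
  then show ?thesis by (rule homotopic_with_symD)
qed

lemma continuous_on_dehom_G1:
  assumes G: "selects {} G"
  shows "continuous_on (phases {}) (\<lambda>y. dehom (G (1, y)))"
  using G_vec(3)[OF G] by (intro continuous_on_dehom continuous_on_G1[OF G]) auto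

lemma dehom_G1_in_Z: "selects {} G \<Longrightarrow> y \<in> phases {} \<Longrightarrow> dehom (G (1, y)) \<in> Z"
  using G_vec(2,3)[of G y 1] by (intro dehom_in_Z) auto

text \<open>The inverse sends a phase vector to the point of \<open>Z\<close> represented by the
  selected vector at time 1.\<close>

lemma homotopy_equivalence_angZ:
  "homotopy_equivalence_map (top_of_set Z) (top_of_set (angZ n ` Z)) (angZ n)"
proof -
  obtain G where G: "selects {} G" using selects_exists[of "{}"] by blast
  have sub: "angZ n ` Z \<subseteq> phases {}" using angZ_in_phases by blast
  show ?thesis unfolding homotopy_equivalence_map_def
  proof (intro conjI exI[of _ "\<lambda>y. dehom (G (1, y))"])
    show "continuous_map (top_of_set Z) (top_of_set (angZ n ` Z)) (angZ n)"
      using continuous_on_angZ by (auto simp: continuous_map_in_subtopology)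
    show "continuous_map (top_of_set (angZ n ` Z)) (top_of_set Z) (\<lambda>y. dehom (G (1, y)))"
      using continuous_on_subset[OF continuous_on_dehom_G1[OF G] sub] dehom_G1_in_Z[OF G] sub
      by (auto simp: continuous_map_in_subtopology)
    show "homotopic_with (\<lambda>x. True) (top_of_set Z) (top_of_set Z) ((\<lambda>y. dehom (G (1, y))) \<circ> angZ n) id"
      using segment_homotopy[OF G] by (simp add: o_def)
    have "homotopic_with (\<lambda>_. True) (top_of_set (angZ n ` Z)) (top_of_set (angZ n ` Z)) (\<lambda>y. flow {} G (1, y)) id"
    proof (rule flow_homotopy[OF G sub sub order_refl])
      fix t y assume "0 < t" "t \<le> (1::real)" "y \<in> angZ n ` Z"
      then show "flow {} G (t, y) \<in> angZ n ` Z"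
        using flow_angZ[OF G, of y t] G_vec(2,3)[OF G, of y t] dehom_in_Z sub by (metis imageI subsetD)
    qed
    then show "homotopic_with (\<lambda>x. True) (top_of_set (angZ n ` Z)) (top_of_set (angZ n ` Z))
        (angZ n \<circ> (\<lambda>y. dehom (G (1, y)))) id"
      by (rule homotopic_with_eq) (use flow_angZ[OF G] sub in auto)
  qed
qed

lemma homotopy_equivalence_inclusion:
  "homotopy_equivalence_map (top_of_set (angZ n ` Z)) (top_of_set (ang n ` Zlog n Z)) id"
  unfolding phases_empty[symmetric]
proof -
  obtain G where G: "selects {} G" using selects_exists[of "{}"] by blast
  have sub: "angZ n ` Z \<subseteq> phases {}" using angZ_in_phases by blast
  have flow: "flow {} G (t, y) \<in> angZ n ` Z" if "0 < t" "t \<le> 1" "y \<in> phases {}" for t y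
    using flow_angZ[OF G that(3,1,2)] dehom_in_Z[OF G_vec(2,3)[OF G that(3,1,2)]] by simp
  show "homotopy_equivalence_map (top_of_set (angZ n ` Z)) (top_of_set (phases {})) id"
    unfolding homotopy_equivalence_map_def
  proof (intro conjI exI[of _ "\<lambda>y. flow {} G (1, y)"])
    show "continuous_map (top_of_set (angZ n ` Z)) (top_of_set (phases {})) id"
      using sub by (auto simp: continuous_map_in_subtopology)
    have "continuous_on (phases {}) (\<lambda>y. flow {} G (1, y))"
      by (rule continuous_on_compose2[OF continuous_on_flow[OF G]]) (auto intro!: continuous_intros)
    then show "continuous_map (top_of_set (phases {})) (top_of_set (angZ n ` Z)) (\<lambda>y. flow {} G (1, y))"
      using flow by (auto simp: continuous_map_in_subtopology)
    show "homotopic_with (\<lambda>x. True) (top_of_set (angZ n ` Z)) (top_of_set (angZ n ` Z))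
        ((\<lambda>y. flow {} G (1, y)) \<circ> id) id"
      using flow_homotopy[OF G sub sub order_refl] flow sub by (simp add: subset_iff)
    show "homotopic_with (\<lambda>x. True) (top_of_set (phases {})) (top_of_set (phases {}))
        (id \<circ> (\<lambda>y. flow {} G (1, y))) id"
      using flow_homotopy[OF G order_refl order_refl order_refl] flow sub by (simp add: subset_iff o_def)
  qed
qed

lemma homotopy_equivalence_Zemb:
  "homotopy_equivalence_map (top_of_set Z) (subtopology (Zlog_top n Z) (Zlog n Z)) (Zemb n Z)"
proof -
  obtain G where G: "selects {} G" using selects_exists[of "{}"] by blast
  let ?X = "subtopology (Zlog_top n Z) (Zlog n Z)"
  have X: "?X = Zlog_top n Z" using subtopology_topspace[of "Zlog_top n Z"] by (simp add: topspace_Zlog)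
  have ang_in: "ang n z \<in> phases {}" if "z \<in> Zlog n Z" for z using that phases_empty by blast
  show ?thesis unfolding homotopy_equivalence_map_def
  proof (intro conjI exI[of _ "(\<lambda>y. dehom (G (1, y))) \<circ> ang n"])
    show "continuous_map (top_of_set Z) ?X (Zemb n Z)" unfolding X by (rule continuous_map_Zemb)
    have "continuous_map ?X (top_of_set (phases {})) (ang n)"
      unfolding X using continuous_map_ang ang_in by (auto simp: continuous_map_in_subtopology topspace_Zlog)
    moreover have "continuous_map (top_of_set (phases {})) (top_of_set Z) (\<lambda>y. dehom (G (1, y)))"
      using continuous_on_dehom_G1[OF G] dehom_G1_in_Z[OF G] by (auto simp: continuous_map_in_subtopology)
    ultimately show "continuous_map ?X (top_of_set Z) ((\<lambda>y. dehom (G (1, y))) \<circ> ang n)"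
      by (rule continuous_map_compose)
    show "homotopic_with (\<lambda>x. True) (top_of_set Z) (top_of_set Z)
        ((\<lambda>y. dehom (G (1, y))) \<circ> ang n \<circ> Zemb n Z) id"
      by (rule homotopic_with_eq[OF segment_homotopy[OF G]]) (simp_all add: ang_Zemb)
    have h: "homeomorphic_maps ?X (top_of_set (polarS {})) Psi kappa"
      using homeomorphic_maps_Psi[of "{}"] by (simp add: Zlog_str_empty)
    have kP: "homotopic_with (\<lambda>_. True) ?X ?X (kappa \<circ> Psi) id"
    proof (rule homotopic_with_equal)
      show "continuous_map ?X ?X (kappa \<circ> Psi)"
        using h continuous_map_compose unfolding homeomorphic_maps_def by blast
    qed (simp_all add: topspace_Zlog kappa_Psi)
    \<comment> \<open>Conjugating the push homotopy by the polar homeomorphism; the end map is then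
      recognised as the embedding of the point selected from the angles.\<close>
    have "homotopic_with (\<lambda>_. True) ?X ?X ((kappa \<circ> core {} G) \<circ> (snd \<circ> Psi)) id"
      by (rule homotopic_conj_id[OF push_homotopy[OF G] _ _ kP]) (use h in \<open>auto simp: homeomorphic_maps_def\<close>)
    then show "homotopic_with (\<lambda>x. True) ?X ?X (Zemb n Z \<circ> ((\<lambda>y. dehom (G (1, y))) \<circ> ang n)) id"
    proof (rule homotopic_with_eq)
      fix z assume "z \<in> topspace ?X"
      then have y: "ang n z \<in> phases {}" using ang_in by (simp add: topspace_Zlog)
      have "core {} G (ang n z) = Psi (Zemb n Z (dehom (G (1, ang n z))))"
        unfolding core_def
        by (rule normalise_eq_Psi_Zemb[OF G_vec(1)[OF G y]])
          (use G_vec(3)[OF G y] phases_D(2,3)[OF y] in auto)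
      then show "(Zemb n Z \<circ> ((\<lambda>y. dehom (G (1, y))) \<circ> ang n)) z = ((kappa \<circ> core {} G) \<circ> (snd \<circ> Psi)) z"
        using kappa_Psi[OF Zemb_in_Zlog[OF dehom_G1_in_Z[OF G y]]] by (simp add: snd_Psi)
    qed simp_all
  qed
qed

end

section \<open>Homogenising the affine equations\<close>

lemma sum_atMost_nat_insert_0: "(\<Sum>i\<le>n. f i) = f 0 + (\<Sum>i\<in>{1..n}. f i)" for f :: "nat \<Rightarrow> complex"
  by (simp add: atMost_atLeast0 sum.atLeast_Suc_atMost)

lemma very_affine_if_very_affine_linear:
  assumes "very_affine_linear n Z"
  obtains A where "very_affine n Z A"
proof -
  obtain F :: "(vec \<times> complex) set" where F: "Z \<noteq> {}" "finite F"
    "Z = {x \<in> torus n. \<forall>(a, b) \<in> F. (\<Sum>i\<in>{1..n}. a i * x i) = b}"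
    using assms unfolding very_affine_linear_def by blast
  \<comment> \<open>The equation with data \<open>(a, b)\<close> becomes a linear form whose
    coefficient at index 0 is \<open>- b\<close>, evaluated where the zeroth coordinate is
    1.\<close>
  define A where "A = (\<lambda>(a, b) i. if i = 0 then - b else a i) ` F"
  have "ext1 x \<in> linear_space n A \<longleftrightarrow> (\<forall>(a, b) \<in> F. (\<Sum>i\<in>{1..n}. a i * x i) = b)" if x: "x \<in> torus n" for x
  proof -
    have "ext1 x \<in> Cn1 n" using x by (auto simp: ext1_def torus_def Cn1_def)
    moreover have "(\<Sum>i\<le>n. (if i = 0 then - b else a i) * ext1 x i) = 0 \<longleftrightarrow> (\<Sum>i\<in>{1..n}. a i * x i) = b"
      for a :: vec and b
    proof -
      have "(\<Sum>i\<in>{1..n}. (if i = 0 then - b else a i) * ext1 x i) = (\<Sum>i\<in>{1..n}. a i * x i)"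
        by (intro sum.cong) (auto simp: ext1_def)
      then show ?thesis unfolding sum_atMost_nat_insert_0 by (simp add: ext1_def)
    qed
    ultimately show ?thesis by (simp add: linear_space_def A_def case_prod_unfold)
  qed
  then have "very_affine n Z A"
    using F by unfold_locales (auto simp: A_def)
  then show thesis by (rule that)
qed

theorem theoremB:
  fixes n :: nat and Z :: "vec set"
  assumes "very_affine_linear n Z"
    and "snc_compactifying n Z"
  shows
    "(\<forall>x\<in>Z. ang n (Zemb n Z x) = angZ n x)
     \<and> homotopy_equivalence_map (top_of_set Z) (subtopology (Zlog_top n Z) (Zlog n Z)) (Zemb n Z)
     \<and> homotopy_equivalence_map (top_of_set (angZ n ` Z)) (top_of_set (ang n ` Zlog n Z)) id
     \<and> homotopy_equivalence_map (top_of_set Z) (top_of_set (angZ n ` Z)) (angZ n)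
     \<and> homotopy_equivalence_map (subtopology (Zlog_top n Z) (Zlog n Z))
          (top_of_set (ang n ` Zlog n Z)) (ang n)
     \<and> (\<forall>S. S \<subset> {0..n} \<and> Zstr n Z S \<noteq> {} \<longrightarrow>
          homotopy_equivalence_map (subtopology (Zlog_top n Z) (Zlog_str n Z S))
            (top_of_set (ang n ` Zlog_str n Z S)) (ang n))
     \<and> (\<forall>S S'. S \<subseteq> S' \<and> S' \<subseteq> {0..n} \<longrightarrow>
          Zlog_str n Z S' \<subseteq> Zlog_str n Z S \<and> Zlog_str n Z S \<subseteq> Zlog n Z
          \<and> ang n ` Zlog_str n Z S' \<subseteq> ang n ` Zlog_str n Z S
          \<and> ang n ` Zlog_str n Z S \<subseteq> ang n ` Zlog n Z)"
proof -
  obtain A where "very_affine n Z A" using very_affine_if_very_affine_linear[OF assms(1)] .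
  then interpret very_affine n Z A .
  interpret snc_very_affine n Z A using assms(2) by unfold_locales
  have mono: "Zlog_str n Z S' \<subseteq> Zlog_str n Z S" if "S \<subseteq> S'" for S S'
    using that by (auto simp: Zlog_str_def Zstr_def)
  show ?thesis
  proof (intro conjI allI impI ballI)
    show "homotopy_equivalence_map (subtopology (Zlog_top n Z) (Zlog n Z))
          (top_of_set (ang n ` Zlog n Z)) (ang n)"
      using homotopy_equivalence_ang[of "{}"] by (simp add: Zlog_str_empty)
    show "homotopy_equivalence_map (subtopology (Zlog_top n Z) (Zlog_str n Z S))
            (top_of_set (ang n ` Zlog_str n Z S)) (ang n)" if "S \<subset> {0..n} \<and> Zstr n Z S \<noteq> {}" for S
      using that by (intro homotopy_equivalence_ang) blast
  qed (auto intro: ang_Zemb homotopy_equivalence_Zemb homotopy_equivalence_inclusion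
      homotopy_equivalence_angZ dest: subsetD[OF mono] subsetD[OF Zlog_str_subset])
qed

end
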